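(* Let $1\le\gamma\le p_0<\infty$. Assume that $T$ is an operator acting from $\bigcup_{w\in A_{p_0/\gamma}}L_{p_0,w}(\mathbb R^n)$ into the space of measurable functions satisfying $$\|Tf|L_{p_0,w}(\mathbb R^n)\|\le c_1\|f|L_{p_0,w}(\mathbb R^n)\|\qquad(\mathrm H)$$ for all $f\in L_{p_0,w}(\mathbb R^n)$ and $w\in A_{p_0/\gamma}$, with a constant $c_1$ independent of $f$ and depending on $w$ only through $[w]_{A_{p_0/\gamma}}$. (No linearity of $T$ is assumed.) Then for every $\gamma<p<\infty$ (and also $p=\gamma$ if $p_0=\gamma$), every $-n/p\le r<0$ and every $w\in A_{p/\gamma}$, $T$ is well-defined on $L^r_p(w,\mathbb R^n)$ by restriction (i.e. $L^r_p(w,\mathbb R^n)$ is contained in the domain $\bigcup_{u\in A_{p_0/\gamma}}L_{p_0,u}(\mathbb R^n)$) and, moreover, $$\|Tf|L^r_p(w,\mathbb R^n)\|\le c_2\|f|L^r_p(w,\mathbb R^n)\|\qquad(1)$$ for all $f\in L^r_p(w,\mathbb R^n)$. Furthermore, for $p$ as before and every $w\in A_{p/\gamma}\cap RH_\sigma$ (with $1<\sigma<\infty$), if $-n/p\le r\le -n/(p\sigma)$, then $T$ is well-defined on $L^r_p(\lambda,w,\mathbb R^n)$ by restriction and, moreover, $$\|Tf|L^r_p(\lambda,w,\mathbb R^n)\|\le c_3\|f|L^r_p(\lambda,w,\mathbb R^n)\|\qquad(2)$$ for all $f\in L^r_p(\lambda,w,\mathbb R^n)$. The constants $c_2$ and $c_3$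 do not depend on $f$ but may depend on the weight $w$ and the involved parameters. If $T$ satisfies instead of (H) the weak-type assumption $\|Tf|WL_{p_0,w}(\mathbb R^n)\|\le c_1\|f|L_{p_0,w}(\mathbb R^n)\|$ (for all such $f$, $w$, with the same dependence of $c_1$), then (1) and (2) are replaced by their weak-type counterparts, that is, $\|Tf|WL^r_p(w,\mathbb R^n)\|$ and $\|Tf|WL^r_p(\lambda,w,\mathbb R^n)\|$ appear at the left-hand side of the inequalities.
   Context: Cubes in $\mathbb R^n$ have sides parallel to the axes. A weight is a nonnegative locally integrable function; $w(E)=\int_E w$, $|E|$ is Lebesgue measure, $p'$ is the conjugate exponent. For $0<p<\infty$, $\|f|L_{p,w}(E)\|=(\int_E|f|^pw)^{1/p}$. Muckenhoupt classes: for $1<p<\infty$ and $w>0$ a.e. locally integrable, $w\in A_p$ iff $[w]_{A_p}=\sup_Q\frac{w(Q)}{|Q|}\big(\frac{w^{1-p'}(Q)}{|Q|}\big)^{p-1}<\infty$; $w\in A_1$ iff there is $c$ with $w(Q)/|Q|\le c\,w(x)$ for a.e. $x\in Q$ and every cube $Q$ ($[w]_{A_1}$ is the least such $c$). Reverse Hölder class: for $1<\sigma<\infty$, $w\in RH_\sigma$ iff there is $c$ with $\big(|Q|^{-1}\int_Q w^\sigma\big)^{1/\sigma}\le c\,|Q|^{-1}\int_Q w$ for all cubes $Q$. Morrey spaces: for $0<p<\infty$, $-n/p\le r<0$ and a weight $w$, the spaces $L^r_p(w,\mathbb R^n)$ and $L^r_p(\lambda,w,\mathbb R^n)$ consist of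 the (classes of) measurable complex functions $f$ on $\mathbb R^n$ for which, respectively, the following quasinorms are finite (suprema over all cubes; here $\lambda$ is just a label for the second type of space): $$\|f|L^r_p(w,\mathbb R^n)\|=\sup_Q w(Q)^{-(1/p+r/n)}\|f|L_{p,w}(Q)\|,\qquad \|f|L^r_p(\lambda,w,\mathbb R^n)\|=\sup_Q |Q|^{-(1/p+r/n)}\|f|L_{p,w}(Q)\|.$$ Weak versions: $$\|f|WL^r_p(w,\mathbb R^n)\|=\sup_Q\sup_{t>0}w(Q)^{-(1/p+r/n)}\,t\,w(\{x\in Q:|f(x)|>t\})^{1/p},$$ $$\|f|WL^r_p(\lambda,w,\mathbb R^n)\|=\sup_Q\sup_{t>0}|Q|^{-(1/p+r/n)}\,t\,w(\{x\in Q:|f(x)|>t\})^{1/p},$$ and $\|f|WL_{p,w}(\mathbb R^n)\|=\sup_{t>0}t\,w(\{x\in\mathbb R^n:|f(x)|>t\})^{1/p}$ (the case $r=-n/p$). *)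

theory Defs
  imports "HOL-Analysis.Analysis"
begin

text \<open>
  Elements of the function spaces below are represented by measurable functions; an operator on
  the corresponding spaces of classes modulo equality almost everywhere is a function on
  representatives that respects this equality (see \<open>operator_on\<close>).
  All (quasi)norms take values in the extended nonnegative reals, so that the spaces are the
  sets of measurable functions of finite (quasi)norm.
\<close>

definition cubes :: "(real ^ 'n) set set" where
  "cubes = {cbox a (\<chi> i. a $ i + l) | a l. 0 < l}"

text \<open>Real powers of extended nonnegative reals; only meant for exponents \<open>a > 0\<close>.\<close>

definition epowr :: "ennreal \<Rightarrow> real \<Rightarrow> ennreal" where
  "epowr x a = (if x = top then top else ennreal (enn2real x powr a))"

definition conj_exponent :: "real \<Rightarrow> real" where
  "conj_exponent p = p / (p - 1)"

definition locally_integrable :: "(real ^ 'n \<Rightarrow> real) \<Rightarrow> bool" where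
  "locally_integrable w \<longleftrightarrow> (\<forall>K. compact K \<longrightarrow> set_integrable lebesgue K w)"

definition weight :: "(real ^ 'n \<Rightarrow> real) \<Rightarrow> bool" where
  "weight w \<longleftrightarrow> (\<forall>x. 0 \<le> w x) \<and> locally_integrable w"

definition wmass :: "(real ^ 'n \<Rightarrow> real) \<Rightarrow> (real ^ 'n) set \<Rightarrow> ennreal" where
  "wmass w E = set_nn_integral lebesgue E (\<lambda>x. ennreal (w x))"

definition avg :: "(real ^ 'n \<Rightarrow> real) \<Rightarrow> (real ^ 'n) set \<Rightarrow> ennreal" where
  "avg w Q = wmass w Q / emeasure lebesgue Q"

text \<open>
  The constant \<open>[w]\<close> of the class \<open>A_p\<close>, for \<open>1 \<le> p\<close>. For \<open>p = 1\<close> the infimum is attained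
  if it is finite, and it is \<open>top\<close> if there is no admissible \<open>c\<close>.
\<close>

definition Ap_const :: "real \<Rightarrow> (real ^ 'n \<Rightarrow> real) \<Rightarrow> ennreal" where
  "Ap_const p w =
     (if p = 1
      then Inf {ennreal c | c. 0 \<le> c \<and>
             (\<forall>Q\<in>cubes. AE x in lebesgue. x \<in> Q \<longrightarrow> avg w Q \<le> ennreal (c * w x))}
      else (SUP Q\<in>cubes. avg w Q * epowr (avg (\<lambda>x. w x powr (1 - conj_exponent p)) Q) (p - 1)))"

definition Muckenhoupt :: "real \<Rightarrow> (real ^ 'n \<Rightarrow> real) set" where
  "Muckenhoupt p = {w. weight w \<and> (AE x in lebesgue. 0 < w x) \<and> Ap_const p w < top}"

definition RevHolder :: "real \<Rightarrow> (real ^ 'n \<Rightarrow> real) set" where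
  "RevHolder \<sigma> = {w. weight w \<and>
     (\<exists>c::real. \<forall>Q\<in>cubes. epowr (avg (\<lambda>x. w x powr \<sigma>) Q) (1 / \<sigma>) \<le> ennreal c * avg w Q)}"

definition Lp_norm ::
    "real \<Rightarrow> (real ^ 'n \<Rightarrow> real) \<Rightarrow> (real ^ 'n) set \<Rightarrow> (real ^ 'n \<Rightarrow> complex) \<Rightarrow> ennreal" where
  "Lp_norm p w E f = epowr (wmass (\<lambda>x. norm (f x) powr p * w x) E) (1 / p)"

definition weak_Lp_norm ::
    "real \<Rightarrow> (real ^ 'n \<Rightarrow> real) \<Rightarrow> (real ^ 'n) set \<Rightarrow> (real ^ 'n \<Rightarrow> complex) \<Rightarrow> ennreal" where
  "weak_Lp_norm p w E f =
     (SUP t\<in>{0::real<..}. ennreal t * epowr (wmass w {x \<in> E. t < norm (f x)}) (1 / p))"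

definition Lp_space :: "real \<Rightarrow> (real ^ 'n \<Rightarrow> real) \<Rightarrow> (real ^ 'n \<Rightarrow> complex) set" where
  "Lp_space p w = {f \<in> borel_measurable lebesgue. Lp_norm p w UNIV f < top}"

text \<open>
  The two Morrey scales differ only in the set function \<open>\<mu>\<close> in the factor \<open>\<mu>(Q)\<close> raised to the
  power \<open>-(1/p + r/n)\<close>: it is \<open>w(Q)\<close> for the first one and \<open>|Q|\<close> for the second one. This factor
  is a power of a real number, which is the intended one because \<open>0 < \<mu>(Q) < \<infinity>\<close> for all weights
  that are positive almost everywhere.
\<close>

definition morrey_factor :: "real \<Rightarrow> real \<Rightarrow> ((real ^ 'n) set \<Rightarrow> ennreal) \<Rightarrow> (real ^ 'n) set \<Rightarrow> ennreal" where
  "morrey_factor p r \<mu> Q = ennreal (enn2real (\<mu> Q) powr (- (1 / p + r / real CARD('n))))"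

definition morrey_norm ::
    "real \<Rightarrow> real \<Rightarrow> (real ^ 'n \<Rightarrow> real) \<Rightarrow> (real ^ 'n \<Rightarrow> complex) \<Rightarrow> ennreal" where
  "morrey_norm p r w f = (SUP Q\<in>cubes. morrey_factor p r (wmass w) Q * Lp_norm p w Q f)"

definition lam_morrey_norm ::
    "real \<Rightarrow> real \<Rightarrow> (real ^ 'n \<Rightarrow> real) \<Rightarrow> (real ^ 'n \<Rightarrow> complex) \<Rightarrow> ennreal" where
  "lam_morrey_norm p r w f =
     (SUP Q\<in>cubes. morrey_factor p r (emeasure lebesgue) Q * Lp_norm p w Q f)"

definition weak_morrey_norm ::
    "real \<Rightarrow> real \<Rightarrow> (real ^ 'n \<Rightarrow> real) \<Rightarrow> (real ^ 'n \<Rightarrow> complex) \<Rightarrow> ennreal" where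
  "weak_morrey_norm p r w f =
     (SUP Q\<in>cubes. morrey_factor p r (wmass w) Q * weak_Lp_norm p w Q f)"

definition weak_lam_morrey_norm ::
    "real \<Rightarrow> real \<Rightarrow> (real ^ 'n \<Rightarrow> real) \<Rightarrow> (real ^ 'n \<Rightarrow> complex) \<Rightarrow> ennreal" where
  "weak_lam_morrey_norm p r w f =
     (SUP Q\<in>cubes. morrey_factor p r (emeasure lebesgue) Q * weak_Lp_norm p w Q f)"

definition morrey_space ::
    "real \<Rightarrow> real \<Rightarrow> (real ^ 'n \<Rightarrow> real) \<Rightarrow> (real ^ 'n \<Rightarrow> complex) set" where
  "morrey_space p r w = {f \<in> borel_measurable lebesgue. morrey_norm p r w f < top}"

definition lam_morrey_space ::
    "real \<Rightarrow> real \<Rightarrow> (real ^ 'n \<Rightarrow> real) \<Rightarrow> (real ^ 'n \<Rightarrow> complex) set" where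
  "lam_morrey_space p r w = {f \<in> borel_measurable lebesgue. lam_morrey_norm p r w f < top}"

text \<open>
  A (not necessarily linear) operator from the classes of functions in \<open>D\<close> into the classes of
  measurable functions. Values of \<open>T\<close> outside \<open>D\<close> are irrelevant.
\<close>

definition operator_on ::
    "(real ^ 'n \<Rightarrow> complex) set \<Rightarrow> ((real ^ 'n \<Rightarrow> complex) \<Rightarrow> (real ^ 'n \<Rightarrow> complex)) \<Rightarrow> bool" where
  "operator_on D T \<longleftrightarrow>
     (\<forall>f\<in>D. T f \<in> borel_measurable lebesgue) \<and>
     (\<forall>f\<in>D. \<forall>g\<in>D. (AE x in lebesgue. f x = g x) \<longrightarrow> (AE x in lebesgue. T f x = T g x))"

definition Lp_union :: "real \<Rightarrow> real \<Rightarrow> (real ^ 'n \<Rightarrow> complex) set" where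
  "Lp_union q p = (\<Union>w\<in>Muckenhoupt q. Lp_space p w)"

end

theory Submission
  imports Defs
begin

text \<open>
  Write \<open>F = |f|^\<gamma>\<close>, \<open>G = |T f|^\<gamma>\<close>, \<open>q = p / \<gamma>\<close> and \<open>q\<^sub>0 = p\<^sub>0 / \<gamma>\<close>, so that the
  hypothesis compares \<open>G\<close> with \<open>F\<close> in weighted Lebesgue norms with exponent \<open>q\<^sub>0\<close> and
  weights from the Muckenhoupt class of index \<open>q\<^sub>0\<close>.
  Rubio de Francia extrapolation (from Muckenhoupt's theorem, with Lerner's proof by weighted maximal
  functions) turns this into a comparison with exponent \<open>q\<close> and weights of index \<open>q\<close>. The Morrey
  norm on a cube \<open>Q\<close> is then reached by the weight \<open>v w\<close>, where \<open>v = \<Sum>\<^sub>j a\<^sub>j 1\<close> over the dilated cubes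
  \<open>2^j Q\<close> with \<open>a\<^sub>j = \<mu>(2^j Q)^(-\<theta>) \<beta>^j\<close> and \<open>\<theta> = 1 + r p / n\<close>: the factor \<open>\<beta>^j\<close> makes
  \<open>\<integral> F^q v w\<close> bounded by the Morrey norm, while growth of \<open>w(2^j Q) \<mu>(2^j Q)^(-\<theta>)\<close>, which follows from
  reverse doubling (of \<open>w\<close>, or of \<open>w^\<sigma>\<close> in the reverse Hoelder case), makes \<open>v\<close> an \<open>A\<^sub>1\<close> weight with
  respect to \<open>w dx\<close>, so that \<open>v w\<close> stays in the class of \<open>w\<close> uniformly in \<open>Q\<close>. The weak-type case is the
  strong one for \<open>t 1\<close> on \<open>{|T f| > t}\<close> in place of \<open>T f\<close>.
\<close>

subsection \<open>Powers of extended nonnegative reals\<close>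

text \<open>A Morrey norm is a supremum over cubes, and each cube brings its own auxiliary weight,
  so the constants must survive infinitely many weights. Hence every bound for the maximal function
  and every step of the extrapolation depends on a weight only through an upper bound for its
  Muckenhoupt constant. Extrapolation is organized around pairs \<open>F\<close>, \<open>G\<close>
  instead of an operator, because no linearity is available: for \<open>F\<close> and a dual test
  function, the weight \<open>H powr (1 - q0) * V\<close> is built from Rubio de Francia majorants
  \<open>H\<close> of \<open>F\<close> and \<open>V\<close> of the test function. It treats
  \<open>q\<close> below and above \<open>q0\<close> alike, and it also provides the membership of
  \<open>F\<close> in the domain of the operator. For \<open>q = 1\<close> there is no dual
  exponent; this case occurs only with \<open>q0 = 1\<close>, where localization alone changes the
  weight. The upper restrictions on \<open>r\<close> enter through \<theta>: \<open>r < 0\<close>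
  means \<theta> < 1, so that \<open>w(Q)^(1 - \<theta>)\<close> grows geometrically over dilates,
  and \<open>r \<le> -n/(p \<sigma>)\<close> means \<theta> \<le> 1 - 1/\<sigma>, the range in which
  masses of \<open>w powr \<sigma>\<close> control the growth of
  \<open>w(Q) |Q|^(-\<theta>)\<close>.\<close>

lemma epowr_ennreal: "0 \<le> x \<Longrightarrow> epowr (ennreal x) a = ennreal (x powr a)"
  by (simp add: epowr_def)

lemma epowr_top [simp]: "epowr top a = top"
  by (simp add: epowr_def)

lemma epowr_0 [simp]: "epowr 0 a = 0"
  by (simp add: epowr_def)

lemma epowr_mono:
  assumes "x \<le> y" "0 < a" shows "epowr x a \<le> epowr y a"
proof (cases "y = top")
  case False
  then obtain v u where "y = ennreal v" "0 \<le> v" "x = ennreal u" "0 \<le> u"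
    using assms by (metis ennreal_cases top.extremum_uniqueI)
  then show ?thesis using assms
    by (simp add: epowr_ennreal powr_mono2 ennreal_leI)
qed simp

lemma epowr_mult:
  assumes "0 < a" shows "epowr (x * y) a = epowr x a * epowr y a"
proof (cases "x = 0 \<or> y = 0")
  case True then show ?thesis by auto
next
  case nz: False
  then have p: "x \<noteq> 0" "y \<noteq> 0" by auto
  have nz': "epowr z a \<noteq> 0" if "z \<noteq> 0" for z
    using that by (cases z) (auto simp: epowr_ennreal)
  show ?thesis
  proof (cases "x = top \<or> y = top")
    case True
    then show ?thesis using p nz'[OF p(1)] nz'[OF p(2)]
      by (auto simp: ennreal_mult_top ennreal_top_mult)
  next
    case False
    then obtain u v where "x = ennreal u" "0 \<le> u" "y = ennreal v" "0 \<le> v"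
      by (metis ennreal_cases)
    then show ?thesis
      by (simp add: epowr_ennreal powr_mult flip: ennreal_mult)
  qed
qed

lemma epowr_epowr: "epowr (epowr x a) b = epowr x (a * b)"
  by (cases x) (simp_all add: epowr_ennreal powr_powr)

lemma epowr_one [simp]: "epowr x 1 = x"
  by (cases x) (simp_all add: epowr_ennreal)

lemma epowr_one_left [simp]: "epowr 1 a = 1"
  using epowr_ennreal[of 1 a] by simp

lemma epowr_add: "epowr x (a + b) = epowr x a * epowr x b"
  by (cases x) (simp_all add: epowr_ennreal powr_add ennreal_mult ennreal_top_mult)

lemma epowr_eq_0_iff [simp]: "epowr x a = 0 \<longleftrightarrow> x = 0"
  by (cases x) (auto simp: epowr_ennreal)

lemma epowr_eq_top_iff [simp]: "epowr x a = top \<longleftrightarrow> x = top"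
  by (simp add: epowr_def)

lemma epowr_less_top_iff [simp]: "epowr x a < top \<longleftrightarrow> x < top"
  by (simp add: epowr_def less_top)

lemma epowr_le_iff:
  assumes "0 < a" shows "epowr x a \<le> epowr y a \<longleftrightarrow> x \<le> y"
proof
  assume "epowr x a \<le> epowr y a"
  from epowr_mono[OF this, of "1/a"] assms show "x \<le> y"
    by (simp add: epowr_epowr)
qed (use assms in \<open>auto intro: epowr_mono\<close>)

lemma epowr_le_swap:
  assumes "0 < a" shows "epowr x a \<le> y \<longleftrightarrow> x \<le> epowr y (1/a)"
  using epowr_le_iff[of a x "epowr y (1/a)"] assms by (simp add: epowr_epowr)

lemma measurable_epowr [measurable (raw)]:
  "f \<in> borel_measurable M \<Longrightarrow> (\<lambda>x. epowr (f x) a) \<in> borel_measurable M"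
proof -
  assume [measurable]: "f \<in> borel_measurable M"
  have "{x \<in> space M. f x = top} \<in> sets M" by measurable
  then show ?thesis unfolding epowr_def by (intro measurable_If) auto
qed

subsection \<open>Cubes\<close>

text \<open>The parameters are the centre and half the side length, so that concentric dilates are
  multiples of \<open>h\<close>; this is why volumes appear as powers of \<open>2*h\<close>.\<close>

definition cub :: "real ^ 'n \<Rightarrow> real \<Rightarrow> (real ^ 'n) set" where
  "cub c h = {x. \<forall>i. \<bar>x $ i - c $ i\<bar> \<le> h}"

lemma mem_cub: "x \<in> cub c h \<longleftrightarrow> (\<forall>i. \<bar>x $ i - c $ i\<bar> \<le> h)"
  by (simp add: cub_def)

lemma cub_cbox: "cub c h = cbox (\<chi> i. c $ i - h) (\<chi> i. c $ i + h)"
  by (auto simp: mem_cub mem_box_cart abs_le_iff algebra_simps)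

lemma cubes_eq: "cubes = {cub c h | c h. 0 < h}"
proof -
  have "\<exists>c h. cbox a (\<chi> i. a $ i + l) = cub c h \<and> 0 < h" if "0 < l" for a :: "real^'n" and l
  proof -
    have "cbox a (\<chi> i. a $ i + l) = cub (\<chi> i. a $ i + l/2) (l/2)"
      unfolding cub_cbox by (simp add: algebra_simps)
    then show ?thesis using that by (metis half_gt_zero)
  qed
  moreover have "\<exists>a l. cub c h = cbox a (\<chi> i. a $ i + l) \<and> 0 < l" if "0 < h" for c :: "real^'n" and h
    unfolding cub_cbox using that by (intro exI[of _ "\<chi> i. c $ i - h"] exI[of _ "2*h"]) (simp add: add.commute)
  ultimately show ?thesis unfolding cubes_def by blast
qed

lemma cub_in_cubes: "0 < h \<Longrightarrow> cub c h \<in> cubes"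
  by (auto simp: cubes_eq)

lemma cub_lebesgue [measurable, simp]: "cub c h \<in> sets lebesgue"
  by (simp add: cub_cbox)

lemma compact_cub: "compact (cub c h)"
  by (simp add: cub_cbox)

lemma emeasure_cub:
  assumes "0 \<le> h" shows "emeasure lebesgue (cub (c :: real^'n) h) = ennreal ((2*h) ^ CARD('n))"
proof -
  have "emeasure lebesgue (cub c h) = ennreal (measure lebesgue (cub c h))"
    by (rule emeasure_eq_ennreal_measure) (simp add: cub_cbox emeasure_lborel_cbox_eq)
  also have "measure lebesgue (cub c h) = (2*h) ^ CARD('n)"
    unfolding cub_cbox using assms
    by (subst measure_completion) (auto simp: content_cbox_cart interval_ne_empty_cart)
  finally show ?thesis .
qed

lemma cub_mono: "h \<le> h' \<Longrightarrow> cub c h \<subseteq> cub c h'"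
  unfolding cub_def using order_trans by blast

lemma center_in_cub: "0 \<le> h \<Longrightarrow> c \<in> cub c h"
  by (simp add: mem_cub)

text \<open>In the maximum norm a cube of half side \<open>h\<close> has diameter
  \<open>2 * h\<close>, so a cube that touches another one sticks out of it by at most that much.
  All inclusions between dilates below come from this.\<close>

lemma cub_subset:
  assumes "x \<in> cub c h" "x \<in> cub c' h'" "2 * h + h' \<le> h''"
  shows "cub c h \<subseteq> cub c' h''"
proof
  fix y assume y: "y \<in> cub c h"
  show "y \<in> cub c' h''" unfolding mem_cub
  proof
    fix i
    have "\<bar>x$i - c$i\<bar> \<le> h" "\<bar>y$i - c$i\<bar> \<le> h" "\<bar>x$i - c'$i\<bar> \<le> h'"
      using assms y by (auto simp: mem_cub)
    then show "\<bar>y$i - c'$i\<bar> \<le> h''" using assms(3) by linarith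
  qed
qed

lemma ex_cub: "\<exists>k::nat. x \<in> cub c (2 ^ k * h)" if "0 < h" for x c :: "real^'n"
proof -
  obtain k where k: "norm (x - c) / h < 2 ^ k"
    using real_arch_pow[of 2 "norm (x - c) / h"] by auto
  have "\<bar>x$i - c$i\<bar> \<le> 2^k * h" for i
    using component_le_norm_cart[of "x - c" i] k that by (simp add: field_simps)
  then show ?thesis by (auto simp: mem_cub)
qed

subsection \<open>Hoelder's inequality\<close>

lemma young_powr:
  fixes a b :: real assumes "0 \<le> a" "0 \<le> b" "0 < \<alpha>" "0 < \<beta>" "\<alpha> + \<beta> = 1"
  shows "a powr \<alpha> * b powr \<beta> \<le> \<alpha> * a + \<beta> * b"
  using Youngs_inequality_0[of \<alpha> \<beta> a b] assms by (cases "a = 0 \<or> b = 0") auto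

text \<open>By homogeneity it suffices to integrate Young's inequality for \<open>f / A\<close> and
  \<open>g / B\<close>, where \<open>A\<close> and \<open>B\<close> are the integrals; zero and
  infinite integrals are treated apart. Powers with sum one, in place of conjugate exponents, fit
  the symmetric form of the weight conditions.\<close>

lemma holder_epowr:
  fixes f g :: "'a \<Rightarrow> ennreal"
  assumes [measurable]: "f \<in> borel_measurable M" "g \<in> borel_measurable M"
    and ab: "0 < \<alpha>" "0 < \<beta>" "\<alpha> + \<beta> = 1"
  shows "(\<integral>\<^sup>+x. epowr (f x) \<alpha> * epowr (g x) \<beta> \<partial>M)
           \<le> epowr (\<integral>\<^sup>+x. f x \<partial>M) \<alpha> * epowr (\<integral>\<^sup>+x. g x \<partial>M) \<beta>"
proof -
  let ?F = "\<integral>\<^sup>+x. f x \<partial>M" and ?G = "\<integral>\<^sup>+x. g x \<partial>M"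
  show ?thesis
  proof (cases "?F = 0 \<or> ?G = 0")
    case True
    then have "AE x in M. epowr (f x) \<alpha> * epowr (g x) \<beta> = 0"
      by (auto simp: nn_integral_0_iff_AE)
    then have "(\<integral>\<^sup>+x. epowr (f x) \<alpha> * epowr (g x) \<beta> \<partial>M) = 0"
      by (subst nn_integral_0_iff_AE) auto
    then show ?thesis by simp
  next
    case nz: False
    show ?thesis
    proof (cases "?F = top \<or> ?G = top")
      case True
      then show ?thesis using nz by (auto simp: ennreal_mult_top ennreal_top_mult)
    next
      case False
      then obtain A B where A: "?F = ennreal A" "0 \<le> A" and B: "?G = ennreal B" "0 \<le> B"
        by (metis ennreal_cases)
      have AB: "0 < A" "0 < B" using nz A B by (auto simp: less_le)
      \<comment> \<open>Young's inequality for the normalized functions; the bracket on the right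
        integrates to \<alpha> + \<beta> = 1.\<close>
      have pt: "epowr (f x) \<alpha> * epowr (g x) \<beta> \<le> ennreal (A powr \<alpha> * B powr \<beta>) * 
                 (ennreal (\<alpha> / A) * f x + ennreal (\<beta> / B) * g x)" for x
      proof (cases "f x = top \<or> g x = top")
        case True
        then have "ennreal (\<alpha> / A) * f x + ennreal (\<beta> / B) * g x = top"
          using AB ab by (auto simp: ennreal_mult_top)
        moreover have "ennreal (A powr \<alpha> * B powr \<beta>) \<noteq> 0" using AB by simp
        ultimately show ?thesis by (simp only: ennreal_mult_top top_greatest if_False)
      next
        case False
        then obtain u v where u: "f x = ennreal u" "0 \<le> u" and v: "g x = ennreal v" "0 \<le> v"
          by (metis ennreal_cases)
        have "u powr \<alpha> * v powr \<beta> = (A powr \<alpha> * B powr \<beta>) * ((u/A) powr \<alpha> * (v/B) powr \<beta>)"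
          using AB u v by (simp add: powr_divide)
        also have "\<dots> \<le> (A powr \<alpha> * B powr \<beta>) * (\<alpha> * (u/A) + \<beta> * (v/B))"
          by (intro mult_left_mono young_powr) (use AB u v ab in auto)
        finally show ?thesis using u v AB ab
          by (simp add: epowr_ennreal ennreal_leI flip: ennreal_mult ennreal_plus)
      qed
      have "(\<integral>\<^sup>+x. epowr (f x) \<alpha> * epowr (g x) \<beta> \<partial>M) \<le>
          (\<integral>\<^sup>+x. ennreal (A powr \<alpha> * B powr \<beta>) * 
                 (ennreal (\<alpha> / A) * f x + ennreal (\<beta> / B) * g x) \<partial>M)"
        by (intro nn_integral_mono pt)
      also have "\<dots> = ennreal (A powr \<alpha> * B powr \<beta>) * (ennreal (\<alpha> / A) * ?F + ennreal (\<beta> / B) * ?G)"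
        by (simp add: nn_integral_cmult nn_integral_add)
      also have "\<dots> = ennreal (A powr \<alpha> * B powr \<beta>)"
        using A B AB ab by (simp flip: ennreal_mult ennreal_plus)
      also have "\<dots> = epowr ?F \<alpha> * epowr ?G \<beta>"
        using A B by (simp add: epowr_ennreal ennreal_mult)
      finally show ?thesis .
    qed
  qed
qed

lemma sigma_finite_lebesgue: "sigma_finite_measure (lebesgue :: 'a::euclidean_space measure)"
proof
  obtain A :: "'a set set" where A: "countable A" "A \<subseteq> sets lborel" "\<Union>A = space lborel" 
     "\<forall>a\<in>A. emeasure lborel a \<noteq> \<infinity>"
    using lborel.sigma_finite_countable by blast
  have "emeasure lebesgue a \<noteq> \<infinity>" if "a \<in> A" for a
    using A that by (auto simp: subset_iff)
  then show "\<exists>A::'a set set. countable A \<and> A \<subseteq> sets lebesgue \<and> \<Union> A = space lebesgue \<and> (\<forall>a\<in>A. emeasure lebesgue a \<noteq> \<infinity>)"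
    using A by (intro exI[of _ A]) auto
qed

lemma ennreal_mult_mult: "0 \<le> a \<Longrightarrow> 0 \<le> b \<Longrightarrow> ennreal a * (ennreal b * x) = ennreal (a * b) * x"
  by (simp add: ennreal_mult mult.assoc)

subsection \<open>Weighted maximal functions\<close>

text \<open>
  Only cubes with rational centre and size enter the maximal function, so that it is a countable
  supremum and hence measurable; averages over arbitrary cubes are recovered up to the factor \<open>2^n\<close>.
\<close>

definition rcubs :: "((real ^ 'n) \<times> real) set" where
  "rcubs = {c. \<forall>i. c $ i \<in> \<rat>} \<times> {h\<in>\<rat>. 0 < h}"

lemma countable_rcubs: "countable (rcubs :: ((real ^ 'n) \<times> real) set)"
proof -
  have "{c :: real^'n. \<forall>i. c $ i \<in> \<rat>} = vec_lambda ` (UNIV \<rightarrow>\<^sub>E \<rat>)"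
  proof (intro set_eqI iffI)
    fix c :: "real^'n" assume "c \<in> {c. \<forall>i. c $ i \<in> \<rat>}"
    then have "c = vec_lambda (\<lambda>i. c $ i)" "(\<lambda>i. c $ i) \<in> UNIV \<rightarrow>\<^sub>E \<rat>" by auto
    then show "c \<in> vec_lambda ` (UNIV \<rightarrow>\<^sub>E \<rat>)" by blast
  qed (auto simp: PiE_iff)
  then have "countable {c :: real^'n. \<forall>i. c $ i \<in> \<rat>}"
    by (simp add: countable_PiE countable_rat)
  moreover have "countable {h\<in>\<rat>. (0::real) < h}"
    using countable_rat by (rule countable_subset[rotated]) auto
  ultimately show ?thesis unfolding rcubs_def by (rule countable_SIGMA)
qed

text \<open>The rational centre is off by less than \<open>h/2\<close> in each coordinate, so a half
  side above \<open>3/2 * h\<close> covers the old cube, and one below \<open>2 * h\<close> costs at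
  most the factor \<open>2^n\<close> in volume.\<close>

lemma rcubs_cover:
  assumes "0 < h" obtains c' h' where "(c', h') \<in> rcubs" "cub c h \<subseteq> cub c' h'" "h' \<le> 2 * h"
proof -
  obtain h' where h': "h' \<in> \<rat>" "3/2 * h < h'" "h' < 2 * h"
    using Rats_dense_in_real[of "3/2*h" "2*h"] assms by auto
  have "\<exists>q\<in>\<rat>. c$i - h/2 < q \<and> q < c$i + h/2" for i
    using Rats_dense_in_real[of "c$i - h/2" "c$i + h/2"] assms by auto
  then obtain q where q: "\<And>i. q i \<in> \<rat>" "\<And>i. c$i - h/2 < q i" "\<And>i. q i < c$i + h/2"
    by metis
  have "(\<chi> i. q i, h') \<in> rcubs" using q h' assms by (auto simp: rcubs_def)
  moreover have "cub c h \<subseteq> cub (\<chi> i. q i) h'"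
  proof
    fix x assume x: "x \<in> cub c h"
    have "\<bar>x$i - q i\<bar> \<le> h'" for i
    proof -
      have "\<bar>x$i - c$i\<bar> \<le> h" using x by (simp add: mem_cub)
      then show ?thesis using q(2,3)[of i] h' by linarith
    qed
    then show "x \<in> cub (\<chi> i. q i) h'" by (simp add: mem_cub)
  qed
  ultimately show thesis using that h' by force
qed

text \<open>Greedy choice: a cube of largest half side is kept, and every cube meeting it is
  discarded. The discarded ones are no larger, hence lie in its threefold dilate; the remaining
  cubes are handled by induction.\<close>

lemma vitali_finite:
  fixes A :: "((real ^ 'n) \<times> real) set"
  assumes "finite A"
  shows "\<exists>B\<subseteq>A. disjoint_family_on (\<lambda>(c,h). cub c h) B \<and> 
           (\<Union>(c,h)\<in>A. cub c h) \<subseteq> (\<Union>(c,h)\<in>B. cub c (3 * h))"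
  using assms
proof (induction "card A" arbitrary: A rule: less_induct)
  case less
  show ?case
  proof (cases "A = {}")
    case True then show ?thesis by (auto simp: disjoint_family_on_def)
  next
    case False
    define m where "m = arg_max_on snd A"
    have m: "m \<in> A" "\<And>a. a \<in> A \<Longrightarrow> snd a \<le> snd m"
    proof -
      have mm: "snd ` A \<noteq> {}" "finite (snd ` A)" using less False by auto
      obtain a where a: "a \<in> A" "snd a = Max (snd ` A)" using Max_in[OF mm(2,1)] by auto
      have "is_arg_max snd (\<lambda>x. x \<in> A) a"
        using a mm by (auto simp: is_arg_max_linorder)
      then have "is_arg_max snd (\<lambda>x. x \<in> A) m"
        unfolding m_def arg_max_on_def arg_max_def by (rule someI)
      then show "m \<in> A" "\<And>a. a \<in> A \<Longrightarrow> snd a \<le> snd m"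
        by (auto simp: is_arg_max_linorder)
    qed
    obtain c0 h0 where ch: "m = (c0, h0)" by (cases m)
    \<comment> \<open>Half sides are not assumed to be positive, and an empty cube does not meet
      itself; \<open>m\<close> is therefore removed explicitly, so that the cardinality
      drops.\<close>
    define A' where "A' = {(c,h)\<in>A. cub c h \<inter> cub c0 h0 = {}} - {m}"
    have "A' \<subset> A" using m by (auto simp: A'_def)
    then have "card A' < card A" "finite A'"
      using less(2) by (auto simp: psubset_card_mono finite_subset)
    from less(1)[OF this] obtain B where B: "B \<subseteq> A'" "disjoint_family_on (\<lambda>(c,h). cub c h) B"
       "(\<Union>(c,h)\<in>A'. cub c h) \<subseteq> (\<Union>(c,h)\<in>B. cub c (3 * h))" by blast
    have "disjoint_family_on (\<lambda>(c,h). cub c h) (insert m B)"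
      unfolding disjoint_family_on_def
    proof (intro ballI impI)
      fix a b assume ab: "a \<in> insert m B" "b \<in> insert m B" "a \<noteq> b"
      have *: "(case a of (c,h) \<Rightarrow> cub c h) \<inter> cub c0 h0 = {}" if "a \<in> B" for a
        using that B(1) by (auto simp: A'_def)
      consider "a = m" "b \<in> B" | "b = m" "a \<in> B" | "a \<in> B" "b \<in> B" using ab by auto
      then show "(case a of (c,h) \<Rightarrow> cub c h) \<inter> (case b of (c,h) \<Rightarrow> cub c h) = {}"
      proof cases
        case 1 with * show ?thesis by (simp add: ch Int_commute)
      next
        case 2 with * show ?thesis by (simp add: ch)
      next
        case 3 with B(2) ab(3) show ?thesis unfolding disjoint_family_on_def by blast
      qed
    qed
    moreover have "(\<Union>(c,h)\<in>A. cub c h) \<subseteq> (\<Union>(c,h)\<in>insert m B. cub c (3 * h))"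
    proof
      fix x assume "x \<in> (\<Union>(c,h)\<in>A. cub c h)"
      then obtain c h where x: "(c,h) \<in> A" "x \<in> cub c h" by auto
      have hle: "h \<le> h0" using m(2)[OF x(1)] ch by simp
      show "x \<in> (\<Union>(c,h)\<in>insert m B. cub c (3 * h))"
      proof (cases "(c,h) \<in> A'")
        case True
        then show ?thesis using B(3) x by blast
      next
        case False
        then have "\<exists>y. y \<in> cub c h \<and> y \<in> cub c0 h0"
          using x ch by (auto simp: A'_def)
        then obtain y where "y \<in> cub c h" "y \<in> cub c0 h0" by blast
        then have "cub c h \<subseteq> cub c0 (3 * h0)"
          by (rule cub_subset) (use hle in simp)
        then show ?thesis using x ch by auto
      qed
    qed
    ultimately show ?thesis using B(1) \<open>A' \<subset> A\<close> m(1) by (intro exI[of _ "insert m B"]) auto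
  qed
qed

section \<open>Doubling measures and the weak type (1,1) bound\<close>

definition doubling :: "real \<Rightarrow> (real ^ 'n \<Rightarrow> real) \<Rightarrow> bool" where
  "doubling D w \<longleftrightarrow> w \<in> borel_measurable lebesgue \<and> (\<forall>x. 0 \<le> w x) \<and> 0 < D \<and>
     (\<forall>c h. 0 < h \<longrightarrow> 0 < wmass w (cub c h) \<and> wmass w (cub c h) < top \<and>
        wmass w (cub c (3 * h)) \<le> ennreal D * wmass w (cub c h))"

lemma doubling_massE:
  assumes "doubling D w" "0 < h"
  obtains m where "wmass w (cub c h) = ennreal m" "0 < m"
proof -
  have "0 < wmass w (cub c h)" "wmass w (cub c h) < top" using assms by (auto simp: doubling_def)
  then show thesis using that by (cases "wmass w (cub c h)") (auto simp: ennreal_less_zero_iff)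
qed

text \<open>The uncentred maximal function of the measure \<open>w dx\<close>. The condition that
  the cube contains \<open>x\<close> is expressed by an indicator, so that the supremum runs over
  one countable family for all \<open>x\<close>.\<close>

definition Mw :: "(real ^ 'n \<Rightarrow> real) \<Rightarrow> (real ^ 'n \<Rightarrow> ennreal) \<Rightarrow> real ^ 'n \<Rightarrow> ennreal" where
  "Mw w g x = (SUP Q\<in>rcubs. indicator (cub (fst Q) (snd Q)) x * 
     ((\<integral>\<^sup>+y. g y * ennreal (w y) * indicator (cub (fst Q) (snd Q)) y \<partial>lebesgue) 
        / wmass w (cub (fst Q) (snd Q))))"

lemma measurable_Mw [measurable]: "Mw w g \<in> borel_measurable lebesgue"
  unfolding Mw_def[abs_def]
  by (intro borel_measurable_SUP countable_rcubs borel_measurable_times borel_measurable_indicator) auto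

lemma Mw_ge:
  assumes "(c, h) \<in> rcubs" "x \<in> cub c h"
  shows "(\<integral>\<^sup>+y. g y * ennreal (w y) * indicator (cub c h) y \<partial>lebesgue) / wmass w (cub c h) \<le> Mw w g x"
  unfolding Mw_def using assms by (intro SUP_upper2[of "(c,h)"]) auto

lemma emeasure_wmass:
  assumes "w \<in> borel_measurable lebesgue" "E \<in> sets lebesgue"
  shows "emeasure (density lebesgue (\<lambda>x. ennreal (w x))) E = wmass w E"
  using assms by (simp add: emeasure_density wmass_def)

lemma UN_initial_segments: "(\<Union>N. \<Union>Q\<in>f ` {..<N::nat}. q Q) = (\<Union>Q\<in>range f. q Q)"
proof (intro equalityI subsetI)
  fix x assume "x \<in> (\<Union>Q\<in>range f. q Q)"
  then obtain n where "x \<in> q (f n)" by blast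
  then have "x \<in> (\<Union>Q\<in>f ` {..<Suc n}. q Q)" by blast
  then show "x \<in> (\<Union>N. \<Union>Q\<in>f ` {..<N::nat}. q Q)" by blast
qed blast

text \<open>The superlevel set is the union of the countably many cubes whose average exceeds
  \<open>t\<close>. For a finite subfamily the covering lemma leaves disjoint cubes whose threefold
  dilates suffice; \<open>doubling\<close> is stated with the factor 3 for this purpose. Continuity
  from below passes to the whole union.\<close>

lemma Mw_weak:
  assumes D: "doubling D w" and [measurable]: "g \<in> borel_measurable lebesgue" and t: "0 < t"
  shows "wmass w {x. ennreal t < Mw w g x} \<le> ennreal (D / t) * (\<integral>\<^sup>+x. g x * ennreal (w x) \<partial>lebesgue)"
proof -
  have [measurable]: "w \<in> borel_measurable lebesgue" using D by (simp add: doubling_def)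
  have D0: "0 < D" using D by (simp add: doubling_def)
  define \<nu> where "\<nu> = density lebesgue (\<lambda>x. ennreal (w x))"
  have \<nu>: "emeasure \<nu> E = wmass w E" if "E \<in> sets lebesgue" for E
    using that by (simp add: \<nu>_def emeasure_wmass)
  have sets\<nu> [simp]: "sets \<nu> = sets lebesgue" by (simp add: \<nu>_def)
  let ?I = "\<lambda>Q. \<integral>\<^sup>+y. g y * ennreal (w y) * indicator (cub (fst Q) (snd Q)) y \<partial>lebesgue"
  let ?q = "\<lambda>Q::(real^'n)\<times>real. cub (fst Q) (snd Q)"
  define S where "S = {Q\<in>rcubs. ennreal t < ?I Q / wmass w (?q Q)}"
  have cS: "countable S" unfolding S_def using countable_rcubs by (rule countable_subset[rotated]) auto
  have eq: "{x. ennreal t < Mw w g x} = (\<Union>Q\<in>S. ?q Q)"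
    by (auto simp: Mw_def less_SUP_iff S_def indicator_def split: if_splits)
  have bd: "wmass w (?q Q) \<le> ennreal (1 / t) * ?I Q" if "Q \<in> S" for Q
  proof -
    have h: "0 < snd Q" using that by (auto simp: S_def rcubs_def)
    then obtain m where m: "wmass w (?q Q) = ennreal m" "0 < m"
      using doubling_massE[OF D] by blast
    have "ennreal t * ennreal m \<le> ?I Q"
    proof (rule ccontr)
      assume "\<not> ?thesis"
      then have "?I Q < ennreal t * ennreal m" by (simp only: not_le)
      then have "?I Q / ennreal m < ennreal t" using m by (subst divide_less_ennreal) simp_all
      then show False using that m unfolding S_def by (metis (mono_tags, lifting) mem_Collect_eq less_asym)
    qed
    then have "ennreal (1/t) * (ennreal t * ennreal m) \<le> ennreal (1/t) * ?I Q" by (rule mult_left_mono) simp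
    then show ?thesis using t m by (simp add: ennreal_mult_mult)
  qed
  have fin: "emeasure \<nu> (\<Union>Q\<in>A. ?q Q) \<le> ennreal (D / t) * (\<integral>\<^sup>+x. g x * ennreal (w x) \<partial>lebesgue)"
    if A: "finite A" "A \<subseteq> S" for A
  proof -
    obtain B where B: "B \<subseteq> A" "disjoint_family_on (\<lambda>(c,h). cub c h) B"
           "(\<Union>(c,h)\<in>A. cub c h) \<subseteq> (\<Union>(c,h)\<in>B. cub c (3 * h))" 
      using vitali_finite[OF A(1)] by blast
    have B2: "disjoint_family_on ?q B" using B(2) by (simp add: case_prod_beta disjoint_family_on_def)
    have finB: "finite B" using B A by (auto intro: finite_subset)
    have "emeasure \<nu> (\<Union>Q\<in>A. ?q Q) \<le> emeasure \<nu> (\<Union>Q\<in>B. cub (fst Q) (3 * snd Q))"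
      using B(3) finB by (intro emeasure_mono) (auto simp: case_prod_beta)
    also have "\<dots> \<le> (\<Sum>Q\<in>B. emeasure \<nu> (cub (fst Q) (3 * snd Q)))"
      by (rule emeasure_subadditive_finite) (use finB in auto)
    also have "\<dots> \<le> (\<Sum>Q\<in>B. ennreal (D / t) * ?I Q)"
    proof (rule sum_mono)
      fix Q assume "Q \<in> B"
      then have Q: "Q \<in> S" using B A by auto
      then have "0 < snd Q" by (auto simp: S_def rcubs_def)
      then have "emeasure \<nu> (cub (fst Q) (3 * snd Q)) \<le> ennreal D * wmass w (?q Q)"
        using D by (simp add: \<nu> doubling_def)
      also have "\<dots> \<le> ennreal D * (ennreal (1 / t) * ?I Q)"
        by (intro mult_left_mono bd Q) simp
      also have "\<dots> = ennreal (D / t) * ?I Q"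
        using D0 t by (simp add: ennreal_mult_mult)
      finally show "emeasure \<nu> (cub (fst Q) (3 * snd Q)) \<le> ennreal (D / t) * ?I Q" .
    qed
    also have "\<dots> = ennreal (D / t) * (\<integral>\<^sup>+y. (\<Sum>Q\<in>B. g y * ennreal (w y) * indicator (?q Q) y) \<partial>lebesgue)"
      by (simp add: nn_integral_sum sum_distrib_left)
    also have "\<dots> \<le> ennreal (D / t) * (\<integral>\<^sup>+x. g x * ennreal (w x) \<partial>lebesgue)"
    proof (intro mult_left_mono nn_integral_mono)
      fix y
      have "(\<Sum>Q\<in>B. indicator (?q Q) y) = (indicator (\<Union>Q\<in>B. ?q Q) y :: ennreal)"
        by (rule indicator_UN_disjoint[symmetric, OF finB B2])
      then have "(\<Sum>Q\<in>B. g y * ennreal (w y) * indicator (?q Q) y) = g y * ennreal (w y) * indicator (\<Union>Q\<in>B. ?q Q) y"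
        by (simp only: sum_distrib_left[symmetric])
      also have "\<dots> \<le> g y * ennreal (w y)"
        by (simp add: indicator_def)
      finally show "(\<Sum>Q\<in>B. g y * ennreal (w y) * indicator (?q Q) y) \<le> g y * ennreal (w y)" .
    qed simp
    finally show ?thesis .
  qed
  show ?thesis
  proof (cases "S = {}")
    case True then show ?thesis by (simp add: eq wmass_def)
  next
    case False
    define U where "U N = (\<Union>Q\<in>from_nat_into S ` {..<N}. ?q Q)" for N :: nat
    have U: "(\<Union>N. U N) = (\<Union>Q\<in>S. ?q Q)"
    proof -
      have "range (from_nat_into S) = S" by (rule range_from_nat_into[OF False cS])
      moreover have "(\<Union>N. U N) = (\<Union>Q\<in>range (from_nat_into S). ?q Q)"
        unfolding U_def by (rule UN_initial_segments)
      ultimately show ?thesis by simp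
    qed
    have "emeasure \<nu> (\<Union>N. U N) = (SUP N. emeasure \<nu> (U N))"
    proof (rule SUP_emeasure_incseq[symmetric])
      show "range U \<subseteq> sets \<nu>" unfolding U_def by (auto intro!: sets.finite_UN)
      show "incseq U" unfolding U_def by (intro monoI UN_mono image_mono) auto
    qed
    also have "\<dots> \<le> ennreal (D / t) * (\<integral>\<^sup>+x. g x * ennreal (w x) \<partial>lebesgue)"
      unfolding U_def by (intro SUP_least fin) (auto simp: from_nat_into[OF False])
    finally show ?thesis
      using U sets.countable_UN''[OF cS, of ?q lebesgue] by (simp add: eq \<nu>)
  qed
qed

text \<open>The part of \<open>g\<close> below the level \<open>t\<close> contributes at most
  \<open>t\<close> to any average.\<close>

lemma Mw_split:
  fixes w :: "real ^ 'n \<Rightarrow> real"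
  assumes D: "doubling D w" and [measurable]: "g \<in> borel_measurable lebesgue" and t: "0 \<le> t"
  shows "Mw w g x \<le> Mw w (\<lambda>y. g y * indicator {y. ennreal t < g y} y) x + ennreal t"
  unfolding Mw_def[of w g]
proof (rule SUP_least)
  fix Q :: "(real^'n) \<times> real" assume Q: "Q \<in> rcubs"
  have [measurable]: "w \<in> borel_measurable lebesgue" using D by (simp add: doubling_def)
  obtain c h where ch: "Q = (c,h)" by (cases Q)
  have "0 < h" using Q by (auto simp: rcubs_def ch)
  then obtain m where m: "wmass w (cub c h) = ennreal m" "0 < m"
    using doubling_massE[OF D] by blast
  let ?g = "\<lambda>y. g y * indicator {y. ennreal t < g y} y"
  let ?I = "\<lambda>g. (\<integral>\<^sup>+y. g y * ennreal (w y) * indicator (cub c h) y \<partial>lebesgue)"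
  show "indicator (cub (fst Q) (snd Q)) x * ((\<integral>\<^sup>+y. g y * ennreal (w y) * indicator (cub (fst Q) (snd Q)) y \<partial>lebesgue) 
        / wmass w (cub (fst Q) (snd Q))) \<le> Mw w ?g x + ennreal t"
  proof (cases "x \<in> cub c h")
    case True
    have "?I g \<le> (\<integral>\<^sup>+y. ?g y * ennreal (w y) * indicator (cub c h) y + ennreal t * (ennreal (w y) * indicator (cub c h) y) \<partial>lebesgue)"
      by (intro nn_integral_mono) (auto simp: indicator_def not_less intro!: mult_right_mono)
    also have "\<dots> = ?I ?g + ennreal t * wmass w (cub c h)"
      by (simp add: nn_integral_add nn_integral_cmult wmass_def)
    finally have "?I g / wmass w (cub c h) \<le> (?I ?g + ennreal t * wmass w (cub c h)) / wmass w (cub c h)"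
      by (rule divide_right_mono_ennreal)
    also have "\<dots> = ?I ?g / wmass w (cub c h) + ennreal t"
      using m by (simp add: add_divide_distrib_ennreal mult_divide_eq_ennreal)
    also have "\<dots> \<le> Mw w ?g x + ennreal t"
      using Mw_ge[of c h x ?g w] Q True ch by (intro add_right_mono) simp
    finally show ?thesis using True ch by simp
  qed (simp add: ch)
qed

text \<open>One half of the layer cake formula. Integrating only up to \<open>u/2\<close> guarantees
  the strict inequality \<open>t < y\<close> for every finite positive \<open>u \<le> y\<close>, and
  accounts for the factor \<open>2 powr p\<close>; an infinite \<open>y\<close> is reached through
  \<open>u = n\<close>.\<close>

lemma epowr_le_layer:
  assumes p: "1 < p"
  shows "epowr y p \<le> ennreal (2 powr p * p) * (\<integral>\<^sup>+t. ennreal (t powr (p - 1)) * indicator {0..} t * indicator {t. ennreal t < y} t \<partial>lborel)"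
proof -
  define J where "J = (\<integral>\<^sup>+t. ennreal (t powr (p - 1)) * indicator {0..} t * indicator {t. ennreal t < y} t \<partial>lborel)"
  have base: "epowr (ennreal u) p \<le> ennreal (2 powr p * p) * J"
    if u: "0 < u" "ennreal u \<le> y" for u
  proof -
    have "((\<lambda>t. t powr (p-1)) has_integral ((u/2) powr (p - 1 + 1) / (p - 1 + 1))) {0..u/2}"
      by (rule has_integral_powr_from_0) (use p u in auto)
    then have "(\<integral>\<^sup>+t\<in>{0..u/2}. ennreal (t powr (p-1)) \<partial>lborel) = ennreal ((u/2) powr p / p)"
      using p by (subst nn_integral_has_integral_lebesgue') auto
    then have eq: "ennreal (2 powr p * p) * (\<integral>\<^sup>+t\<in>{0..u/2}. ennreal (t powr (p-1)) \<partial>lborel) = epowr (ennreal u) p"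
      using p u by (simp add: epowr_ennreal powr_divide flip: ennreal_mult)
    have le: "(\<integral>\<^sup>+t\<in>{0..u/2}. ennreal (t powr (p-1)) \<partial>lborel) \<le> J"
    unfolding J_def
    proof (intro nn_integral_mono)
      fix t :: real
      have "ennreal t < y" if "t \<in> {0..u/2}"
      proof -
        have "ennreal t < ennreal u" using that u by (intro ennreal_lessI) auto
        then show ?thesis using u by simp
      qed
      then show "ennreal (t powr (p-1)) * indicator {0..u/2} t \<le> ennreal (t powr (p - 1)) * indicator {0..} t * indicator {t. ennreal t < y} t"
        by (auto simp: indicator_def)
    qed
    from mult_left_mono[OF le, of "ennreal (2 powr p * p)"] show ?thesis by (simp only: eq zero_le)
  qed
  have "epowr y p \<le> ennreal (2 powr p * p) * J"
  proof (cases y)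
    case (real r)
    show ?thesis
    proof (cases "r = 0")
      case False
      then show ?thesis using base[of r] real by (simp add: J_def[symmetric])
    qed (use real in simp)
  next
    case top
    have "ennreal (real n) \<le> ennreal (2 powr p * p) * J" for n
    proof (cases "n = 0")
      case False
      have "real n = real n powr 1" by simp
      also have "\<dots> \<le> real n powr p" using False p by (intro powr_mono) auto
      finally show ?thesis using base[of "real n"] False top
        by (metis ennreal_leI epowr_ennreal of_nat_0_le_iff of_nat_0_less_iff neq0_conv order_trans top_greatest)
    qed simp
    then have "(SUP n. ennreal (real n)) \<le> ennreal (2 powr p * p) * J"
      by (intro SUP_least)
    moreover have "(SUP n. ennreal (real n)) = top"
      using ennreal_SUP_of_nat_eq_top by (simp add: ennreal_of_nat_eq_real_of_nat)
    ultimately show ?thesis by (simp add: top_unique)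
  qed
  then show ?thesis by (simp only: J_def)
qed

text \<open>The other half, for the exponent \<open>p - 1\<close>: the layers with
  \<open>t/2 < y\<close> fill at most the interval from \<open>0\<close> to \<open>2 * y\<close>,
  and \<open>p > 1\<close> makes the power integrable at zero.\<close>

lemma layer_le_epowr:
  assumes p: "1 < p"
  shows "(\<integral>\<^sup>+t. ennreal (t powr (p - 2)) * indicator {0..} t * indicator {t. ennreal (t/2) < y} t \<partial>lborel)
           \<le> ennreal (2 powr (p - 1) / (p - 1)) * epowr y (p - 1)"
proof (cases y)
  case (real r)
  have "((\<lambda>t. t powr (p-2)) has_integral ((2*r) powr (p - 2 + 1) / (p - 2 + 1))) {0..2*r}"
    by (rule has_integral_powr_from_0) (use p real in auto)
  then have eq: "(\<integral>\<^sup>+t\<in>{0..2*r}. ennreal (t powr (p-2)) \<partial>lborel) = ennreal ((2*r) powr (p-1) / (p-1))"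
    using p by (subst nn_integral_has_integral_lebesgue') auto
  have "(\<integral>\<^sup>+t. ennreal (t powr (p - 2)) * indicator {0..} t * indicator {t. ennreal (t/2) < y} t \<partial>lborel)
      \<le> (\<integral>\<^sup>+t\<in>{0..2*r}. ennreal (t powr (p-2)) \<partial>lborel)"
    using real by (intro nn_integral_mono) (auto simp: indicator_def ennreal_less_iff)
  then show ?thesis using eq real p by (simp add: epowr_ennreal powr_mult flip: ennreal_mult)
qed (use p in \<open>simp add: ennreal_mult_top\<close>)

section \<open>Interchange of integrals and the strong type bound\<close>

lemma nn_integral_swap_lebesgue:
  fixes f :: "'a::euclidean_space \<Rightarrow> real \<Rightarrow> ennreal"
  assumes "case_prod f \<in> borel_measurable (lebesgue \<Otimes>\<^sub>M lborel)"
  shows "(\<integral>\<^sup>+x. (\<integral>\<^sup>+t. f x t \<partial>lborel) \<partial>lebesgue) = (\<integral>\<^sup>+t. (\<integral>\<^sup>+x. f x t \<partial>lebesgue) \<partial>lborel)"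
proof -
  interpret L: sigma_finite_measure "lebesgue :: 'a measure" by (rule sigma_finite_lebesgue)
  interpret pair_sigma_finite "lebesgue :: 'a measure" "lborel :: real measure" ..
  show ?thesis using Fubini[OF assms] by simp
qed

lemma measurable_layer:
  fixes F w :: "'a::euclidean_space \<Rightarrow> ennreal"
  assumes [measurable]: "F \<in> borel_measurable lebesgue" "w \<in> borel_measurable lebesgue" "k \<in> borel_measurable borel" "l \<in> borel_measurable borel"
  shows "case_prod (\<lambda>x t. k t * indicator {t. ennreal (l t) < F x} t * w x) \<in> borel_measurable (lebesgue \<Otimes>\<^sub>M lborel)"
proof -
  have "(\<lambda>xt. k (snd xt) * (if ennreal (l (snd xt)) < F (fst xt) then 1 else 0) * w (fst xt)) \<in> borel_measurable (lebesgue \<Otimes>\<^sub>M lborel)"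
    by measurable
  then show ?thesis by (simp add: case_prod_beta' indicator_def of_bool_def)
qed

text \<open>The factor \<open>2 powr p * p\<close> comes from \<open>epowr_le_layer\<close>,
  \<open>2 * D\<close> from the weak type bound at the level \<open>t/2\<close>, and the last one
  from \<open>layer_le_epowr\<close>.\<close>

definition Mw_const :: "real \<Rightarrow> real \<Rightarrow> real" where
  "Mw_const D p = 2 powr p * p * (2 * D * (2 powr (p - 1) / (p - 1)))"

text \<open>Marcinkiewicz interpolation between the weak type bound and the trivial bound for
  bounded functions, done by hand: at each level \<open>t\<close> only the part of \<open>g\<close>
  above \<open>t/2\<close> matters, and interchanging the integrals turns the levels back into a
  power of \<open>g\<close>.\<close>

lemma Mw_strong:
  fixes w :: "real ^ 'n \<Rightarrow> real"
  assumes D: "doubling D w" and g [measurable]: "g \<in> borel_measurable lebesgue" and p: "1 < p"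
  shows "(\<integral>\<^sup>+x. epowr (Mw w g x) p * ennreal (w x) \<partial>lebesgue)
     \<le> ennreal (Mw_const D p) * (\<integral>\<^sup>+x. epowr (g x) p * ennreal (w x) \<partial>lebesgue)"
proof -
  have [measurable]: "w \<in> borel_measurable lebesgue" using D by (simp add: doubling_def)
  have D0: "0 < D" using D by (simp add: doubling_def)
  let ?k = "\<lambda>t. ennreal (t powr (p - 1)) * indicator {0..} t"
  let ?k2 = "\<lambda>t. ennreal (t powr (p - 2)) * indicator {0..} t"
  let ?a = "ennreal (2 powr p * p)"
  have "(\<integral>\<^sup>+x. epowr (Mw w g x) p * ennreal (w x) \<partial>lebesgue) \<le>
     (\<integral>\<^sup>+x. ?a * (\<integral>\<^sup>+t. ?k t * indicator {t. ennreal t < Mw w g x} t * ennreal (w x) \<partial>lborel) \<partial>lebesgue)"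
  proof (rule nn_integral_mono)
    fix x
    have "epowr (Mw w g x) p * ennreal (w x) \<le> ?a * (\<integral>\<^sup>+t. ?k t * indicator {t. ennreal t < Mw w g x} t \<partial>lborel) * ennreal (w x)"
      by (intro mult_right_mono epowr_le_layer p) simp
    also have "\<dots> = ?a * (\<integral>\<^sup>+t. ?k t * indicator {t. ennreal t < Mw w g x} t * ennreal (w x) \<partial>lborel)"
      by (subst nn_integral_multc) (auto simp: mult.assoc)
    finally show "epowr (Mw w g x) p * ennreal (w x) \<le> ?a * (\<integral>\<^sup>+t. ?k t * indicator {t. ennreal t < Mw w g x} t * ennreal (w x) \<partial>lborel)" .
  qed
  also have "\<dots> = ?a * (\<integral>\<^sup>+x. (\<integral>\<^sup>+t. ?k t * indicator {t. ennreal t < Mw w g x} t * ennreal (w x) \<partial>lborel) \<partial>lebesgue)"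
  proof (rule nn_integral_cmult)
    show "(\<lambda>x. \<integral>\<^sup>+t. ?k t * indicator {t. ennreal t < Mw w g x} t * ennreal (w x) \<partial>lborel) \<in> borel_measurable lebesgue"
      by (rule lborel.borel_measurable_nn_integral, rule measurable_layer) auto
  qed
  also have "(\<integral>\<^sup>+x. (\<integral>\<^sup>+t. ?k t * indicator {t. ennreal t < Mw w g x} t * ennreal (w x) \<partial>lborel) \<partial>lebesgue)
     = (\<integral>\<^sup>+t. (\<integral>\<^sup>+x. ?k t * indicator {t. ennreal t < Mw w g x} t * ennreal (w x) \<partial>lebesgue) \<partial>lborel)"
    by (rule nn_integral_swap_lebesgue, rule measurable_layer) auto
  also have "\<dots> \<le> (\<integral>\<^sup>+t. (\<integral>\<^sup>+x. ennreal (2 * D) * (?k2 t * indicator {t. ennreal (t/2) < g x} t * (g x * ennreal (w x))) \<partial>lebesgue) \<partial>lborel)"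
  proof (rule nn_integral_mono)
    fix t :: real
    show "(\<integral>\<^sup>+x. ?k t * indicator {t. ennreal t < Mw w g x} t * ennreal (w x) \<partial>lebesgue) \<le>
      (\<integral>\<^sup>+x. ennreal (2 * D) * (?k2 t * indicator {t. ennreal (t/2) < g x} t * (g x * ennreal (w x))) \<partial>lebesgue)"
    proof (cases "0 < t")
      case False
      then have "?k t = 0" by (auto simp: indicator_def)
      then show ?thesis by (simp only: mult_zero_left nn_integral_const zero_le)
    next
      case t: True
      let ?g = "\<lambda>y. g y * indicator {y. ennreal (t/2) < g y} y"
      \<comment> \<open>The part of \<open>g\<close> below \<open>t/2\<close> uses up at most half
        of the level, so the truncated function must supply the other half.\<close>
      have "{x. ennreal t < Mw w g x} \<subseteq> {x. ennreal (t/2) < Mw w ?g x}"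
      proof
        fix x assume "x \<in> {x. ennreal t < Mw w g x}"
        then have *: "ennreal t < Mw w ?g x + ennreal (t/2)"
          using Mw_split[OF D g, of "t/2" x] t by simp
        have "ennreal (t/2) < Mw w ?g x"
        proof (rule ccontr)
          assume "\<not> ?thesis"
          then have "Mw w ?g x + ennreal (t/2) \<le> ennreal (t/2) + ennreal (t/2)"
            by (intro add_mono) auto
          also have "\<dots> = ennreal t" using t by (simp flip: ennreal_plus)
          finally show False using * by simp
        qed
        then show "x \<in> {x. ennreal (t/2) < Mw w ?g x}" by simp
      qed
      then have "wmass w {x. ennreal t < Mw w g x} \<le> wmass w {x. ennreal (t/2) < Mw w ?g x}"
        unfolding wmass_def by (intro nn_integral_mono) (auto simp: indicator_def)
      also have "\<dots> \<le> ennreal (D / (t/2)) * (\<integral>\<^sup>+x. ?g x * ennreal (w x) \<partial>lebesgue)"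
        by (rule Mw_weak[OF D]) (use t in auto)
      finally have W: "wmass w {x. ennreal t < Mw w g x} \<le> ennreal (D / (t/2)) * (\<integral>\<^sup>+x. ?g x * ennreal (w x) \<partial>lebesgue)" .
      have "(\<integral>\<^sup>+x. ?k t * indicator {t. ennreal t < Mw w g x} t * ennreal (w x) \<partial>lebesgue)
          = (\<integral>\<^sup>+x. ?k t * (ennreal (w x) * indicator {x. ennreal t < Mw w g x} x) \<partial>lebesgue)"
        by (intro nn_integral_cong) (simp add: indicator_def ac_simps)
      also have "\<dots> = ?k t * wmass w {x. ennreal t < Mw w g x}"
        unfolding wmass_def by (rule nn_integral_cmult) measurable
      also have "\<dots> \<le> ?k t * (ennreal (D / (t/2)) * (\<integral>\<^sup>+x. ?g x * ennreal (w x) \<partial>lebesgue))"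
        by (rule mult_left_mono[OF W]) simp
      also have "\<dots> = (ennreal (2*D) * ?k2 t) * (\<integral>\<^sup>+x. ?g x * ennreal (w x) \<partial>lebesgue)"
      proof -
        have "t powr (p-1) = t powr (p - 2) * t"
          using t powr_add[of t "p-2" 1] by simp
        then have "t powr (p-1) * (D / (t/2)) = 2 * D * t powr (p - 2)"
          using t by (simp add: field_simps)
        then have "ennreal (t powr (p-1)) * ennreal (D / (t/2)) = ennreal (2*D) * ennreal (t powr (p-2))"
          using t D0 by (simp flip: ennreal_mult)
        then show ?thesis using t by (simp flip: mult.assoc)
      qed
      also have "\<dots> = (\<integral>\<^sup>+x. (ennreal (2*D) * ?k2 t) * (?g x * ennreal (w x)) \<partial>lebesgue)"
        by (rule nn_integral_cmult[symmetric]) measurable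
      also have "\<dots> = (\<integral>\<^sup>+x. ennreal (2 * D) * (?k2 t * indicator {t. ennreal (t/2) < g x} t * (g x * ennreal (w x))) \<partial>lebesgue)"
        by (intro nn_integral_cong) (simp add: indicator_def ac_simps)
      finally show ?thesis .
    qed
  qed
  also have "\<dots> = (\<integral>\<^sup>+x. (\<integral>\<^sup>+t. (ennreal (2*D) * ?k2 t) * indicator {t. ennreal (t/2) < g x} t * (g x * ennreal (w x)) \<partial>lborel) \<partial>lebesgue)"
    by (subst nn_integral_swap_lebesgue, rule measurable_layer) (auto simp: mult.assoc)
  also have "\<dots> \<le> (\<integral>\<^sup>+x. ennreal (2*D * (2 powr (p - 1) / (p - 1))) * (epowr (g x) p * ennreal (w x)) \<partial>lebesgue)"
  proof (rule nn_integral_mono)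
    fix x
    have "(\<integral>\<^sup>+t. (ennreal (2*D) * ?k2 t) * indicator {t. ennreal (t/2) < g x} t * (g x * ennreal (w x)) \<partial>lborel)
       = ennreal (2*D) * (\<integral>\<^sup>+t. ?k2 t * indicator {t. ennreal (t/2) < g x} t \<partial>lborel) * (g x * ennreal (w x))"
      by (subst nn_integral_multc, simp) (subst mult.assoc, subst nn_integral_cmult, auto)
    also have "\<dots> \<le> ennreal (2*D) * (ennreal (2 powr (p - 1) / (p - 1)) * epowr (g x) (p - 1)) * (g x * ennreal (w x))"
      by (intro mult_right_mono mult_left_mono layer_le_epowr p) auto
    also have "\<dots> = ennreal (2*D * (2 powr (p - 1) / (p - 1))) * (epowr (g x) p * ennreal (w x))"
    proof -
      have e: "epowr (g x) p = epowr (g x) (p - 1) * g x" using epowr_add[of "g x" "p - 1" 1] by simp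
      have m: "ennreal (2*D * (2 powr (p - 1) / (p - 1))) = ennreal (2*D) * ennreal (2 powr (p - 1) / (p - 1))"
        using D0 p by (intro ennreal_mult) auto
      show ?thesis unfolding e m by (simp only: mult.assoc)
    qed
    finally show "(\<integral>\<^sup>+t. (ennreal (2*D) * ?k2 t) * indicator {t. ennreal (t/2) < g x} t * (g x * ennreal (w x)) \<partial>lborel)
      \<le> ennreal (2*D * (2 powr (p - 1) / (p - 1))) * (epowr (g x) p * ennreal (w x))" .
  qed
  also have "\<dots> = ennreal (2*D * (2 powr (p - 1) / (p - 1))) * (\<integral>\<^sup>+x. epowr (g x) p * ennreal (w x) \<partial>lebesgue)"
    by (rule nn_integral_cmult) measurable
  finally have fin: "(\<integral>\<^sup>+x. epowr (Mw w g x) p * ennreal (w x) \<partial>lebesgue) \<le>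
     ?a * (ennreal (2*D * (2 powr (p - 1) / (p - 1))) * (\<integral>\<^sup>+x. epowr (g x) p * ennreal (w x) \<partial>lebesgue))"
    by (simp add: mult_left_mono)
  have "0 \<le> 2 powr p * p" "0 \<le> 2*D * (2 powr (p - 1) / (p - 1))" using p D0 by auto
  then show ?thesis using fin by (simp only: ennreal_mult_mult Mw_const_def)
qed

subsection \<open>Dual pairs of weights and Muckenhoupt's theorem\<close>

lemma wmass_mono: "E \<subseteq> F \<Longrightarrow> wmass w E \<le> wmass w F"
  unfolding wmass_def by (intro nn_integral_mono) (auto simp: indicator_def)

lemma wmass_pos:
  assumes [measurable]: "w \<in> borel_measurable lebesgue" "E \<in> sets lebesgue"
    and pos: "AE x in lebesgue. 0 < w x" and E: "0 < emeasure lebesgue E"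
  shows "0 < wmass w E"
proof (rule ccontr)
  assume "\<not> 0 < wmass w E"
  then have "AE x in lebesgue. ennreal (w x) * indicator E x = 0"
    unfolding wmass_def by (subst nn_integral_0_iff_AE[symmetric]) auto
  then have "AE x in lebesgue. x \<notin> E"
    using pos by eventually_elim (auto simp: indicator_def split: if_splits)
  then have "emeasure lebesgue E = 0"
    by (subst (asm) AE_iff_measurable[OF _ refl]) auto
  then show False using E by simp
qed

text \<open>The familiar consequence \<open>(|E|/|Q|)^q \<le> k^q w(E)/w(Q)\<close> of the
  Muckenhoupt condition, after a \<open>q\<close>-th root and without quotients. It yields both
  doubling (subcubes as \<open>E\<close>) and reverse doubling (annuli as \<open>E\<close>).\<close>

definition thick :: "real \<Rightarrow> real \<Rightarrow> (real ^ 'n \<Rightarrow> real) \<Rightarrow> bool" where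
  "thick q k w \<longleftrightarrow> (\<forall>c h E. 0 < h \<longrightarrow> E \<in> sets lebesgue \<longrightarrow> E \<subseteq> cub c h \<longrightarrow>
     emeasure lebesgue E * epowr (wmass w (cub c h)) (1 / q)
       \<le> ennreal k * emeasure lebesgue (cub c h) * epowr (wmass w E) (1 / q))"

text \<open>Equivalent to being a weight that is positive almost everywhere, see
  \<open>regular_weight_iff\<close>; finiteness on cubes is the handier form of local
  integrability.\<close>

definition regular_weight :: "(real ^ 'n \<Rightarrow> real) \<Rightarrow> bool" where
  "regular_weight w \<longleftrightarrow> w \<in> borel_measurable lebesgue \<and> (\<forall>x. 0 \<le> w x) \<and> (AE x in lebesgue. 0 < w x) \<and>
     (\<forall>c h. 0 < h \<longrightarrow> wmass w (cub c h) < top)"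

lemma regular_weight_massE:
  assumes "regular_weight w" "0 < h"
  obtains m where "wmass w (cub c h) = ennreal m" "0 < m"
proof -
  have "0 < emeasure lebesgue (cub c h)" using assms by (subst emeasure_cub) auto
  then have "0 < wmass w (cub c h)" using assms
    by (intro wmass_pos) (auto simp: regular_weight_def)
  moreover have "wmass w (cub c h) < top" using assms by (simp add: regular_weight_def)
  ultimately show thesis using that by (cases "wmass w (cub c h)") (auto simp: ennreal_less_zero_iff)
qed

lemma emeasure_cub_pos:
  assumes "0 < h" obtains v where "emeasure lebesgue (cub c h) = ennreal v" "0 < v"
  using assms emeasure_cub[of h c] by fastforce

lemma thick_scale:
  fixes w :: "real ^ 'n \<Rightarrow> real"
  assumes w: "regular_weight w" "thick q k w" and q: "0 < q" and k: "0 < k" 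
    and h: "0 < h'" "0 < h" and sub: "cub c' h' \<subseteq> cub c h"
  shows "wmass w (cub c h) \<le> ennreal ((k * (h / h') ^ CARD('n)) powr q) * wmass w (cub c' h')"
proof -
  have "ennreal ((2*h') ^ CARD('n)) * epowr (wmass w (cub c h)) (1 / q)
       \<le> ennreal k * ennreal ((2*h) ^ CARD('n)) * epowr (wmass w (cub c' h')) (1 / q)"
    using w(2) h sub unfolding thick_def 
    by (metis cub_lebesgue emeasure_cub less_imp_le)
  moreover obtain a where a: "wmass w (cub c h) = ennreal a" "0 < a"
    using regular_weight_massE[OF w(1) h(2)] by blast
  moreover obtain b where b: "wmass w (cub c' h') = ennreal b" "0 < b"
    using regular_weight_massE[OF w(1) h(1)] by blast
  ultimately have "(2*h') ^ CARD('n) * a powr (1/q) \<le> k * (2*h) ^ CARD('n) * b powr (1/q)"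
    using h k by (simp add: epowr_ennreal flip: ennreal_mult)
  then have "a powr (1/q) \<le> k * (2*h) ^ CARD('n) * b powr (1/q) / (2*h') ^ CARD('n)"
    using h by (simp add: pos_le_divide_eq mult.commute)
  also have "\<dots> = (k * (h / h') ^ CARD('n)) * b powr (1/q)"
    using h by (simp add: power_divide power_mult_distrib)
  finally have "(a powr (1/q)) powr q \<le> ((k * (h / h') ^ CARD('n)) * b powr (1/q)) powr q"
    using q by (intro powr_mono2) auto
  then have "a \<le> (k * (h / h') ^ CARD('n)) powr q * b"
    using a b q h k by (simp add: powr_mult powr_powr)
  then show ?thesis using a b by (simp add: ennreal_leI flip: ennreal_mult)
qed

lemma thick_doubling:
  fixes w :: "real ^ 'n \<Rightarrow> real"
  assumes w: "regular_weight w" "thick q k w" and q: "0 < q" and k: "0 < k"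
  shows "doubling ((k * 3 ^ CARD('n)) powr q) w"
  unfolding doubling_def
proof (intro conjI allI impI)
  fix c :: "real^'n" and h :: real assume h: "0 < h"
  show "wmass w (cub c (3 * h)) \<le> ennreal ((k * 3 ^ CARD('n)) powr q) * wmass w (cub c h)"
    using thick_scale[OF assms, of h "3*h" c c] h cub_mono[of h "3*h" c] by simp
  show "0 < wmass w (cub c h)" "wmass w (cub c h) < top" 
    using regular_weight_massE[OF w(1) h, of c] by force+
qed (use w k in \<open>auto simp: regular_weight_def\<close>)

text \<open>
  The \<open>A\<^sub>q\<close> condition for \<open>w\<close> together with its dual weight \<open>s = w^(1 - q')\<close>, in a form that is
  symmetric under exchanging \<open>(q, w)\<close> and \<open>(q', s)\<close>.
\<close>

definition dual_pair :: "real \<Rightarrow> real \<Rightarrow> (real ^ 'n \<Rightarrow> real) \<Rightarrow> (real ^ 'n \<Rightarrow> real) \<Rightarrow> bool" where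
  "dual_pair q k w s \<longleftrightarrow> 1 < q \<and> 0 < k \<and> regular_weight w \<and> regular_weight s \<and>
     (AE x in lebesgue. w x powr (1 / q) * s x powr (1 - 1 / q) = 1) \<and>
     (\<forall>c h. 0 < h \<longrightarrow> epowr (wmass w (cub c h)) (1 / q) * epowr (wmass s (cub c h)) (1 - 1 / q)
        \<le> ennreal k * emeasure lebesgue (cub c h))"

lemma dual_pair_sym: "dual_pair q k w s \<Longrightarrow> dual_pair (q / (q - 1)) k s w"
  unfolding dual_pair_def by (auto simp: divide_simps mult.commute)

text \<open>Hoelder's inequality on \<open>E\<close> for the factorization
  \<open>1 = w powr (1/q) * s powr (1 - 1/q)\<close>; the mass of \<open>s\<close> on
  \<open>E\<close> is enlarged to that on the cube, where the joint condition applies.\<close>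

lemma dual_pair_thick:
  fixes w s :: "real ^ 'n \<Rightarrow> real"
  assumes "dual_pair q k w s" shows "thick q k w"
  unfolding thick_def
proof (intro allI impI)
  fix c :: "real ^ 'n" and h E assume h: "0 < h" and E [measurable]: "E \<in> sets lebesgue" and sub: "E \<subseteq> cub c h"
  have [measurable]: "w \<in> borel_measurable lebesgue" "s \<in> borel_measurable lebesgue"
    and q: "1 < q" and ae: "AE x in lebesgue. w x powr (1 / q) * s x powr (1 - 1 / q) = 1"
    and nn: "\<And>x. 0 \<le> w x" "\<And>x. 0 \<le> s x"
    using assms by (auto simp: dual_pair_def regular_weight_def)
  have "emeasure lebesgue E = (\<integral>\<^sup>+x. indicator E x \<partial>lebesgue)" by simp
  also have "\<dots> = (\<integral>\<^sup>+x. epowr (ennreal (w x) * indicator E x) (1/q) * epowr (ennreal (s x) * indicator E x) (1 - 1/q) \<partial>lebesgue)"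
    using ae by (intro nn_integral_cong_AE, eventually_elim)
      (auto simp: indicator_def epowr_ennreal nn simp flip: ennreal_mult)
  also have "\<dots> \<le> epowr (wmass w E) (1/q) * epowr (wmass s E) (1 - 1/q)"
    unfolding wmass_def by (rule holder_epowr) (use q in auto)
  also have "\<dots> \<le> epowr (wmass w E) (1/q) * epowr (wmass s (cub c h)) (1 - 1/q)"
    by (intro mult_left_mono epowr_mono wmass_mono sub) (use q in auto)
  finally have "emeasure lebesgue E * epowr (wmass w (cub c h)) (1 / q) \<le>
     epowr (wmass w E) (1/q) * epowr (wmass s (cub c h)) (1 - 1/q) * epowr (wmass w (cub c h)) (1 / q)"
    by (rule mult_right_mono) simp
  also have "\<dots> = epowr (wmass w E) (1/q) * (epowr (wmass w (cub c h)) (1 / q) * epowr (wmass s (cub c h)) (1 - 1/q))"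
    by (simp add: ac_simps)
  also have "\<dots> \<le> epowr (wmass w E) (1/q) * (ennreal k * emeasure lebesgue (cub c h))"
    using assms h by (intro mult_left_mono) (auto simp: dual_pair_def)
  finally show "emeasure lebesgue E * epowr (wmass w (cub c h)) (1 / q)
       \<le> ennreal k * emeasure lebesgue (cub c h) * epowr (wmass w E) (1 / q)"
    by (simp add: ac_simps)
qed

lemma powr_dual_eq:
  fixes a b q :: real
  assumes "0 < a" "0 < b" "1 < q" "a powr (1/q) * b powr (1 - 1/q) = 1"
  shows "b = a powr (- 1 / (q - 1))" "a = b powr (1 - q)"
proof -
  have "ln (a powr (1/q) * b powr (1 - 1/q)) = 1/q * ln a + (1 - 1/q) * ln b"
    using assms(1-3) by (simp add: ln_mult ln_powr)
  then have "1/q * ln a + (1 - 1/q) * ln b = 0" using assms(4) by simp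
  then have *: "ln a + (q - 1) * ln b = 0" using assms by (simp add: field_simps)
  then have "ln b = - 1 / (q - 1) * ln a" using assms by (simp add: field_simps)
  then show "b = a powr (- 1 / (q - 1))" using assms by (simp add: powr_def) (metis exp_ln)
  from * have "ln a = (1 - q) * ln b" by (simp add: algebra_simps)
  then show "a = b powr (1 - q)" using assms by (simp add: powr_def) (metis exp_ln)
qed

section \<open>The unweighted maximal function on weighted Lebesgue spaces\<close>

abbreviation maxfun :: "(real ^ 'n \<Rightarrow> ennreal) \<Rightarrow> real ^ 'n \<Rightarrow> ennreal" where
  "maxfun \<equiv> Mw (\<lambda>_. 1)"

lemma wmass_one: "E \<in> sets lebesgue \<Longrightarrow> wmass (\<lambda>_. 1) E = emeasure lebesgue E"
  by (simp add: wmass_def)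

text \<open>Lerner's inequality. The average of \<open>f\<close> over a cube is
  \<open>s(Q)/|Q|\<close> times the average of \<open>f/s\<close> with respect to \<open>s\<close>.
  The latter is below the maximal function of \<open>s\<close> at every point of the cube, and the
  power \<open>q - 1\<close> of \<open>s(Q)/|Q|\<close> is at most
  \<open>k powr q * |Q|/w(Q)\<close>, which completes an average with respect to
  \<open>w\<close>.\<close>

lemma maxfun_pointwise:
  assumes dp: "dual_pair q k w s" and [measurable]: "f \<in> borel_measurable lebesgue"
  shows "epowr (maxfun f x) (q - 1) \<le> ennreal (k powr q) * 
    Mw w (\<lambda>y. epowr (Mw s (\<lambda>z. f z * ennreal (1 / s z)) y) (q - 1) * ennreal (1 / w y)) x"
proof -
  let ?g = "\<lambda>z. f z * ennreal (1 / s z)"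
  let ?\<phi> = "\<lambda>y. epowr (Mw s ?g y) (q - 1) * ennreal (1 / w y)"
  let ?R = "ennreal (k powr q) * Mw w ?\<phi> x"
  have [measurable]: "w \<in> borel_measurable lebesgue" "s \<in> borel_measurable lebesgue"
    and q: "1 < q" and k: "0 < k" and rw: "regular_weight w" and rs: "regular_weight s"
    and ws: "AE x in lebesgue. 0 < w x" "AE x in lebesgue. 0 < s x"
    using dp by (auto simp: dual_pair_def regular_weight_def)
  have "maxfun f x \<le> epowr ?R (1 / (q - 1))"
    unfolding Mw_def[of "\<lambda>_. 1" f]
  proof (rule SUP_least)
    fix Q :: "(real^'a) \<times> real" assume Q: "Q \<in> rcubs"
    obtain c h where ch: "Q = (c,h)" by (cases Q)
    have h: "0 < h" using Q by (auto simp: rcubs_def ch)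
    obtain W where W: "wmass w (cub c h) = ennreal W" "0 < W" using regular_weight_massE[OF rw h] by blast
    obtain S where S: "wmass s (cub c h) = ennreal S" "0 < S" using regular_weight_massE[OF rs h] by blast
    obtain V where V: "emeasure lebesgue (cub c h) = ennreal V" "0 < V" using emeasure_cub_pos[OF h] by blast
    let ?I = "\<integral>\<^sup>+y. f y * indicator (cub c h) y \<partial>lebesgue"
    have ind: "indicator (cub c h) x * (?I / ennreal V) \<le> epowr ?R (1 / (q - 1))"
    proof (cases "x \<in> cub c h")
      case True
      have I: "?I = (\<integral>\<^sup>+y. ?g y * ennreal (s y) * indicator (cub c h) y \<partial>lebesgue)"
        using ws(2) by (intro nn_integral_cong_AE, eventually_elim) (simp add: mult.assoc flip: ennreal_mult)
      have m: "?I / ennreal S \<le> Mw s ?g y" if "y \<in> cub c h" for y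
        using Mw_ge[of c h y ?g s] Q that by (simp add: ch I S)
      \<comment> \<open>The average with respect to \<open>s\<close> is a constant below the maximal
        function on the whole cube, so integrating over the cube produces its volume on the
        left.\<close>
      have A: "epowr (?I / ennreal S) (q - 1) * ennreal V \<le> (\<integral>\<^sup>+y. ?\<phi> y * ennreal (w y) * indicator (cub c h) y \<partial>lebesgue)"
      proof -
        have "epowr (?I / ennreal S) (q - 1) * ennreal V = (\<integral>\<^sup>+y. epowr (?I / ennreal S) (q - 1) * indicator (cub c h) y \<partial>lebesgue)"
          by (simp add: nn_integral_cmult V)
        also have "\<dots> \<le> (\<integral>\<^sup>+y. epowr (Mw s ?g y) (q - 1) * indicator (cub c h) y \<partial>lebesgue)"
          using m q by (intro nn_integral_mono) (auto simp: indicator_def intro!: epowr_mono)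
        also have "\<dots> = (\<integral>\<^sup>+y. ?\<phi> y * ennreal (w y) * indicator (cub c h) y \<partial>lebesgue)"
          using ws(1) by (intro nn_integral_cong_AE, eventually_elim) (simp add: mult.assoc flip: ennreal_mult)
        finally show ?thesis .
      qed
      \<comment> \<open>The joint condition raised to the power \<open>q\<close> and divided by
        powers of the volume.\<close>
      have ap: "(S / V) powr (q - 1) \<le> k powr q * (V / W)"
      proof -
        have "epowr (wmass w (cub c h)) (1 / q) * epowr (wmass s (cub c h)) (1 - 1 / q)
          \<le> ennreal k * emeasure lebesgue (cub c h)" using dp h by (simp add: dual_pair_def)
        then have "W powr (1/q) * S powr (1 - 1/q) \<le> k * V"
          using W S V k by (simp add: epowr_ennreal flip: ennreal_mult)
        then have "(W powr (1/q) * S powr (1 - 1/q)) powr q \<le> (k * V) powr q"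
          using q by (intro powr_mono2) auto
        then have "W * S powr (q - 1) \<le> k powr q * V powr q"
          using W S V k q by (simp add: powr_mult powr_powr algebra_simps)
        moreover have "V powr q = V powr (q - 1) * V" using V powr_add[of V "q-1" 1] by simp
        ultimately show ?thesis using V W S by (simp add: powr_divide field_simps)
      qed
      have "epowr (?I / ennreal V) (q - 1) = epowr (?I / ennreal S) (q - 1) * ennreal ((S / V) powr (q - 1))"
      proof -
        have "ennreal S / ennreal V = ennreal (S / V)" using S V by (simp add: divide_ennreal)
        moreover have "?I / ennreal V = (?I / ennreal S) * (ennreal S / ennreal V)"
        proof -
          have "(?I / ennreal S) * (ennreal S / ennreal V) = (?I / ennreal S) * ennreal S / ennreal V"
            by (rule ennreal_times_divide)
          also have "(?I / ennreal S) * ennreal S = ?I"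
            using S by (simp add: ennreal_divide_times)
          finally show ?thesis by simp
        qed
        ultimately show ?thesis using q S V by (simp add: epowr_mult epowr_ennreal)
      qed
      also have "\<dots> \<le> epowr (?I / ennreal S) (q - 1) * ennreal (k powr q * (V / W))"
        by (intro mult_left_mono ennreal_leI ap) simp
      also have "\<dots> = ennreal (k powr q) * ((epowr (?I / ennreal S) (q - 1) * ennreal V) / ennreal W)"
      proof -
        have "ennreal (k powr q * (V / W)) = ennreal (k powr q) * (ennreal V / ennreal W)"
          using V W by (subst ennreal_mult) (auto simp: divide_ennreal)
        then show ?thesis by (simp only: ennreal_times_divide[symmetric] mult.assoc mult.left_commute)
      qed
      also have "\<dots> \<le> ennreal (k powr q) * ((\<integral>\<^sup>+y. ?\<phi> y * ennreal (w y) * indicator (cub c h) y \<partial>lebesgue) / ennreal W)"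
        by (intro mult_left_mono divide_right_mono_ennreal A) simp
      also have "\<dots> \<le> ?R"
        using Mw_ge[of c h x ?\<phi> w] Q True by (intro mult_left_mono) (auto simp: ch W)
      finally show ?thesis using True q by (simp add: epowr_le_swap)
    qed simp
    then show "indicator (cub (fst Q) (snd Q)) x * ((\<integral>\<^sup>+y. f y * ennreal 1 * indicator (cub (fst Q) (snd Q)) y \<partial>lebesgue) 
        / wmass (\<lambda>_. 1) (cub (fst Q) (snd Q))) \<le> epowr ?R (1 / (q - 1))"
      by (simp add: ch wmass_one V)
  qed
  then show ?thesis using q by (simp add: epowr_le_swap)
qed

text \<open>The price of the pointwise inequality raised to \<open>q' = q/(q-1)\<close>, times the
  norms of the maximal functions of \<open>w\<close> with exponent \<open>q'\<close> and of
  \<open>s\<close> with exponent \<open>q\<close>. Only \<open>n\<close>, \<open>q\<close> and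
  \<open>k\<close> enter, which gives uniformity over all weights with the same bound
  \<open>k\<close>.\<close>

definition maxfun_const :: "nat \<Rightarrow> real \<Rightarrow> real \<Rightarrow> real" where
  "maxfun_const n q k = (k powr q) powr (q / (q - 1)) *
     (Mw_const ((k * 3 ^ n) powr q) (q / (q - 1)) * Mw_const ((k * 3 ^ n) powr (q / (q - 1))) q)"

text \<open>Each of the two weighted maximal functions acts on a Lebesgue space of its own measure,
  where doubling alone bounds it. The inner function is transported between \<open>w\<close> and
  \<open>s\<close> by the duality relation.\<close>

theorem maxfun_bounded:
  fixes w s :: "real ^ 'n \<Rightarrow> real"
  assumes dp: "dual_pair q k w s" and [measurable]: "f \<in> borel_measurable lebesgue"
  shows "(\<integral>\<^sup>+x. epowr (maxfun f x) q * ennreal (w x) \<partial>lebesgue)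
    \<le> ennreal (maxfun_const CARD('n) q k) * (\<integral>\<^sup>+x. epowr (f x) q * ennreal (w x) \<partial>lebesgue)"
proof -
  let ?g = "\<lambda>z. f z * ennreal (1 / s z)"
  let ?\<phi> = "\<lambda>y. epowr (Mw s ?g y) (q - 1) * ennreal (1 / w y)"
  let ?q = "q / (q - 1)"
  have [measurable]: "w \<in> borel_measurable lebesgue" "s \<in> borel_measurable lebesgue"
    and q: "1 < q" and k: "0 < k" and rw: "regular_weight w" and rs: "regular_weight s"
    and ws: "AE x in lebesgue. 0 < w x" "AE x in lebesgue. 0 < s x"
    and ae: "AE x in lebesgue. w x powr (1 / q) * s x powr (1 - 1 / q) = 1"
    using dp by (auto simp: dual_pair_def regular_weight_def)
  have q': "1 < ?q" using q by simp
  have dw: "doubling ((k * 3 ^ CARD('n)) powr q) w"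
    by (rule thick_doubling[OF rw dual_pair_thick[OF dp]]) (use q k in auto)
  have ds: "doubling ((k * 3 ^ CARD('n)) powr ?q) s"
    by (rule thick_doubling[OF rs dual_pair_thick[OF dual_pair_sym[OF dp]]]) (use q' k in auto)
  have "(\<integral>\<^sup>+x. epowr (maxfun f x) q * ennreal (w x) \<partial>lebesgue) \<le>
     (\<integral>\<^sup>+x. ennreal ((k powr q) powr ?q) * (epowr (Mw w ?\<phi> x) ?q * ennreal (w x)) \<partial>lebesgue)"
  proof (rule nn_integral_mono)
    fix x
    have "epowr (epowr (maxfun f x) (q - 1)) ?q \<le> epowr (ennreal (k powr q) * Mw w ?\<phi> x) ?q"
      by (intro epowr_mono maxfun_pointwise[OF dp]) (use q' in auto)
    then have "epowr (maxfun f x) q \<le> ennreal ((k powr q) powr ?q) * epowr (Mw w ?\<phi> x) ?q"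
      using q q' by (simp add: epowr_epowr epowr_mult epowr_ennreal)
    then show "epowr (maxfun f x) q * ennreal (w x) \<le> ennreal ((k powr q) powr ?q) * (epowr (Mw w ?\<phi> x) ?q * ennreal (w x))"
      by (subst mult.assoc[symmetric]) (rule mult_right_mono, auto)
  qed
  also have "\<dots> = ennreal ((k powr q) powr ?q) * (\<integral>\<^sup>+x. epowr (Mw w ?\<phi> x) ?q * ennreal (w x) \<partial>lebesgue)"
    by (rule nn_integral_cmult) measurable
  also have "\<dots> \<le> ennreal ((k powr q) powr ?q) * (ennreal (Mw_const ((k * 3 ^ CARD('n)) powr q) ?q) *
       (\<integral>\<^sup>+x. epowr (?\<phi> x) ?q * ennreal (w x) \<partial>lebesgue))"
    by (intro mult_left_mono Mw_strong dw q') auto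
  \<comment> \<open>Here \<open>w powr (1 - q') = s\<close>, so the power \<open>q'\<close> of the
    outer function, integrated against \<open>w\<close>, is a power \<open>q\<close> integrated
    against \<open>s\<close>.\<close>
  also have "(\<integral>\<^sup>+x. epowr (?\<phi> x) ?q * ennreal (w x) \<partial>lebesgue) = (\<integral>\<^sup>+x. epowr (Mw s ?g x) q * ennreal (s x) \<partial>lebesgue)"
    using ws ae
  proof (intro nn_integral_cong_AE, eventually_elim)
    case (elim x)
    have s: "s x = w x powr (- 1 / (q - 1))" using powr_dual_eq[of "w x" "s x" q] elim q by simp
    have "(1 / w x) powr ?q * w x = w x powr (1 - ?q)"
      using elim by (simp add: powr_divide powr_diff)
    also have "1 - ?q = - 1 / (q - 1)" using q by (simp add: field_simps)
    finally have "(1 / w x) powr ?q * w x = s x" using s by simp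
    then have "ennreal ((1 / w x) powr ?q) * ennreal (w x) = ennreal (s x)" 
      using elim by (simp flip: ennreal_mult)
    then show ?case using q q' elim
      by (simp add: epowr_mult epowr_epowr epowr_ennreal mult.assoc)
  qed
  also have "\<dots> \<le> ennreal (Mw_const ((k * 3 ^ CARD('n)) powr ?q) q) * (\<integral>\<^sup>+x. epowr (?g x) q * ennreal (s x) \<partial>lebesgue)"
    by (intro Mw_strong ds q) auto
  \<comment> \<open>Conversely \<open>s powr (1 - q) = w\<close> turns \<open>f/s\<close> against
    \<open>s\<close> back into \<open>f\<close> against \<open>w\<close>.\<close>
  also have "(\<integral>\<^sup>+x. epowr (?g x) q * ennreal (s x) \<partial>lebesgue) = (\<integral>\<^sup>+x. epowr (f x) q * ennreal (w x) \<partial>lebesgue)"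
    using ws ae
  proof (intro nn_integral_cong_AE, eventually_elim)
    case (elim x)
    have w: "w x = s x powr (1 - q)" using powr_dual_eq[of "w x" "s x" q] elim q by simp
    have "(1 / s x) powr q * s x = w x"
      using elim w by (simp add: powr_divide powr_diff)
    then have "ennreal ((1 / s x) powr q) * ennreal (s x) = ennreal (w x)" 
      using elim by (simp flip: ennreal_mult)
    then show ?case using q q' elim
      by (simp add: epowr_mult epowr_ennreal mult.assoc)
  qed
  finally have fin: "(\<integral>\<^sup>+x. epowr (maxfun f x) q * ennreal (w x) \<partial>lebesgue) \<le>
    ennreal ((k powr q) powr ?q) * (ennreal (Mw_const ((k * 3 ^ CARD('n)) powr q) ?q) *
     (ennreal (Mw_const ((k * 3 ^ CARD('n)) powr ?q) q) * (\<integral>\<^sup>+x. epowr (f x) q * ennreal (w x) \<partial>lebesgue)))"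
    by (simp add: mult_left_mono)
  have "0 \<le> Mw_const ((k * 3 ^ CARD('n)) powr q) ?q" "0 \<le> Mw_const ((k * 3 ^ CARD('n)) powr ?q) q"
    using q q' by (auto simp: Mw_const_def)
  then show ?thesis using fin by (simp add: ennreal_mult_mult maxfun_const_def mult.assoc)
qed

subsection \<open>The Rubio de Francia algorithm\<close>

lemma maxfun_average:
  fixes g :: "real ^ 'n \<Rightarrow> ennreal"
  assumes h: "0 < h" and x: "x \<in> cub c h"
  shows "(\<integral>\<^sup>+y. g y * indicator (cub c h) y \<partial>lebesgue) \<le> ennreal (2 ^ CARD('n)) * emeasure lebesgue (cub c h) * maxfun g x"
proof -
  obtain c' h' where Q: "(c', h') \<in> rcubs" "cub c h \<subseteq> cub c' h'" "h' \<le> 2 * h"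
    using rcubs_cover[OF h, of c] by blast
  have h': "0 < h'" using Q by (auto simp: rcubs_def)
  obtain v where v: "emeasure lebesgue (cub c' h') = ennreal v" "0 < v" using emeasure_cub_pos[OF h'] by blast
  let ?I = "\<integral>\<^sup>+y. g y * indicator (cub c' h') y \<partial>lebesgue"
  have "(\<integral>\<^sup>+y. g y * indicator (cub c h) y \<partial>lebesgue) \<le> ?I"
    using Q(2) by (intro nn_integral_mono) (auto simp: indicator_def)
  also have "?I = ennreal v * (?I / ennreal v)"
    unfolding ennreal_times_divide using v
    by (subst mult.commute, subst mult_divide_eq_ennreal) auto
  also have "\<dots> \<le> ennreal v * maxfun g x"
    using Mw_ge[of c' h' x g "\<lambda>_. 1"] Q x by (intro mult_left_mono) (auto simp: wmass_one v)
  also have "ennreal v = ennreal ((2 * h') ^ CARD('n))" using v(1) h' by (simp only: emeasure_cub less_imp_le)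
  also have "ennreal ((2 * h') ^ CARD('n)) \<le> ennreal (2 ^ CARD('n) * (2 * h) ^ CARD('n))"
  proof (rule ennreal_leI)
    have "(2 * h') ^ CARD('n) \<le> (2 * (2 * h)) ^ CARD('n)" using Q h h' by (intro power_mono) auto
    then show "(2 * h') ^ CARD('n) \<le> 2 ^ CARD('n) * (2 * h) ^ CARD('n)" by (simp only: power_mult_distrib)
  qed
  also have "\<dots> = ennreal (2 ^ CARD('n)) * emeasure lebesgue (cub c h)"
    using h by (subst emeasure_cub) (auto simp: ennreal_mult)
  finally show ?thesis by (simp add: mult_right_mono)
qed

lemma ennreal_mult_regroup:
  fixes x :: ennreal assumes "x * y = a * z" shows "x * (y * v * m) = (a * v) * (z * m)"
proof -
  have "x * (y * v * m) = (x * y) * v * m" by (simp only: mult.assoc)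
  also have "\<dots> = (a * v) * (z * m)" unfolding assms by (simp only: ac_simps)
  finally show ?thesis .
qed

section \<open>Summing the iterates of the maximal function\<close>

lemma suminf_shift_le: "(\<Sum>j. f (j + i)) \<le> (\<Sum>j. f j :: ennreal)"
  by (subst suminf_offset[of f i]) auto

lemma suminf_Suc_le: "(\<Sum>j. f (Suc j)) \<le> (\<Sum>j. f j :: ennreal)"
  using suminf_shift_le[of f 1] by simp

text \<open>A supremum is bounded by the sum of powers; this replaces the triangle inequality in
  weighted Lebesgue spaces.\<close>

lemma epowr_SUP_le_suminf:
  fixes y :: "nat \<Rightarrow> ennreal"
  assumes "0 < q" shows "epowr (SUP j. y j) q \<le> (\<Sum>j. epowr (y j) q)"
proof -
  have "y j \<le> epowr (\<Sum>j. epowr (y j) q) (1/q)" for j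
  proof -
    have "epowr (y j) q \<le> (\<Sum>j. epowr (y j) q)"
      using sum_le_suminf[of "\<lambda>j. epowr (y j) q" "{j}"] by simp
    then show ?thesis using assms by (simp add: epowr_le_swap)
  qed
  then have "(SUP j. y j) \<le> epowr (\<Sum>j. epowr (y j) q) (1/q)" by (rule SUP_least)
  then show ?thesis using assms by (simp add: epowr_le_swap)
qed

text \<open>The factor \<open>2 ^ n\<close> is the loss in \<open>maxfun_average\<close>, and
  \<open>4 * b\<close> is the ratio of the series in \<open>rubio_de_francia\<close>, where
  \<open>b\<close> bounds the norm of the maximal function.\<close>

definition rdf_const :: "nat \<Rightarrow> real \<Rightarrow> real \<Rightarrow> real" where
  "rdf_const n q k = 2 ^ n * (4 * (max 1 (maxfun_const n q k)) powr (1 / q))"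

text \<open>The condition \<open>A_1\<close> with an explicit constant and multiplied by the volume.
  Finite mass on cubes is not part of it but follows in \<open>A1_bound_finite\<close>.\<close>

definition A1_bound :: "real \<Rightarrow> (real ^ 'n \<Rightarrow> real) \<Rightarrow> bool" where
  "A1_bound A v \<longleftrightarrow> v \<in> borel_measurable lebesgue \<and> (\<forall>x. 0 \<le> v x) \<and> (AE x in lebesgue. 0 < v x) \<and>
     (\<forall>c h. 0 < h \<longrightarrow> (AE x in lebesgue. x \<in> cub c h \<longrightarrow>
        wmass v (cub c h) \<le> ennreal (A * v x) * emeasure lebesgue (cub c h)))"

lemma suminf_half_ennreal: "(\<Sum>j. ennreal ((1/2) ^ j)) = 2"
proof -
  have "(\<Sum>j. ennreal ((1/2) ^ j)) = ennreal (\<Sum>j. (1/2) ^ j)"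
    by (intro suminf_ennreal2) (auto intro: summable_geometric)
  then show ?thesis by (simp add: suminf_geometric)
qed

lemma rubio_de_francia:
  fixes w s :: "real ^ 'n \<Rightarrow> real"
  assumes dp: "dual_pair q k w s" and F [measurable]: "F \<in> borel_measurable lebesgue"
    and F1: "(\<integral>\<^sup>+x. epowr (F x) q * ennreal (w x) \<partial>lebesgue) \<le> 1"
    and F0: "(\<integral>\<^sup>+x. F x \<partial>lebesgue) \<noteq> 0"
  obtains H :: "real ^ 'n \<Rightarrow> real" where "A1_bound (rdf_const CARD('n) q k) H"
    "AE x in lebesgue. F x \<le> ennreal (H x)"
    "(\<integral>\<^sup>+x. ennreal (H x powr q * w x) \<partial>lebesgue) \<le> ennreal (2 powr q * 2)"
proof -
  define C where "C = max 1 (maxfun_const CARD('n) q k)"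
  define b where "b = C powr (1/q)"
  define A where "A = 2 ^ CARD('n) * (4 * b)"
  have A: "A = rdf_const CARD('n) q k" by (simp add: A_def b_def C_def rdf_const_def)
  have [measurable]: "w \<in> borel_measurable lebesgue"
    and q: "1 < q" and k: "0 < k" and w0: "AE x in lebesgue. 0 < w x" and wnn: "\<And>x. 0 \<le> w x"
    using dp by (auto simp: dual_pair_def regular_weight_def)
  have C1: "1 \<le> C" and b1: "1 \<le> b" using q by (auto simp: C_def b_def ge_one_powr_ge_zero)
  have bq: "b powr q = C" using q C1 by (simp add: b_def powr_powr)
  define M where "M j = (maxfun ^^ j) F" for j
  have M0: "M 0 = F" and MS: "M (Suc j) = maxfun (M j)" for j by (simp_all add: M_def)
  have Mm [measurable]: "M j \<in> borel_measurable lebesgue" for j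
    by (cases j) (auto simp: M0 MS)
  have Mb: "(\<integral>\<^sup>+x. epowr (M j x) q * ennreal (w x) \<partial>lebesgue) \<le> ennreal (C ^ j)" for j
  proof (induction j)
    case (Suc j)
    have "(\<integral>\<^sup>+x. epowr (M (Suc j) x) q * ennreal (w x) \<partial>lebesgue)
       \<le> ennreal (maxfun_const CARD('n) q k) * (\<integral>\<^sup>+x. epowr (M j x) q * ennreal (w x) \<partial>lebesgue)"
      unfolding MS by (rule maxfun_bounded[OF dp]) measurable
    also have "\<dots> \<le> ennreal C * ennreal (C ^ j)"
      by (intro mult_mono Suc ennreal_leI) (auto simp: C_def)
    finally show ?case using C1 by (simp add: ennreal_mult)
  qed (use F1 M0 in simp)
  \<comment> \<open>The ratio is \<open>4 * b\<close> rather than \<open>2 * b\<close>: one factor 2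
    makes the norms of the terms summable, the other is spent when the sum is replaced by a
    supremum. Shifting the index by one costs exactly \<open>4 * b\<close>, whence the
    \<open>A_1\<close> property.\<close>
  define He where "He x = (\<Sum>j. ennreal ((1 / (4 * b)) ^ j) * M j x)" for x
  have Hm [measurable]: "He \<in> borel_measurable lebesgue" unfolding He_def[abs_def] by measurable
  have FH: "F x \<le> He x" for x
    using sum_le_suminf[of "\<lambda>j. ennreal ((1 / (4 * b)) ^ j) * M j x" "{0}"] by (simp add: He_def M0)
  have avg: "(\<integral>\<^sup>+y. He y * indicator (cub c h) y \<partial>lebesgue) \<le> ennreal A * emeasure lebesgue (cub c h) * He x"
    if h: "0 < h" and x: "x \<in> cub c h" for c h x
  proof -
    have "(\<integral>\<^sup>+y. He y * indicator (cub c h) y \<partial>lebesgue) =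
        (\<integral>\<^sup>+y. (\<Sum>j. ennreal ((1 / (4 * b)) ^ j) * M j y * indicator (cub c h) y) \<partial>lebesgue)"
      by (simp add: He_def)
    also have "\<dots> = (\<Sum>j. \<integral>\<^sup>+y. ennreal ((1 / (4 * b)) ^ j) * M j y * indicator (cub c h) y \<partial>lebesgue)"
      by (rule nn_integral_suminf) measurable
    also have "\<dots> = (\<Sum>j. ennreal ((1 / (4 * b)) ^ j) * (\<integral>\<^sup>+y. M j y * indicator (cub c h) y \<partial>lebesgue))"
      by (simp add: mult.assoc nn_integral_cmult)
    also have "\<dots> \<le> (\<Sum>j. ennreal ((1 / (4 * b)) ^ j) * (ennreal (2 ^ CARD('n)) * emeasure lebesgue (cub c h) * M (Suc j) x))"
      unfolding MS by (intro suminf_le mult_left_mono maxfun_average h x) auto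
    also have "\<dots> = (\<Sum>j. (ennreal A * emeasure lebesgue (cub c h)) * (ennreal ((1 / (4 * b)) ^ Suc j) * M (Suc j) x))"
    proof (intro suminf_cong)
      fix j
      have "(1 / (4 * b)) ^ j * 2 ^ CARD('n) = A * (1 / (4 * b)) ^ Suc j" using b1 by (simp add: A_def)
      moreover have "0 \<le> A" "0 \<le> 1 / (4 * b)" using b1 by (auto simp: A_def)
      ultimately have "ennreal ((1 / (4 * b)) ^ j) * ennreal (2 ^ CARD('n)) = ennreal A * ennreal ((1 / (4 * b)) ^ Suc j)"
        by (simp only: ennreal_mult[symmetric] zero_le_power zero_le_numeral)
      then show "ennreal ((1 / (4 * b)) ^ j) * (ennreal (2 ^ CARD('n)) * emeasure lebesgue (cub c h) * M (Suc j) x) =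
        (ennreal A * emeasure lebesgue (cub c h)) * (ennreal ((1 / (4 * b)) ^ Suc j) * M (Suc j) x)"
        by (rule ennreal_mult_regroup)
    qed
    also have "\<dots> = (ennreal A * emeasure lebesgue (cub c h)) * (\<Sum>j. ennreal ((1 / (4 * b)) ^ Suc j) * M (Suc j) x)"
      by (rule ennreal_suminf_cmult)
    also have "\<dots> \<le> (ennreal A * emeasure lebesgue (cub c h)) * He x"
      unfolding He_def by (intro mult_left_mono suminf_Suc_le) auto
    finally show ?thesis .
  qed
  have Hq: "(\<integral>\<^sup>+x. epowr (He x) q * ennreal (w x) \<partial>lebesgue) \<le> ennreal (2 powr q * 2)"
  proof -
    \<comment> \<open>One factor \<open>(1/2) ^ j\<close> is split off the coefficients; the sum is
      then at most twice the supremum of the \<open>y j\<close>, and the powers of the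
      \<open>y j\<close> still have geometrically decreasing integrals.\<close>
    define y where "y j x = ennreal ((1 / (2 * b)) ^ j) * M j x" for j x
    have [measurable]: "y j \<in> borel_measurable lebesgue" for j unfolding y_def by measurable
    have He2: "He x \<le> 2 * (SUP j. y j x)" for x
    proof -
      have "He x = (\<Sum>j. ennreal ((1/2) ^ j) * y j x)"
        unfolding He_def y_def using b1
        by (intro suminf_cong) (simp add: mult.assoc[symmetric] ennreal_mult[symmetric] power_mult_distrib[symmetric])
      also have "\<dots> \<le> (\<Sum>j. ennreal ((1/2) ^ j) * (SUP j. y j x))"
        by (intro suminf_le mult_left_mono SUP_upper) auto
      also have "\<dots> = (\<Sum>j. ennreal ((1/2) ^ j)) * (SUP j. y j x)" by simp
      also have "(\<Sum>j. ennreal ((1/2) ^ j)) = 2" by (rule suminf_half_ennreal)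
      finally show ?thesis .
    qed
    have yb: "(\<integral>\<^sup>+x. epowr (y j x) q * ennreal (w x) \<partial>lebesgue) \<le> ennreal ((1/2) ^ j)" for j
    proof -
      have "(\<integral>\<^sup>+x. epowr (y j x) q * ennreal (w x) \<partial>lebesgue) = 
         ennreal (((1 / (2 * b)) ^ j) powr q) * (\<integral>\<^sup>+x. epowr (M j x) q * ennreal (w x) \<partial>lebesgue)"
        using q b1 by (subst nn_integral_cmult[symmetric]) (auto simp: y_def epowr_mult epowr_ennreal mult.assoc)
      also have "\<dots> \<le> ennreal (((1 / (2 * b)) ^ j) powr q) * ennreal (C ^ j)"
        by (intro mult_left_mono Mb) simp
      also have "\<dots> = ennreal (((1 / (2 * b)) ^ j) powr q * C ^ j)"
        using C1 by (simp add: ennreal_mult)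
      also have "\<dots> \<le> ennreal ((1/2) ^ j)"
      proof (rule ennreal_leI)
        have "((1 / (2 * b)) ^ j) powr q = ((1 / (2 * b)) powr q) ^ j"
          using b1 by (simp add: powr_powr mult.commute flip: powr_realpow)
        also have "(1 / (2 * b)) powr q = (1/2) powr q / C"
          using b1 by (simp add: powr_divide powr_mult bq)
        finally have "((1 / (2 * b)) ^ j) powr q * C ^ j = ((1/2) powr q) ^ j"
          using C1 by (simp add: power_divide)
        also have "(1/2) powr q \<le> (1/2) powr (1::real)" using q by (intro powr_mono') auto
        then have "((1/2) powr q) ^ j \<le> (1/2) ^ j" by (intro power_mono) auto
        finally show "((1 / (2 * b)) ^ j) powr q * C ^ j \<le> (1/2) ^ j" .
      qed
      finally show ?thesis .
    qed
    have "(\<integral>\<^sup>+x. epowr (He x) q * ennreal (w x) \<partial>lebesgue) \<le>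
      (\<integral>\<^sup>+x. ennreal (2 powr q) * (\<Sum>j. epowr (y j x) q * ennreal (w x)) \<partial>lebesgue)"
    proof (rule nn_integral_mono)
      fix x
      have "epowr (He x) q \<le> epowr (2 * (SUP j. y j x)) q" by (intro epowr_mono He2) (use q in simp)
      also have "\<dots> = ennreal (2 powr q) * epowr (SUP j. y j x) q"
        using q epowr_ennreal[of 2 q] by (simp add: epowr_mult)
      also have "\<dots> \<le> ennreal (2 powr q) * (\<Sum>j. epowr (y j x) q)"
        by (intro mult_left_mono epowr_SUP_le_suminf) (use q in auto)
      finally have "epowr (He x) q * ennreal (w x) \<le> ennreal (2 powr q) * (\<Sum>j. epowr (y j x) q) * ennreal (w x)"
        by (rule mult_right_mono) simp
      then show "epowr (He x) q * ennreal (w x) \<le> ennreal (2 powr q) * (\<Sum>j. epowr (y j x) q * ennreal (w x))"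
        by (simp add: mult.assoc)
    qed
    also have "\<dots> = ennreal (2 powr q) * (\<Sum>j. \<integral>\<^sup>+x. epowr (y j x) q * ennreal (w x) \<partial>lebesgue)"
      by (subst nn_integral_cmult, measurable) (subst nn_integral_suminf, auto)
    also have "\<dots> \<le> ennreal (2 powr q) * (\<Sum>j. ennreal ((1/2) ^ j))"
      by (intro mult_left_mono suminf_le yb) auto
    also have "\<dots> = ennreal (2 powr q * 2)" unfolding suminf_half_ennreal by (simp add: ennreal_mult)
    finally show ?thesis .
  qed
  have Hfin: "AE x in lebesgue. He x \<noteq> top"
  proof -
    have "(\<integral>\<^sup>+x. epowr (He x) q * ennreal (w x) \<partial>lebesgue) \<noteq> \<infinity>"
      using Hq by (auto simp: top_unique)
    then have "AE x in lebesgue. epowr (He x) q * ennreal (w x) \<noteq> \<infinity>"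
      by (intro nn_integral_PInf_AE) auto
    then show ?thesis using w0 by eventually_elim (auto simp: ennreal_top_mult)
  qed
  \<comment> \<open>A zero at one point forces the integrals over all cubes centred there to vanish,
    hence \<open>F = 0\<close> almost everywhere.\<close>
  have Hpos: "He x \<noteq> 0" for x
  proof
    assume H0: "He x = 0"
    have "AE y in lebesgue. y \<in> cub x (2 ^ j * 1) \<longrightarrow> F y = 0" for j :: nat
    proof -
      have "(\<integral>\<^sup>+y. He y * indicator (cub x (2 ^ j * 1)) y \<partial>lebesgue) \<le> 0"
        using avg[of "2 ^ j * 1" x x] H0 by (simp add: center_in_cub)
      then have "AE y in lebesgue. He y * indicator (cub x (2 ^ j * 1)) y = 0"
        by (subst (asm) le_zero_eq, subst (asm) nn_integral_0_iff_AE) auto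
      then show ?thesis
      proof eventually_elim
        case (elim y)
        then show ?case using FH[of y] by auto
      qed
    qed
    then have "AE y in lebesgue. \<forall>j. y \<in> cub x (2 ^ j * 1) \<longrightarrow> F y = 0" by (intro AE_all_countable[THEN iffD2] allI)
    then have "AE y in lebesgue. F y = 0"
      by eventually_elim (use ex_cub[of 1] in force)
    then show False using F0 by (simp add: nn_integral_0_iff_AE)
  qed
  define H where "H x = enn2real (He x)" for x
  have HH: "AE x in lebesgue. ennreal (H x) = He x"
    using Hfin by eventually_elim (simp add: H_def ennreal_enn2real_if)
  have Hmeas: "H \<in> borel_measurable lebesgue" unfolding H_def[abs_def] by measurable
  have b0: "0 \<le> A" using b1 by (simp add: A_def)
  have "A1_bound A H"
    unfolding A1_bound_def
  proof (intro conjI allI impI Hmeas)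
    show "0 \<le> H x" for x by (simp add: H_def)
    show "AE x in lebesgue. 0 < H x" using Hfin 
      by eventually_elim (auto simp: H_def enn2real_positive_iff less_top Hpos zero_less_iff_neq_zero)
    fix c h assume h: "(0::real) < h"
    have eq: "wmass H (cub c h) = (\<integral>\<^sup>+y. He y * indicator (cub c h) y \<partial>lebesgue)"
      unfolding wmass_def using HH by (intro nn_integral_cong_AE, eventually_elim) simp
    show "AE x in lebesgue. x \<in> cub c h \<longrightarrow>
        wmass H (cub c h) \<le> ennreal (A * H x) * emeasure lebesgue (cub c h)"
      using HH
    proof eventually_elim
      case (elim x)
      have "ennreal (A * H x) * emeasure lebesgue (cub c h) = ennreal A * emeasure lebesgue (cub c h) * He x"
        using b0 elim by (simp add: ennreal_mult' ac_simps)
      then show ?case using avg[OF h, of x c] eq by simp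
    qed
  qed
  moreover have "AE x in lebesgue. F x \<le> ennreal (H x)"
    using HH by eventually_elim (use FH in simp)
  moreover have "(\<integral>\<^sup>+x. ennreal (H x powr q * w x) \<partial>lebesgue) = (\<integral>\<^sup>+x. epowr (He x) q * ennreal (w x) \<partial>lebesgue)"
    using HH
  proof (intro nn_integral_cong_AE, eventually_elim)
    case (elim x)
    have "epowr (He x) q = ennreal (H x powr q)" using elim by (metis H_def enn2real_nonneg epowr_ennreal)
    then show ?case by (simp add: ennreal_mult wnn)
  qed
  ultimately show thesis using that Hq A by simp
qed

subsection \<open>Muckenhoupt classes\<close>

text \<open>Local integrability makes the product with the indicator of each cube measurable, and at
  every point these products are eventually equal to \<open>w\<close>.\<close>

lemma weight_measurable:
  fixes w :: "real ^ 'n \<Rightarrow> real"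
  assumes "weight w" shows "w \<in> borel_measurable lebesgue"
proof (rule borel_measurable_LIMSEQ_real)
  fix j :: nat
  have "integrable lebesgue (\<lambda>x. indicator (cub 0 (2 ^ j * 1)) x *\<^sub>R w x)"
    using assms compact_cub by (auto simp: weight_def locally_integrable_def set_integrable_def)
  then show "(\<lambda>x. indicator (cub 0 (2 ^ j * 1)) x *\<^sub>R w x) \<in> borel_measurable lebesgue"
    by (rule borel_measurable_integrable)
next
  fix x :: "real ^ 'n"
  obtain k :: nat where k: "x \<in> cub 0 (2 ^ k * 1)" using ex_cub[of 1 x 0] by auto
  have "x \<in> cub 0 (2 ^ j * 1)" if "k \<le> j" for j :: nat
    using k cub_mono[of "2 ^ k * 1" "2 ^ j * 1" 0] that power_increasing[of k j "2::real"] by auto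
  then have "eventually (\<lambda>j::nat. indicator (cub 0 (2 ^ j * 1)) x *\<^sub>R w x = w x) sequentially"
    unfolding eventually_sequentially by (intro exI[of _ k]) auto
  then show "(\<lambda>j::nat. indicator (cub 0 (2 ^ j * 1)) x *\<^sub>R w x) \<longlonglongrightarrow> w x"
    by (rule tendsto_eventually)
qed

lemma weight_wmass_finite:
  assumes "weight w" shows "wmass w (cub c h) < top"
proof -
  have "integrable lebesgue (\<lambda>x. indicator (cub c h) x *\<^sub>R w x)"
    using assms compact_cub by (auto simp: weight_def locally_integrable_def set_integrable_def)
  then have "(\<integral>\<^sup>+x. ennreal (norm (indicator (cub c h) x *\<^sub>R w x)) \<partial>lebesgue) < \<infinity>"
    by (simp add: integrable_iff_bounded)
  also have "(\<integral>\<^sup>+x. ennreal (norm (indicator (cub c h) x *\<^sub>R w x)) \<partial>lebesgue) = wmass w (cub c h)"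
    unfolding wmass_def using assms by (intro nn_integral_cong) (auto simp: indicator_def weight_def)
  finally show ?thesis by simp
qed

lemma bounded_subset_cub:
  assumes "bounded K" obtains h where "0 < h" "K \<subseteq> cub 0 h"
proof -
  obtain B where B: "\<And>x. x \<in> K \<Longrightarrow> norm x \<le> B" using assms by (auto simp: bounded_iff)
  have "K \<subseteq> cub 0 (max B 1)"
  proof
    fix x assume "x \<in> K"
    then have "\<bar>x $ i\<bar> \<le> max B 1" for i
      using B[of x] component_le_norm_cart[of x i] by simp
    then show "x \<in> cub 0 (max B 1)" by (simp add: mem_cub)
  qed
  then show thesis by (intro that[of "max B 1"]) auto
qed

lemma weightI:
  assumes [measurable]: "w \<in> borel_measurable lebesgue" and nn: "\<And>x. 0 \<le> w x"
    and fin: "\<And>c h. 0 < h \<Longrightarrow> wmass w (cub c h) < top"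
  shows "weight w"
  unfolding weight_def locally_integrable_def
proof (intro conjI allI impI nn)
  fix K :: "(real^'a) set" assume K: "compact K"
  obtain h where h: "0 < h" "K \<subseteq> cub 0 h" using bounded_subset_cub compact_imp_bounded K by blast
  have [measurable]: "K \<in> sets lebesgue" using K by (auto dest: compact_imp_closed)
  have "(\<integral>\<^sup>+x. ennreal (norm (indicator K x *\<^sub>R w x)) \<partial>lebesgue) = wmass w K"
    unfolding wmass_def using nn by (intro nn_integral_cong) (auto simp: indicator_def)
  also have "\<dots> \<le> wmass w (cub 0 h)" by (rule wmass_mono[OF h(2)])
  also have "\<dots> < \<infinity>" using fin[OF h(1)] by simp
  finally show "set_integrable lebesgue K w"
    unfolding set_integrable_def by (subst integrable_iff_bounded) auto
qed

lemma regular_weight_iff: "regular_weight w \<longleftrightarrow> weight w \<and> (AE x in lebesgue. 0 < w x)"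
  using weight_measurable weight_wmass_finite weightI unfolding regular_weight_def weight_def by blast

section \<open>Muckenhoupt classes in terms of masses of cubes\<close>

lemma avg_cub:
  assumes "emeasure lebesgue (cub c h) = ennreal v" "0 < v" "wmass w (cub c h) = ennreal m" "0 \<le> m"
  shows "avg w (cub c h) = ennreal (m / v)"
  using assms unfolding avg_def by (simp only: divide_ennreal)

lemma Ap_const_le_iff:
  fixes w :: "real ^ 'n \<Rightarrow> real"
  assumes "1 < p"
  shows "Ap_const p w \<le> K \<longleftrightarrow> (\<forall>c h. 0 < h \<longrightarrow> 
     avg w (cub c h) * epowr (avg (\<lambda>x. w x powr (1 - conj_exponent p)) (cub c h)) (p - 1) \<le> K)"
  using assms by (auto simp: Ap_const_def SUP_le_iff cubes_eq)

lemma Ap_const_one_le: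
  assumes "0 \<le> A" "\<And>Q. Q \<in> cubes \<Longrightarrow> AE x in lebesgue. x \<in> Q \<longrightarrow> avg w Q \<le> ennreal (A * w x)"
  shows "Ap_const 1 w \<le> ennreal A"
  unfolding Ap_const_def using assms by (auto intro!: Inf_lower)

lemma Muckenhoupt_regular: "w \<in> Muckenhoupt p \<Longrightarrow> regular_weight w"
  by (simp add: Muckenhoupt_def regular_weight_iff)

lemma dual_exponent: "1 < q \<Longrightarrow> 1 - conj_exponent q = - 1 / (q - 1)"
  by (simp add: conj_exponent_def field_simps)

text \<open>The dual weight has finite mass on cubes because otherwise the Muckenhoupt expression
  would be infinite, the average of \<open>w\<close> being positive. The constant
  \<open>K powr (1/q)\<close> arises from taking \<open>q\<close>-th roots in the condition.\<close>

lemma Muckenhoupt_dual_pair: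
  fixes w :: "real ^ 'n \<Rightarrow> real"
  assumes q: "1 < q" and w: "w \<in> Muckenhoupt q" and K: "Ap_const q w \<le> ennreal K" "0 < K"
  shows "dual_pair q (K powr (1/q)) w (\<lambda>x. w x powr (1 - conj_exponent q))"
proof -
  let ?s = "\<lambda>x. w x powr (1 - conj_exponent q)"
  have rw: "regular_weight w" by (rule Muckenhoupt_regular[OF w])
  have [measurable]: "w \<in> borel_measurable lebesgue" and pos: "AE x in lebesgue. 0 < w x"
    using rw by (auto simp: regular_weight_def)
  have Ap: "avg w (cub c h) * epowr (avg ?s (cub c h)) (q - 1) \<le> ennreal K" if "0 < h" for c h
    using K(1) that q by (simp add: Ap_const_le_iff)
  have fin: "wmass ?s (cub c h) < top" if h: "0 < h" for c h
  proof (rule ccontr)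
    assume "\<not> wmass ?s (cub c h) < top"
    then have top: "wmass ?s (cub c h) = top" by (simp add: not_less top_unique)
    obtain v where v: "emeasure lebesgue (cub c h) = ennreal v" "0 < v" using emeasure_cub_pos[OF h] by blast
    obtain m where m: "wmass w (cub c h) = ennreal m" "0 < m" using regular_weight_massE[OF rw h] by blast
    have "avg ?s (cub c h) = top" unfolding avg_def v(1) top by (simp add: ennreal_top_divide)
    moreover have "avg w (cub c h) \<noteq> 0" using avg_cub[OF v m(1)] m v by simp
    ultimately have "top \<le> ennreal K" using Ap[OF h, of c] by (simp add: ennreal_mult_top)
    then show False by (simp add: top_unique)
  qed
  have "AE x in lebesgue. 0 < ?s x" using pos by eventually_elim simp
  then have rs: "regular_weight ?s" using fin by (simp add: regular_weight_def)
  have ae: "AE x in lebesgue. w x powr (1 / q) * ?s x powr (1 - 1 / q) = 1"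
    using pos
  proof eventually_elim
    case (elim x)
    have "1 / q + (1 - conj_exponent q) * (1 - 1 / q) = 0"
      unfolding dual_exponent[OF q] using q by (simp add: field_simps)
    then show ?case using elim by (simp add: powr_powr flip: powr_add)
  qed
  have "epowr (wmass w (cub c h)) (1 / q) * epowr (wmass ?s (cub c h)) (1 - 1 / q)
        \<le> ennreal (K powr (1/q)) * emeasure lebesgue (cub c h)" if h: "0 < h" for c h
  proof -
    obtain V where v: "emeasure lebesgue (cub c h) = ennreal V" "0 < V" using emeasure_cub_pos[OF h] by blast
    obtain W where m: "wmass w (cub c h) = ennreal W" "0 < W" using regular_weight_massE[OF rw h] by blast
    obtain S where s: "wmass ?s (cub c h) = ennreal S" "0 < S" using regular_weight_massE[OF rs h] by blast
    have "ennreal (W / V) * epowr (ennreal (S / V)) (q - 1) \<le> ennreal K"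
      using Ap[OF h, of c] avg_cub[OF v m(1)] avg_cub[OF v s(1)] m s by simp
    then have "W / V * (S / V) powr (q - 1) \<le> K"
      using m s v K by (simp add: epowr_ennreal flip: ennreal_mult)
    moreover have "V powr q = V powr (q - 1) * V" using v powr_add[of V "q-1" 1] by simp
    ultimately have "W * S powr (q - 1) \<le> K * V powr q"
      using m s v by (simp add: powr_divide field_simps)
    then have "(W * S powr (q - 1)) powr (1/q) \<le> (K * V powr q) powr (1/q)"
      using m s v q by (intro powr_mono2) auto
    then have "W powr (1/q) * S powr (1 - 1/q) \<le> K powr (1/q) * V"
      using m s v q K by (simp add: powr_mult powr_powr diff_divide_distrib)
    then show ?thesis using m s v by (simp add: epowr_ennreal ennreal_leI flip: ennreal_mult)
  qed
  then show ?thesis using q K rw rs ae by (simp add: dual_pair_def)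
qed

text \<open>The strict inequality supplies an admissible constant below \<open>K\<close> without
  deciding whether the infimum is attained. This is the origin of the slack \<open>K + 1\<close> in
  later bounds.\<close>

lemma Muckenhoupt_one_A1_bound:
  fixes w :: "real ^ 'n \<Rightarrow> real"
  assumes w: "w \<in> Muckenhoupt 1" and K: "Ap_const 1 w < ennreal K" 
  shows "A1_bound K w"
proof -
  have rw: "regular_weight w" by (rule Muckenhoupt_regular[OF w])
  obtain c0 where c0: "0 \<le> c0" "ennreal c0 < ennreal K"
    "\<forall>Q\<in>cubes. AE x in lebesgue. x \<in> Q \<longrightarrow> avg w Q \<le> ennreal (c0 * w x)"
    using K unfolding Ap_const_def by (auto simp: Inf_less_iff)
  have c0K: "c0 \<le> K" using c0 by (simp add: ennreal_less_iff)
  have "AE x in lebesgue. x \<in> cub c h \<longrightarrow> wmass w (cub c h) \<le> ennreal (K * w x) * emeasure lebesgue (cub c h)"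
    if h: "0 < h" for c h
  proof -
    obtain v where v: "emeasure lebesgue (cub c h) = ennreal v" "0 < v" using emeasure_cub_pos[OF h] by blast
    obtain m where m: "wmass w (cub c h) = ennreal m" "0 < m" using regular_weight_massE[OF rw h] by blast
    have "AE x in lebesgue. x \<in> cub c h \<longrightarrow> avg w (cub c h) \<le> ennreal (c0 * w x)"
      using c0(3) cub_in_cubes[OF h] by blast
    then show ?thesis
    proof eventually_elim
      case (elim x)
      have w0: "0 \<le> w x" using rw by (simp add: regular_weight_def)
      show ?case
      proof
        assume "x \<in> cub c h"
        then have "m / v \<le> c0 * w x" using elim m v c0 w0 avg_cub[OF v m(1)] by (simp add: ennreal_le_iff)
        also have "\<dots> \<le> K * w x" using c0K w0 by (rule mult_right_mono)
        finally have "m \<le> K * w x * v" using v by (simp add: field_simps)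
        then show "wmass w (cub c h) \<le> ennreal (K * w x) * emeasure lebesgue (cub c h)"
          unfolding v(1) m(1) using c0 c0K w0 v by (subst ennreal_mult[symmetric]) (auto intro: ennreal_leI)
      qed
    qed
  qed
  then show ?thesis using rw by (simp add: A1_bound_def regular_weight_def)
qed

text \<open>If the mass were infinite, the bound could hold at no point of the cube, so the cube
  would be a null set.\<close>

lemma A1_bound_finite:
  fixes v :: "real ^ 'n \<Rightarrow> real"
  assumes "A1_bound A v" "0 < h" shows "wmass v (cub c h) < top"
proof -
  obtain m where m: "emeasure lebesgue (cub c h) = ennreal m" "0 < m" using emeasure_cub_pos[OF assms(2)] by blast
  have ae: "AE x in lebesgue. x \<in> cub c h \<longrightarrow> wmass v (cub c h) \<le> ennreal (A * v x) * emeasure lebesgue (cub c h)"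
    using assms by (simp add: A1_bound_def)
  show ?thesis
  proof (rule ccontr)
    assume "\<not> ?thesis"
    then have top: "wmass v (cub c h) = top" by (simp add: not_less top_unique)
    from ae have "AE x in lebesgue. x \<notin> cub c h"
      by eventually_elim (simp add: m(1) top top_unique ennreal_mult_eq_top_iff)
    then have "emeasure lebesgue (cub c h) = 0"
      by (subst (asm) AE_iff_measurable[OF _ refl]) auto
    then show False using m by simp
  qed
qed

lemma A1_bound_regular: "A1_bound A v \<Longrightarrow> regular_weight v"
  using A1_bound_finite unfolding A1_bound_def regular_weight_def by blast

text \<open>Integration of the pointwise bound over \<open>E\<close>.\<close>

lemma A1_bound_thick:
  fixes v :: "real ^ 'n \<Rightarrow> real"
  assumes v: "A1_bound A v" and A: "0 < A" shows "thick 1 A v"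
  unfolding thick_def
proof (intro allI impI)
  fix c :: "real^'n" and h E assume h: "0 < h" and E [measurable]: "E \<in> sets lebesgue" and sub: "E \<subseteq> cub c h"
  have [measurable]: "v \<in> borel_measurable lebesgue" and nn: "\<And>x. 0 \<le> v x" using v by (auto simp: A1_bound_def)
  have ae: "AE x in lebesgue. x \<in> cub c h \<longrightarrow> wmass v (cub c h) \<le> ennreal (A * v x) * emeasure lebesgue (cub c h)"
    using v h by (simp add: A1_bound_def)
  have "emeasure lebesgue E * wmass v (cub c h) = (\<integral>\<^sup>+x. wmass v (cub c h) * indicator E x \<partial>lebesgue)"
    by (subst nn_integral_cmult) (auto simp: mult.commute)
  also have "\<dots> \<le> (\<integral>\<^sup>+x. (ennreal A * emeasure lebesgue (cub c h)) * (ennreal (v x) * indicator E x) \<partial>lebesgue)"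
    using ae
  proof (intro nn_integral_mono_AE, eventually_elim)
    case (elim x)
    have "ennreal (A * v x) = ennreal A * ennreal (v x)" using A nn by (simp add: ennreal_mult)
    then show ?case using elim sub by (auto simp: indicator_def ac_simps)
  qed
  also have "\<dots> = (ennreal A * emeasure lebesgue (cub c h)) * wmass v E"
    unfolding wmass_def by (rule nn_integral_cmult) measurable
  finally show "emeasure lebesgue E * epowr (wmass v (cub c h)) (1 / 1)
       \<le> ennreal A * emeasure lebesgue (cub c h) * epowr (wmass v E) (1 / 1)" by simp
qed

lemma Muckenhoupt_thick:
  fixes w :: "real ^ 'n \<Rightarrow> real"
  assumes q: "1 \<le> q" and w: "w \<in> Muckenhoupt q" and K: "Ap_const q w \<le> ennreal K" "0 < K"
  shows "thick q ((K + 1) powr (1/q)) w"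
proof (cases "q = 1")
  case True
  have "Ap_const 1 w < ennreal (K + 1)" using K True by (simp add: ennreal_less_iff order_le_less_trans)
  then have "A1_bound (K + 1) w" using w True by (intro Muckenhoupt_one_A1_bound) auto
  then show ?thesis using A1_bound_thick[of "K+1" w] K True by simp
next
  case False
  have "Ap_const q w \<le> ennreal (K + 1)" using K by (meson ennreal_leI le_add_same_cancel1 order_trans zero_le_one)
  then show ?thesis using False q w K by (intro dual_pair_thick[OF Muckenhoupt_dual_pair]) auto
qed

text \<open>The easy direction of Jones' factorization. On a cube, \<open>H\<close> and
  \<open>V\<close> are bounded below by their averages over \<open>A\<close>, and both enter with a
  negative exponent: \<open>H\<close> in the weight, contributing \<open>A powr (q - 1)\<close>, and
  \<open>V\<close> in the dual weight, contributing \<open>A\<close>.\<close>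

lemma A1_factorization:
  fixes H V :: "real ^ 'n \<Rightarrow> real"
  assumes H: "A1_bound A H" and V: "A1_bound A V" and A: "0 < A" and q: "1 \<le> q"
  shows "(\<lambda>x. H x powr (1 - q) * V x) \<in> Muckenhoupt q"
    and "Ap_const q (\<lambda>x. H x powr (1 - q) * V x) \<le> ennreal (A powr q)"
proof -
  let ?W = "\<lambda>x. H x powr (1 - q) * V x"
  have rH: "regular_weight H" and rV: "regular_weight V" using H V by (auto intro: A1_bound_regular)
  have [measurable]: "H \<in> borel_measurable lebesgue" "V \<in> borel_measurable lebesgue"
    and pos: "AE x in lebesgue. 0 < H x" "AE x in lebesgue. 0 < V x" and nn: "\<And>x. 0 \<le> H x" "\<And>x. 0 \<le> V x"
    using rH rV by (auto simp: regular_weight_def)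
  have low: "AE x in lebesgue. x \<in> cub c h \<longrightarrow> m / (A * v) \<le> X x"
    if X: "A1_bound A X" and h: "0 < h" and m: "wmass X (cub c h) = ennreal m" "0 < m"
      and v: "emeasure lebesgue (cub c h) = ennreal v" "0 < v" for X c h m v
  proof -
    have "AE x in lebesgue. x \<in> cub c h \<longrightarrow> wmass X (cub c h) \<le> ennreal (A * X x) * emeasure lebesgue (cub c h)"
      using X h by (simp add: A1_bound_def)
    then show ?thesis
    proof eventually_elim
      case (elim x)
      have X0: "0 \<le> X x" using X by (simp add: A1_bound_def)
      show ?case
      proof
        assume "x \<in> cub c h"
        then have "ennreal m \<le> ennreal (A * X x * v)" using elim m(1) v A X0 by (simp add: ennreal_mult')
        then have "m \<le> A * X x * v" using A X0 v by (simp add: ennreal_le_iff)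
        then show "m / (A * v) \<le> X x" using A v by (simp add: field_simps)
      qed
    qed
  qed
  have Wle: "wmass ?W (cub c h) \<le> ennreal ((mH / (A * v)) powr (1 - q) * mV)"
    if h: "0 < h" and mH: "wmass H (cub c h) = ennreal mH" "0 < mH" 
      and mV: "wmass V (cub c h) = ennreal mV" "0 < mV"
      and v: "emeasure lebesgue (cub c h) = ennreal v" "0 < v" for c h mH mV v
  proof -
    have "wmass ?W (cub c h) \<le> (\<integral>\<^sup>+x. ennreal ((mH / (A * v)) powr (1 - q)) * (ennreal (V x) * indicator (cub c h) x) \<partial>lebesgue)"
      unfolding wmass_def using low[OF H h mH v]
    proof (intro nn_integral_mono_AE, eventually_elim)
      case (elim x)
      have "H x powr (1 - q) * V x \<le> (mH / (A * v)) powr (1 - q) * V x" if "x \<in> cub c h"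
        using elim that q mH A v nn by (intro mult_right_mono powr_mono2') auto
      then show ?case using nn by (auto simp: indicator_def ennreal_mult[symmetric] intro!: ennreal_leI)
    qed
    also have "\<dots> = ennreal ((mH / (A * v)) powr (1 - q)) * wmass V (cub c h)"
      unfolding wmass_def by (rule nn_integral_cmult) measurable
    finally show ?thesis using mV by (simp add: ennreal_mult)
  qed
  have Wfin: "wmass ?W (cub c h) < top" if h: "0 < h" for c h
  proof -
    obtain v where v: "emeasure lebesgue (cub c h) = ennreal v" "0 < v" using emeasure_cub_pos[OF h] by blast
    obtain mH where mH: "wmass H (cub c h) = ennreal mH" "0 < mH" using regular_weight_massE[OF rH h] by blast
    obtain mV where mV: "wmass V (cub c h) = ennreal mV" "0 < mV" using regular_weight_massE[OF rV h] by blast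
    show ?thesis using Wle[OF h mH mV v] by (rule le_less_trans) simp
  qed
  have Wpos: "AE x in lebesgue. 0 < ?W x" using pos by eventually_elim simp
  have rW: "regular_weight ?W" using Wfin Wpos nn by (simp add: regular_weight_def)
  show Ap: "Ap_const q ?W \<le> ennreal (A powr q)"
  proof (cases "q = 1")
    case True
    have "AE x in lebesgue. x \<in> Q \<longrightarrow> avg ?W Q \<le> ennreal (A * ?W x)" if Qc: "Q \<in> cubes" for Q :: "(real ^ 'n) set"
    proof -
      obtain c h where Q: "Q = cub c h" "0 < h" using Qc unfolding cubes_eq by blast
      obtain v where v: "emeasure lebesgue (cub c h) = ennreal v" "0 < v" using emeasure_cub_pos[OF Q(2)] by blast
      obtain mH where mH: "wmass H (cub c h) = ennreal mH" "0 < mH" using regular_weight_massE[OF rH Q(2)] by blast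
      obtain mV where mV: "wmass V (cub c h) = ennreal mV" "0 < mV" using regular_weight_massE[OF rV Q(2)] by blast
      obtain mW where mW: "wmass ?W (cub c h) = ennreal mW" "0 < mW" using regular_weight_massE[OF rW Q(2)] by blast
      have "mW \<le> mV" using Wle[OF Q(2) mH mV v] True mH A v mV mW by (simp add: ennreal_le_iff)
      have "avg ?W Q = ennreal (mW / v)" unfolding Q(1) using mW by (intro avg_cub[OF v]) auto
      from low[OF V Q(2) mV v] pos(1) show ?thesis
      proof eventually_elim
        case (elim x)
        show ?case
        proof
          assume "x \<in> Q"
          then have "mV / (A * v) \<le> V x" using elim Q by simp
          then have "mV / v \<le> A * V x" using A v by (simp add: field_simps)
          moreover have mle: "mW / v \<le> mV / v" using \<open>mW \<le> mV\<close> v by (simp add: divide_right_mono)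
          ultimately have "mW / v \<le> A * V x" by (intro order_trans[OF mle])
          \<comment> \<open>Positivity of \<open>H\<close> matters here, since
            \<open>0 powr 0 = 0\<close>.\<close>
          moreover have "?W x = V x" using elim True by simp
          ultimately have "mW / v \<le> A * ?W x" by (simp only:)
          then show "avg ?W Q \<le> ennreal (A * ?W x)"
            unfolding \<open>avg ?W Q = ennreal (mW / v)\<close> by (rule ennreal_leI)
        qed
      qed
    qed
    then have "Ap_const 1 ?W \<le> ennreal A" by (intro Ap_const_one_le) (use A in auto)
    moreover have "A powr q = A" using A True by simp
    ultimately show ?thesis using True by (simp only:)
  next
    case False
    then have q1: "1 < q" using q by simp
    let ?S = "\<lambda>x. ?W x powr (1 - conj_exponent q)"
    let ?e = "- 1 / (q - 1)"
    show ?thesis unfolding Ap_const_le_iff[OF q1]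
    proof (intro allI impI)
      fix c :: "real^'n" and h :: real assume h: "0 < h"
      obtain v where v: "emeasure lebesgue (cub c h) = ennreal v" "0 < v" using emeasure_cub_pos[OF h] by blast
      obtain mH where mH: "wmass H (cub c h) = ennreal mH" "0 < mH" using regular_weight_massE[OF rH h] by blast
      obtain mV where mV: "wmass V (cub c h) = ennreal mV" "0 < mV" using regular_weight_massE[OF rV h] by blast
      \<comment> \<open>The dual exponent turns the power \<open>1 - q\<close> of \<open>H\<close>
        into \<open>H\<close> itself.\<close>
      have e: "(1 - q) * ?e = 1" using q1 by (simp add: field_simps)
      have "wmass ?S (cub c h) \<le> (\<integral>\<^sup>+x. ennreal ((mV / (A * v)) powr ?e) * (ennreal (H x) * indicator (cub c h) x) \<partial>lebesgue)"
        unfolding wmass_def using low[OF V h mV v] pos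
      proof (intro nn_integral_mono_AE, eventually_elim)
        case (elim x)
        have "?S x = H x * V x powr ?e" unfolding dual_exponent[OF q1] 
          using elim e by (subst powr_mult) (auto simp: powr_powr)
        moreover have "H x * V x powr ?e \<le> H x * (mV / (A * v)) powr ?e" if "x \<in> cub c h"
          using elim that q1 mV A v nn by (intro mult_left_mono powr_mono2') auto
        ultimately show ?case using nn by (auto simp: indicator_def ennreal_mult[symmetric] mult.commute intro!: ennreal_leI)
      qed
      also have "\<dots> = ennreal ((mV / (A * v)) powr ?e) * wmass H (cub c h)"
        unfolding wmass_def by (rule nn_integral_cmult) measurable
      also have "\<dots> = ennreal ((mV / (A * v)) powr ?e * mH)" using mH by (simp add: ennreal_mult)
      finally have "avg ?S (cub c h) \<le> ennreal ((mV / (A * v)) powr ?e * mH) / ennreal v"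
        unfolding avg_def v(1) by (rule divide_right_mono_ennreal)
      also have "\<dots> = ennreal ((mV / (A * v)) powr ?e * mH / v)" using mH v by (simp add: divide_ennreal)
      finally have "epowr (avg ?S (cub c h)) (q - 1) \<le> epowr (ennreal ((mV / (A * v)) powr ?e * mH / v)) (q - 1)"
        using q1 by (intro epowr_mono) auto
      also have "\<dots> = ennreal (((mV / (A * v)) powr ?e * mH / v) powr (q - 1))"
        using mH v by (intro epowr_ennreal) auto
      finally have S: "epowr (avg ?S (cub c h)) (q - 1) \<le> ennreal (((mV / (A * v)) powr ?e * mH / v) powr (q - 1))" .
      have "avg ?W (cub c h) \<le> ennreal ((mH / (A * v)) powr (1 - q) * mV) / ennreal v"
        unfolding avg_def v(1) by (intro divide_right_mono_ennreal Wle h mH mV v)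
      also have "\<dots> = ennreal ((mH / (A * v)) powr (1 - q) * mV / v)" using mV v by (simp add: divide_ennreal)
      finally have "avg ?W (cub c h) * epowr (avg ?S (cub c h)) (q - 1) \<le>
         ennreal ((mH / (A * v)) powr (1 - q) * mV / v) * ennreal (((mV / (A * v)) powr ?e * mH / v) powr (q - 1))"
        by (rule mult_mono[OF _ S]) auto
      also have "\<dots> = ennreal ((mH / (A * v)) powr (1 - q) * mV / v * ((mV / (A * v)) powr ?e * mH / v) powr (q - 1))"
        using mV v by (subst ennreal_mult) auto
      also have "(mH / (A * v)) powr (1 - q) * mV / v * ((mV / (A * v)) powr ?e * mH / v) powr (q - 1) = A powr q"
      proof -
        define a b where "a = mH / v" and "b = mV / v"
        have ab: "0 < a" "0 < b" using mH mV v by (auto simp: a_def b_def)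
        have 1: "mH / (A * v) = a / A" "mV / (A * v) = b / A" by (auto simp: a_def b_def)
        have 2: "((b / A) powr ?e * a) powr (q - 1) = (b / A) powr (-1) * a powr (q - 1)"
          using ab A q1 by (simp add: powr_mult powr_powr)
        have 3: "(b / A) powr (-1) = A / b" using ab A by (simp add: powr_minus)
        have "(a / A) powr (1 - q) * a powr (q - 1) = A powr (q - 1)"
          using ab A by (simp add: powr_divide powr_diff)
        then have "(a / A) powr (1 - q) * b * (A / b * a powr (q - 1)) = A powr (q - 1) * A"
          using ab by (simp add: field_simps)
        also have "\<dots> = A powr q" using A powr_add[of A "q - 1" 1] by simp
        finally show ?thesis using 1 2 3 ab A by (simp add: a_def[symmetric] b_def[symmetric] flip: times_divide_eq_right)
      qed
      finally show "avg ?W (cub c h) * epowr (avg ?S (cub c h)) (q - 1) \<le> ennreal (A powr q)" .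
    qed
  qed
  show "?W \<in> Muckenhoupt q"
    using rW Ap by (auto simp: Muckenhoupt_def regular_weight_iff intro: le_less_trans)
qed

subsection \<open>Extrapolation\<close>

definition pint :: "real \<Rightarrow> (real ^ 'n \<Rightarrow> real) \<Rightarrow> (real ^ 'n \<Rightarrow> real) \<Rightarrow> ennreal" where
  "pint q w F = (\<integral>\<^sup>+x. ennreal (F x powr q * w x) \<partial>lebesgue)"

lemma pint_cmult:
  assumes "0 \<le> c" "\<And>x. 0 \<le> F x" and [measurable]: "F \<in> borel_measurable lebesgue" "w \<in> borel_measurable lebesgue"
  shows "pint q w (\<lambda>x. c * F x) = ennreal (c powr q) * pint q w F"
proof -
  have "pint q w (\<lambda>x. c * F x) = (\<integral>\<^sup>+x. ennreal (c powr q) * ennreal (F x powr q * w x) \<partial>lebesgue)"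
    unfolding pint_def using assms(1,2)
    by (intro nn_integral_cong) (simp add: powr_mult ennreal_mult' mult.assoc)
  then show ?thesis unfolding pint_def by (simp add: nn_integral_cmult)
qed

lemma pint_mono:
  assumes "\<And>x. 0 \<le> F x" "\<And>x. F x \<le> G x" "\<And>x. 0 \<le> w x" "0 \<le> q"
  shows "pint q w F \<le> pint q w G"
  unfolding pint_def using assms
  by (intro nn_integral_mono ennreal_leI mult_right_mono powr_mono2) auto

lemma A1_bound_mono:
  assumes "A1_bound A v" "A \<le> B" shows "A1_bound B v"
  unfolding A1_bound_def
proof (intro conjI allI impI)
  fix c and h :: real assume "0 < h"
  then have "AE x in lebesgue. x \<in> cub c h \<longrightarrow> wmass v (cub c h) \<le> ennreal (A * v x) * emeasure lebesgue (cub c h)"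
    using assms by (simp add: A1_bound_def)
  then show "AE x in lebesgue. x \<in> cub c h \<longrightarrow> wmass v (cub c h) \<le> ennreal (B * v x) * emeasure lebesgue (cub c h)"
  proof eventually_elim
    case (elim x)
    have "0 \<le> v x" using assms by (simp add: A1_bound_def)
    then have "ennreal (A * v x) * emeasure lebesgue (cub c h) \<le> ennreal (B * v x) * emeasure lebesgue (cub c h)"
      using assms(2) by (intro mult_right_mono ennreal_leI) auto
    then show ?case using elim by (meson order_trans)
  qed
qed (use assms in \<open>auto simp: A1_bound_def\<close>)

lemma rdf_const_pos: "0 < rdf_const n q k"
  by (simp add: rdf_const_def)

text \<open>The weight is \<open>W = H powr (1 - q0) * V\<close> with majorants \<open>H\<close> of
  \<open>F\<close> and \<open>V\<close> of \<kappa>. It gives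
  \<open>F powr q0 * W \<le> H * V\<close>, and the integral of \<open>H * V\<close> is bounded by
  duality. It is in the class of index \<open>q0\<close> by factorization, for any relation between
  \<open>q\<close> and \<open>q0\<close>.\<close>

lemma extrapolation_weight:
  fixes u s F \<kappa> :: "real ^ 'n \<Rightarrow> real"
  assumes q0: "1 \<le> q0" and dp: "dual_pair q k u s"
    and [measurable]: "F \<in> borel_measurable lebesgue" "\<kappa> \<in> borel_measurable lebesgue"
    and nn: "\<And>x. 0 \<le> F x" "\<And>x. 0 \<le> \<kappa> x"
    and F: "pint q u F \<le> 1" "(\<integral>\<^sup>+x. ennreal (F x) \<partial>lebesgue) \<noteq> 0"
    and \<kappa>: "pint (q / (q - 1)) s \<kappa> \<le> 1" "(\<integral>\<^sup>+x. ennreal (\<kappa> x) \<partial>lebesgue) \<noteq> 0"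
  defines "A \<equiv> max (rdf_const CARD('n) q k) (rdf_const CARD('n) (q / (q - 1)) k)"
    and "B \<equiv> 2 powr q * 2 + 2 powr (q / (q - 1)) * 2"
  obtains W where "W \<in> Muckenhoupt q0" "Ap_const q0 W \<le> ennreal (A powr q0)" "pint q0 W F \<le> ennreal B"
    "\<And>G. G \<in> borel_measurable lebesgue \<Longrightarrow> (\<And>x. 0 \<le> G x) \<Longrightarrow>
        (\<integral>\<^sup>+x. ennreal (G x * \<kappa> x) \<partial>lebesgue) \<le> pint q0 W G + ennreal B"
proof -
  let ?q = "q / (q - 1)"
  have [measurable]: "u \<in> borel_measurable lebesgue" "s \<in> borel_measurable lebesgue"
    and q: "1 < q" and unn: "\<And>x. 0 \<le> u x" and snn: "\<And>x. 0 \<le> s x"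
    and us: "AE x in lebesgue. u x powr (1 / q) * s x powr (1 - 1 / q) = 1"
    using dp by (auto simp: dual_pair_def regular_weight_def)
  have A0: "0 < A" using rdf_const_pos by (auto simp: A_def less_max_iff_disj)
  have "(\<integral>\<^sup>+x. epowr (ennreal (F x)) q * ennreal (u x) \<partial>lebesgue) \<le> 1"
    using F(1) nn unn by (simp add: pint_def epowr_ennreal ennreal_mult)
  from rubio_de_francia[OF dp _ this F(2)]
  obtain H where H: "A1_bound (rdf_const CARD('n) q k) H" "AE x in lebesgue. ennreal (F x) \<le> ennreal (H x)"
     "pint q u H \<le> ennreal (2 powr q * 2)" unfolding pint_def by auto
  have "(\<integral>\<^sup>+x. epowr (ennreal (\<kappa> x)) ?q * ennreal (s x) \<partial>lebesgue) \<le> 1"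
    using \<kappa>(1) nn snn by (simp add: pint_def epowr_ennreal ennreal_mult)
  from rubio_de_francia[OF dual_pair_sym[OF dp] _ this \<kappa>(2)]
  obtain V where V: "A1_bound (rdf_const CARD('n) ?q k) V" "AE x in lebesgue. ennreal (\<kappa> x) \<le> ennreal (V x)"
     "pint ?q s V \<le> ennreal (2 powr ?q * 2)" unfolding pint_def by auto
  have [measurable]: "H \<in> borel_measurable lebesgue" "V \<in> borel_measurable lebesgue"
    and HV0: "AE x in lebesgue. 0 < H x" "AE x in lebesgue. 0 < V x"
    using H(1) V(1) by (auto simp: A1_bound_def)
  have "A1_bound A H" "A1_bound A V"
    using H(1) V(1) by (auto simp: A_def intro: A1_bound_mono)
  note W = A1_factorization[OF this A0 q0]
  let ?W = "\<lambda>x. H x powr (1 - q0) * V x"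
  have HV: "(\<integral>\<^sup>+x. ennreal (H x * V x) \<partial>lebesgue) \<le> ennreal B"
  proof -
    \<comment> \<open>Young's inequality after inserting the factor
      \<open>u powr (1/q) * s powr (1 - 1/q) = 1\<close>; \<open>B\<close> is the sum of the two
      bounds from the Rubio de Francia construction.\<close>
    have "(\<integral>\<^sup>+x. ennreal (H x * V x) \<partial>lebesgue) \<le> (\<integral>\<^sup>+x. ennreal (H x powr q * u x) + ennreal (V x powr ?q * s x) \<partial>lebesgue)"
      using HV0 us
    proof (intro nn_integral_mono_AE, eventually_elim)
      case (elim x)
      have e: "?q * (1 - 1/q) = 1" using q by (simp add: field_simps)
      have "H x * V x = H x * V x * (u x powr (1 / q) * s x powr (1 - 1 / q))" using elim by simp
      also have "\<dots> = (H x powr q * u x) powr (1/q) * (V x powr ?q * s x) powr (1 - 1/q)"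
        using elim q unn snn by (simp only: powr_mult powr_powr e) (simp add: mult_ac)
      also have "\<dots> \<le> (1/q) * (H x powr q * u x) + (1 - 1/q) * (V x powr ?q * s x)"
        by (rule young_powr) (use q unn snn in auto)
      also have "\<dots> \<le> 1 * (H x powr q * u x) + 1 * (V x powr ?q * s x)"
        using q unn snn by (intro add_mono mult_right_mono) auto
      finally show ?case using unn snn by (simp add: ennreal_leI flip: ennreal_plus)
    qed
    also have "\<dots> = pint q u H + pint ?q s V" unfolding pint_def by (rule nn_integral_add) measurable
    also have "\<dots> \<le> ennreal (2 powr q * 2) + ennreal (2 powr ?q * 2)" by (intro add_mono H V)
    also have "\<dots> = ennreal B" by (simp add: B_def)
    finally show ?thesis .
  qed
  have "pint q0 ?W F \<le> (\<integral>\<^sup>+x. ennreal (H x * V x) \<partial>lebesgue)"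
    unfolding pint_def using HV0 H(2)
  proof (intro nn_integral_mono_AE, eventually_elim)
    case (elim x)
    have "F x powr q0 \<le> H x powr q0" using elim nn q0 by (intro powr_mono2) auto
    then have "F x powr q0 * ?W x \<le> H x powr q0 * ?W x" using elim by (intro mult_right_mono) auto
    also have "\<dots> = H x * V x" using elim powr_add[of "H x" q0 "1 - q0"] by simp
    finally show ?case by (rule ennreal_leI)
  qed
  then have WF: "pint q0 ?W F \<le> ennreal B" using HV by (rule order_trans)
  have WG: "(\<integral>\<^sup>+x. ennreal (G x * \<kappa> x) \<partial>lebesgue) \<le> pint q0 ?W G + ennreal B"
    if [measurable]: "G \<in> borel_measurable lebesgue" and G: "\<And>x. 0 \<le> G x" for G
  proof -
    have "(\<integral>\<^sup>+x. ennreal (G x * \<kappa> x) \<partial>lebesgue) \<le> (\<integral>\<^sup>+x. ennreal (G x powr q0 * ?W x) + ennreal (H x * V x) \<partial>lebesgue)"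
      using HV0 V(2)
    proof (intro nn_integral_mono_AE, eventually_elim)
      case (elim x)
      \<comment> \<open>Where \<open>G \<le> H\<close> the second term suffices. Elsewhere
        \<open>G powr (1 - q0) \<le> H powr (1 - q0)\<close>, as \<open>q0 \<ge> 1\<close>.\<close>
      have "G x \<le> G x powr q0 * H x powr (1 - q0) + H x"
      proof (cases "G x \<le> H x")
        case False
        then have "G x = G x powr q0 * G x powr (1 - q0)" using elim powr_add[of "G x" q0 "1 - q0"] by simp
        also have "\<dots> \<le> G x powr q0 * H x powr (1 - q0)"
          using False elim q0 by (intro mult_left_mono powr_mono2') auto
        finally show ?thesis using elim by simp
      qed (simp add: add_increasing)
      then have "G x * V x \<le> (G x powr q0 * H x powr (1 - q0) + H x) * V x"
        using elim by (intro mult_right_mono) auto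
      moreover have "G x * \<kappa> x \<le> G x * V x" using elim G nn by (intro mult_left_mono) auto
      ultimately have "G x * \<kappa> x \<le> G x powr q0 * ?W x + H x * V x" by (simp add: algebra_simps)
      then show ?case using elim by (simp add: ennreal_leI flip: ennreal_plus)
    qed
    also have "\<dots> = pint q0 ?W G + (\<integral>\<^sup>+x. ennreal (H x * V x) \<partial>lebesgue)"
      unfolding pint_def by (rule nn_integral_add) measurable
    also have "\<dots> \<le> pint q0 ?W G + ennreal B" by (intro add_left_mono HV)
    finally show ?thesis .
  qed
  show thesis by (rule that[OF W WF WG])
qed

text \<open>The converse of Hoelder's inequality. The extremal test function needs a finite norm, so
  it is formed from truncations of \<open>G\<close> in height and in space. Test functions that
  vanish almost everywhere are excluded because they have no positive majorant in
  \<open>rubio_de_francia\<close>.\<close>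

lemma pint_le_dual:
  fixes u s G :: "real ^ 'n \<Rightarrow> real"
  assumes dp: "dual_pair q k u s" and [measurable]: "G \<in> borel_measurable lebesgue" and nn: "\<And>x. 0 \<le> G x"
    and R: "0 \<le> R"
    and test: "\<And>\<kappa>. \<kappa> \<in> borel_measurable lebesgue \<Longrightarrow> (\<And>x. 0 \<le> \<kappa> x) \<Longrightarrow> pint (q / (q - 1)) s \<kappa> \<le> 1 \<Longrightarrow>
       (\<integral>\<^sup>+x. ennreal (\<kappa> x) \<partial>lebesgue) \<noteq> 0 \<Longrightarrow> (\<integral>\<^sup>+x. ennreal (G x * \<kappa> x) \<partial>lebesgue) \<le> ennreal R"
  shows "pint q u G \<le> ennreal (R powr q)"
proof -
  let ?q = "q / (q - 1)"
  have [measurable]: "u \<in> borel_measurable lebesgue" "s \<in> borel_measurable lebesgue"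
    and q: "1 < q" and unn: "\<And>x. 0 \<le> u x" and snn: "\<And>x. 0 \<le> s x" and ru: "regular_weight u"
    and u0: "AE x in lebesgue. 0 < u x" and s0: "AE x in lebesgue. 0 < s x"
    and us: "AE x in lebesgue. u x powr (1 / q) * s x powr (1 - 1 / q) = 1"
    using dp by (auto simp: dual_pair_def regular_weight_def)
  define g where "g j x = min (G x) (2 ^ j) * indicator (cub 0 (2 ^ j * 1)) x" for j :: nat and x
  have gm [measurable]: "g j \<in> borel_measurable lebesgue" for j unfolding g_def[abs_def] by measurable
  have g0: "0 \<le> g j x" and gG: "g j x \<le> G x" for j x using nn by (auto simp: g_def indicator_def)
  have gmono: "g i x \<le> g j x" if "i \<le> j" for i j x
  proof -
    have "(2::real) ^ i \<le> 2 ^ j" using that by (intro power_increasing) auto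
    moreover from this have "min (G x) (2 ^ i) \<le> min (G x) (2 ^ j)" by (intro min.mono) auto
    ultimately show ?thesis using nn[of x] cub_mono[of "2 ^ i * 1" "2 ^ j * 1" "0::real^'n"]
      by (auto simp: g_def indicator_def subset_iff)
  qed
  have fin: "pint q u (g j) \<le> ennreal (R powr q)" for j
  proof -
    have "pint q u (g j) \<le> (\<integral>\<^sup>+x. ennreal ((2 ^ j) powr q) * (ennreal (u x) * indicator (cub 0 (2 ^ j * 1)) x) \<partial>lebesgue)"
      unfolding pint_def
    proof (intro nn_integral_mono)
      fix x
      have "g j x powr q \<le> (2 ^ j) powr q" using g0 nn q by (intro powr_mono2) (auto simp: g_def indicator_def)
      then have "g j x powr q * u x \<le> (2 ^ j) powr q * u x" using unn by (intro mult_right_mono) auto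
      then show "ennreal (g j x powr q * u x) \<le> ennreal ((2 ^ j) powr q) * (ennreal (u x) * indicator (cub 0 (2 ^ j * 1)) x)"
        using unn by (auto simp: indicator_def g_def ennreal_mult[symmetric] intro!: ennreal_leI)
    qed
    also have "\<dots> = ennreal ((2 ^ j) powr q) * wmass u (cub 0 (2 ^ j * 1))"
      unfolding wmass_def by (rule nn_integral_cmult) measurable
    also have "\<dots> < top" using ru by (auto simp: ennreal_mult_less_top regular_weight_def)
    finally obtain I where I: "pint q u (g j) = ennreal I" "0 \<le> I" by (cases "pint q u (g j)") auto
    show ?thesis
    proof (cases "I = 0")
      case False
      then have I0: "0 < I" using I by simp
      \<comment> \<open>The extremal function in Hoelder's inequality; since
        \<open>u powr q' * s = u\<close>, the factor in front normalizes it in the dual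
        space.\<close>
      define \<kappa> where "\<kappa> x = I powr (-1/?q) * (g j x powr (q - 1) * u x)" for x
      have [measurable]: "\<kappa> \<in> borel_measurable lebesgue" unfolding \<kappa>_def[abs_def] by measurable
      have \<kappa>0: "0 \<le> \<kappa> x" for x using unn by (simp add: \<kappa>_def)
      have "pint ?q s \<kappa> = (\<integral>\<^sup>+x. ennreal (1/I) * ennreal (g j x powr q * u x) \<partial>lebesgue)"
        unfolding pint_def using u0 s0 us
      proof (intro nn_integral_cong_AE, eventually_elim)
        case (elim x)
        have w: "u x = s x powr (1 - q)" using powr_dual_eq[of "u x" "s x" q] elim q by simp
        have "u x powr ?q * s x = s x powr ((1 - q) * ?q + 1)"
          using elim by (simp add: w powr_powr powr_add)
        also have "(1 - q) * ?q + 1 = 1 - q" using q by (simp add: field_simps)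
        finally have us': "u x powr ?q * s x = u x" using w by simp
        have "-1/?q * ?q = -1" using q by (simp add: field_simps)
        then have "(I powr (-1/?q)) powr ?q = 1 / I" using I0 by (simp only: powr_powr) (simp add: powr_minus divide_inverse)
        moreover have "(g j x powr (q - 1)) powr ?q = g j x powr q" using q by (simp add: powr_powr)
        ultimately have "\<kappa> x powr ?q * s x = 1 / I * (g j x powr q * (u x powr ?q * s x))"
          using unn by (simp add: \<kappa>_def powr_mult)
        then have "\<kappa> x powr ?q * s x = 1 / I * (g j x powr q * u x)" by (simp only: us')
        moreover have "0 \<le> 1 / I" using I0 by simp
        ultimately show ?case by (simp only: ennreal_mult'[symmetric])
      qed
      also have "\<dots> = ennreal (1/I) * pint q u (g j)" unfolding pint_def by (rule nn_integral_cmult) measurable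
      also have "\<dots> = 1" using I I0 by (simp flip: ennreal_mult)
      finally have 1: "pint ?q s \<kappa> \<le> 1" by simp
      have "ennreal (I powr (1/q)) = ennreal (I powr (-1/?q)) * pint q u (g j)"
      proof -
        have "1/q = -1/?q + 1" using q by (simp add: field_simps)
        then have "I powr (1/q) = I powr (-1/?q) * I" using I0 by (simp only: powr_add) simp
        then show ?thesis using I by (simp only: ennreal_mult'[symmetric] powr_ge_zero)
      qed
      also have "\<dots> = (\<integral>\<^sup>+x. ennreal (I powr (-1/?q)) * ennreal (g j x powr q * u x) \<partial>lebesgue)"
        unfolding pint_def by (rule nn_integral_cmult[symmetric]) measurable
      also have "\<dots> \<le> (\<integral>\<^sup>+x. ennreal (G x * \<kappa> x) \<partial>lebesgue)"
      proof (intro nn_integral_mono)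
        fix x
        have "g j x powr q = g j x * g j x powr (q - 1)" 
          using powr_add[of "g j x" 1 "q - 1"] g0[of j x] by (cases "g j x = 0") auto
        also have "\<dots> \<le> G x * g j x powr (q - 1)" using gG by (intro mult_right_mono) auto
        finally have "g j x powr q * u x \<le> G x * g j x powr (q - 1) * u x" using unn by (intro mult_right_mono) auto
        then have "I powr (-1/?q) * (g j x powr q * u x) \<le> I powr (-1/?q) * (G x * g j x powr (q - 1) * u x)"
          by (intro mult_left_mono) auto
        also have "\<dots> = G x * \<kappa> x" by (simp add: \<kappa>_def mult_ac)
        finally show "ennreal (I powr (-1/?q)) * ennreal (g j x powr q * u x) \<le> ennreal (G x * \<kappa> x)"
          by (subst ennreal_mult'[symmetric]) (auto intro: ennreal_leI)
      qed
      finally have 2: "ennreal (I powr (1/q)) \<le> (\<integral>\<^sup>+x. ennreal (G x * \<kappa> x) \<partial>lebesgue)" .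
      have "(\<integral>\<^sup>+x. ennreal (\<kappa> x) \<partial>lebesgue) \<noteq> 0"
      proof
        assume "(\<integral>\<^sup>+x. ennreal (\<kappa> x) \<partial>lebesgue) = 0"
        then have "AE x in lebesgue. ennreal (\<kappa> x) = 0" by (subst (asm) nn_integral_0_iff_AE) auto
        then have "AE x in lebesgue. ennreal (G x * \<kappa> x) = 0"
          by eventually_elim (use \<kappa>0 nn in \<open>auto simp: ennreal_mult\<close>)
        then have "(\<integral>\<^sup>+x. ennreal (G x * \<kappa> x) \<partial>lebesgue) = 0" by (subst nn_integral_0_iff_AE) auto
        then show False using 2 I0 by simp
      qed
      from test[OF _ \<kappa>0 1 this] have "ennreal (I powr (1/q)) \<le> ennreal R" using 2 by (auto intro: order_trans)
      then have "I powr (1/q) \<le> R" using R by (simp add: ennreal_le_iff)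
      then have "(I powr (1/q)) powr q \<le> R powr q" using q by (intro powr_mono2) auto
      then show ?thesis using I q I0 by (simp add: powr_powr ennreal_leI)
    qed (use I in simp)
  qed
  have "pint q u G \<le> (\<integral>\<^sup>+x. (SUP j. ennreal (g j x powr q * u x)) \<partial>lebesgue)"
    unfolding pint_def
  proof (intro nn_integral_mono)
    fix x :: "real ^ 'n"
    obtain j1 :: nat where j1: "x \<in> cub 0 (2 ^ j1 * 1)" using ex_cub[of 1 x 0] by auto
    obtain j2 :: nat where j2: "G x < 2 ^ j2" using real_arch_pow[of 2 "G x"] by auto
    have "g (max j1 j2) x = G x"
    proof -
      have "(2::real) ^ j1 \<le> 2 ^ max j1 j2" "(2::real) ^ j2 \<le> 2 ^ max j1 j2" by (auto intro: power_increasing)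
      moreover from this have "min (G x) (2 ^ max j1 j2) = G x" using j2 by (intro min_absorb1) linarith
      ultimately show ?thesis using j1 cub_mono[of "2 ^ j1 * 1" "2 ^ max j1 j2 * 1" 0]
        by (auto simp: g_def indicator_def subset_iff)
    qed
    then show "ennreal (G x powr q * u x) \<le> (SUP j. ennreal (g j x powr q * u x))"
      by (intro SUP_upper2[of "max j1 j2"]) auto
  qed
  also have "\<dots> = (SUP j. pint q u (g j))"
    unfolding pint_def
  proof (rule nn_integral_monotone_convergence_SUP)
    show "incseq (\<lambda>j x. ennreal (g j x powr q * u x))"
      unfolding incseq_def le_fun_def using gmono g0 unn q
      by (intro allI impI ennreal_leI mult_right_mono powr_mono2) auto
  qed measurable
  also have "\<dots> \<le> ennreal (R powr q)" by (intro SUP_least fin)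
  finally show ?thesis .
qed


text \<open>After \<open>F\<close> is normalized, every dual test function for \<open>G\<close> gets
  its own weight \<open>W\<close>, at which the hypothesis gives the bound
  \<open>(C + 1) * B\<close>; homogeneity restores the norm of \<open>F\<close>. The hypothesis is
  required only for weights with constant at most \<open>K\<close>, and \<open>K\<close> does not
  depend on \<open>F\<close> or \<open>G\<close>.\<close>

theorem extrapolation:
  fixes u s F :: "real ^ 'n \<Rightarrow> real"
  assumes q0: "1 \<le> q0" and dp: "dual_pair q k u s"
    and [measurable]: "F \<in> borel_measurable lebesgue" and nn: "\<And>x. 0 \<le> F x" and F: "pint q u F < top"
  defines "K \<equiv> max (rdf_const CARD('n) q k) (rdf_const CARD('n) (q / (q - 1)) k) powr q0"
    and "B \<equiv> 2 powr q * 2 + 2 powr (q / (q - 1)) * 2"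
  shows "\<exists>W\<in>Muckenhoupt q0. pint q0 W F < top"
    and "\<And>G C. G \<in> borel_measurable lebesgue \<Longrightarrow> (\<And>x. 0 \<le> G x) \<Longrightarrow> 0 \<le> C \<Longrightarrow>
       (\<And>W. W \<in> Muckenhoupt q0 \<Longrightarrow> Ap_const q0 W \<le> ennreal K \<Longrightarrow> pint q0 W F < top \<Longrightarrow>
          pint q0 W G \<le> ennreal C * pint q0 W F) \<Longrightarrow>
       pint q u G \<le> ennreal (((C + 1) * B) powr q) * pint q u F"
proof -
  let ?q = "q / (q - 1)"
  have [measurable]: "u \<in> borel_measurable lebesgue" "s \<in> borel_measurable lebesgue"
    and q: "1 < q" and unn: "\<And>x. 0 \<le> u x" and ru: "regular_weight u" and rs: "regular_weight s"
    using dp by (auto simp: dual_pair_def regular_weight_def)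
  have q': "1 < ?q" using q by simp
  let ?Q = "cub 0 1 :: (real ^ 'n) set"
  obtain m where m: "wmass u ?Q = ennreal m" "0 < m" using regular_weight_massE[OF ru, of 1 0] by auto
  obtain Y where Y: "pint q u F = ennreal Y" "0 \<le> Y" using F by (cases "pint q u F") auto
  have B0: "0 < B" by (simp add: B_def add_pos_pos)
  \<comment> \<open>\<open>F\<close> is enlarged on a cube by a small constant, so that its Rubio de Francia majorant is a weight
    even if \<open>F = 0\<close>.\<close>
  define \<eta> where "\<eta> \<epsilon> = (\<epsilon> / m) powr (1/q)" for \<epsilon>
  define N where "N \<epsilon> = (Y + \<epsilon>) powr (1/q)" for \<epsilon>
  define F' where "F' \<epsilon> x = 1 / N \<epsilon> * max (F x) (\<eta> \<epsilon> * indicator ?Q x)" for \<epsilon> x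
  have [measurable]: "F' \<epsilon> \<in> borel_measurable lebesgue" for \<epsilon> unfolding F'_def[abs_def] by measurable
  have Npos: "0 < N \<epsilon>" if "0 < \<epsilon>" for \<epsilon> using that Y by (simp add: N_def)
  have F'0: "0 \<le> F' \<epsilon> x" if "0 < \<epsilon>" for \<epsilon> x using Npos[OF that] nn by (simp add: F'_def max.coboundedI1)
  have FF': "F x \<le> N \<epsilon> * F' \<epsilon> x" if "0 < \<epsilon>" for \<epsilon> x using Npos[OF that] by (simp add: F'_def)
  have F'1: "pint q u (F' \<epsilon>) \<le> 1" if \<epsilon>: "0 < \<epsilon>" for \<epsilon>
  proof -
    have "pint q u (F' \<epsilon>) = ennreal ((1 / N \<epsilon>) powr q) * pint q u (\<lambda>x. max (F x) (\<eta> \<epsilon> * indicator ?Q x))"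
      unfolding F'_def using Npos[OF \<epsilon>] nn by (intro pint_cmult) (auto simp: max.coboundedI1)
    also have "pint q u (\<lambda>x. max (F x) (\<eta> \<epsilon> * indicator ?Q x)) \<le>
        (\<integral>\<^sup>+x. ennreal (F x powr q * u x) + ennreal (\<eta> \<epsilon> powr q) * (ennreal (u x) * indicator ?Q x) \<partial>lebesgue)"
      unfolding pint_def
    proof (intro nn_integral_mono)
      fix x
      have "max (F x) (\<eta> \<epsilon> * indicator ?Q x) powr q \<le> F x powr q + \<eta> \<epsilon> powr q * indicator ?Q x"
        by (auto simp: max_def indicator_def)
      then have "max (F x) (\<eta> \<epsilon> * indicator ?Q x) powr q * u x \<le> (F x powr q + \<eta> \<epsilon> powr q * indicator ?Q x) * u x"
        using unn by (intro mult_right_mono)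
      also have "\<dots> = F x powr q * u x + \<eta> \<epsilon> powr q * (u x * indicator ?Q x)" by (simp add: algebra_simps)
      finally have "ennreal (max (F x) (\<eta> \<epsilon> * indicator ?Q x) powr q * u x) \<le> ennreal (F x powr q * u x + \<eta> \<epsilon> powr q * (u x * indicator ?Q x))"
        by (rule ennreal_leI)
      also have "\<dots> = ennreal (F x powr q * u x) + ennreal (\<eta> \<epsilon> powr q) * (ennreal (u x) * indicator ?Q x)"
        using unn by (auto simp: indicator_def ennreal_mult)
      finally show "ennreal (max (F x) (\<eta> \<epsilon> * indicator ?Q x) powr q * u x) \<le> ennreal (F x powr q * u x) + ennreal (\<eta> \<epsilon> powr q) * (ennreal (u x) * indicator ?Q x)" .
    qed
    also have "\<dots> = pint q u F + (\<integral>\<^sup>+x. ennreal (\<eta> \<epsilon> powr q) * (ennreal (u x) * indicator ?Q x) \<partial>lebesgue)"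
      unfolding pint_def by (rule nn_integral_add) measurable
    also have "(\<integral>\<^sup>+x. ennreal (\<eta> \<epsilon> powr q) * (ennreal (u x) * indicator ?Q x) \<partial>lebesgue) = ennreal (\<eta> \<epsilon> powr q) * wmass u ?Q"
      unfolding wmass_def by (rule nn_integral_cmult) measurable
    \<comment> \<open>\<eta> is chosen so that the added piece contributes exactly \<epsilon>, which
      matches the \<epsilon> in \<open>N\<close>.\<close>
    also have "\<eta> \<epsilon> powr q = \<epsilon> / m" using \<epsilon> m q by (simp add: \<eta>_def powr_powr)
    also have "ennreal (\<epsilon> / m) * wmass u ?Q = ennreal \<epsilon>" using \<epsilon> m by (simp flip: ennreal_mult)
    also have "pint q u F + ennreal \<epsilon> = ennreal (Y + \<epsilon>)" using Y \<epsilon> by simp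
    finally have "pint q u (F' \<epsilon>) \<le> ennreal ((1 / N \<epsilon>) powr q) * ennreal (Y + \<epsilon>)"
      by (simp add: mult_left_mono)
    also have "(1 / N \<epsilon>) powr q = 1 / (Y + \<epsilon>)" using \<epsilon> Y q by (simp add: N_def powr_divide powr_powr)
    also have "ennreal (1 / (Y + \<epsilon>)) * ennreal (Y + \<epsilon>) = 1"
      using \<epsilon> Y by (subst ennreal_mult[symmetric]) auto
    finally show ?thesis .
  qed
  have F'2: "(\<integral>\<^sup>+x. ennreal (F' \<epsilon> x) \<partial>lebesgue) \<noteq> 0" if \<epsilon>: "0 < \<epsilon>" for \<epsilon>
  proof
    assume "(\<integral>\<^sup>+x. ennreal (F' \<epsilon> x) \<partial>lebesgue) = 0"
    then have "AE x in lebesgue. ennreal (F' \<epsilon> x) = 0" by (subst (asm) nn_integral_0_iff_AE) auto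
    then have "AE x in lebesgue. x \<notin> ?Q"
    proof eventually_elim
      case (elim x)
      have "0 < \<eta> \<epsilon>" using \<epsilon> m by (simp add: \<eta>_def)
      then have "x \<in> ?Q \<Longrightarrow> 0 < F' \<epsilon> x" using Npos[OF \<epsilon>] by (simp add: F'_def less_max_iff_disj)
      then show ?case using elim by (auto simp: ennreal_eq_0_iff)
    qed
    then have "emeasure lebesgue ?Q = 0"
      by (subst (asm) AE_iff_measurable[OF _ refl]) auto
    then show False by (subst (asm) emeasure_cub) auto
  qed
  note weight = extrapolation_weight[OF q0 dp _ _ _ _ F'1 F'2, folded K_def B_def]
  have Ffin: "pint q0 W F \<le> ennreal (N \<epsilon> powr q0) * pint q0 W (F' \<epsilon>)" if \<epsilon>: "0 < \<epsilon>" and W: "W \<in> Muckenhoupt q0" for \<epsilon> W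
  proof -
    have rW: "regular_weight W" using W by (rule Muckenhoupt_regular)
    have "pint q0 W F \<le> pint q0 W (\<lambda>x. N \<epsilon> * F' \<epsilon> x)"
      using rW q0 nn FF'[OF \<epsilon>] by (intro pint_mono) (auto simp: regular_weight_def)
    also have "\<dots> = ennreal (N \<epsilon> powr q0) * pint q0 W (F' \<epsilon>)"
      using rW Npos[OF \<epsilon>] F'0[OF \<epsilon>] by (intro pint_cmult) (auto simp: regular_weight_def)
    finally show ?thesis .
  qed
  show "\<exists>W\<in>Muckenhoupt q0. pint q0 W F < top"
  proof -
    obtain m' where m': "wmass s ?Q = ennreal m'" "0 < m'" using regular_weight_massE[OF rs, of 1 0] by auto
    \<comment> \<open>Any normalized nonzero test function would do for the existence of a weight;
      here it is a multiple of the indicator of the unit cube.\<close>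
    define \<kappa> where "\<kappa> x = (1/m') powr (1/?q) * indicator ?Q x" for x :: "real ^ 'n"
    have [measurable]: "\<kappa> \<in> borel_measurable lebesgue" unfolding \<kappa>_def[abs_def] by measurable
    have "pint ?q s \<kappa> = (\<integral>\<^sup>+x. ennreal (1/m') * (ennreal (s x) * indicator ?Q x) \<partial>lebesgue)"
      unfolding pint_def
    proof (intro nn_integral_cong)
      fix x
      have "\<kappa> x powr ?q * s x = 1/m' * (s x * indicator ?Q x)"
        using m' q q' by (auto simp: \<kappa>_def powr_powr indicator_def)
      then show "ennreal (\<kappa> x powr ?q * s x) = ennreal (1/m') * (ennreal (s x) * indicator ?Q x)"
        using m' by (auto simp: indicator_def simp flip: ennreal_mult')
    qed
    also have "\<dots> = ennreal (1/m') * wmass s ?Q" unfolding wmass_def by (rule nn_integral_cmult) measurable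
    also have "\<dots> = 1" using m' by (simp flip: ennreal_mult)
    finally have \<kappa>1: "pint ?q s \<kappa> \<le> 1" by simp
    have "(\<integral>\<^sup>+x. ennreal (\<kappa> x) \<partial>lebesgue) = (\<integral>\<^sup>+x. ennreal ((1/m') powr (1/?q)) * indicator ?Q x \<partial>lebesgue)"
      by (intro nn_integral_cong) (auto simp: \<kappa>_def indicator_def)
    also have "\<dots> = ennreal ((1/m') powr (1/?q)) * emeasure lebesgue ?Q" by (rule nn_integral_cmult_indicator) simp
    also have "\<dots> \<noteq> 0" using m' by (subst emeasure_cub) auto
    finally have \<kappa>2: "(\<integral>\<^sup>+x. ennreal (\<kappa> x) \<partial>lebesgue) \<noteq> 0" .
    obtain W where W: "W \<in> Muckenhoupt q0" "pint q0 W (F' 1) \<le> ennreal B"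
      by (rule weight[of 1 \<kappa>]) (use \<kappa>1 \<kappa>2 F'0 in \<open>auto simp: \<kappa>_def\<close>)
    have "pint q0 W F \<le> ennreal (N 1 powr q0) * pint q0 W (F' 1)" using Ffin W by simp
    also have "\<dots> \<le> ennreal (N 1 powr q0) * ennreal B" by (intro mult_left_mono W) simp
    also have "\<dots> < top" by (simp add: ennreal_mult_less_top)
    finally show ?thesis using W by blast
  qed
  fix G C assume [measurable]: "G \<in> borel_measurable lebesgue" and G: "\<And>x. 0 \<le> G x" and C: "0 \<le> (C::real)"
    and hyp: "\<And>W. W \<in> Muckenhoupt q0 \<Longrightarrow> Ap_const q0 W \<le> ennreal K \<Longrightarrow> pint q0 W F < top \<Longrightarrow>
          pint q0 W G \<le> ennreal C * pint q0 W F"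
  let ?R = "(C + 1) * B"
  have R0: "0 < ?R" using C B0 by simp
  have key: "pint q u G \<le> ennreal (?R powr q * (Y + \<epsilon>))" if \<epsilon>: "0 < \<epsilon>" for \<epsilon>
  proof -
    let ?N = "N \<epsilon>"
    have N: "0 < ?N" by (rule Npos[OF \<epsilon>])
    have "pint q u (\<lambda>x. 1 / ?N * G x) \<le> ennreal (?R powr q)"
    proof (rule pint_le_dual[OF dp])
      fix \<kappa> assume k: "\<kappa> \<in> borel_measurable lebesgue" "\<And>x. 0 \<le> \<kappa> x" "pint ?q s \<kappa> \<le> 1" "(\<integral>\<^sup>+x. ennreal (\<kappa> x) \<partial>lebesgue) \<noteq> 0"
      obtain W where W: "W \<in> Muckenhoupt q0" "Ap_const q0 W \<le> ennreal K" "pint q0 W (F' \<epsilon>) \<le> ennreal B"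
        and WG: "\<And>G. G \<in> borel_measurable lebesgue \<Longrightarrow> (\<And>x. 0 \<le> G x) \<Longrightarrow>
          (\<integral>\<^sup>+x. ennreal (G x * \<kappa> x) \<partial>lebesgue) \<le> pint q0 W G + ennreal B"
        by (rule weight[of \<epsilon> \<kappa>]) (use k \<epsilon> F'0[OF \<epsilon>] in auto)
      have rW: "regular_weight W" using W(1) by (rule Muckenhoupt_regular)
      have [measurable]: "W \<in> borel_measurable lebesgue" using rW by (simp add: regular_weight_def)
      have WF: "pint q0 W F \<le> ennreal (?N powr q0 * B)"
      proof -
        have "pint q0 W F \<le> ennreal (?N powr q0) * ennreal B"
          using Ffin[OF \<epsilon> W(1)] mult_left_mono[OF W(3), of "ennreal (?N powr q0)"] by (meson order_trans zero_le)
        then show ?thesis by (simp add: ennreal_mult')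
      qed
      then have "pint q0 W F < top" by (rule le_less_trans) simp
      then have "pint q0 W G \<le> ennreal C * pint q0 W F" by (intro hyp W)
      also have "\<dots> \<le> ennreal C * ennreal (?N powr q0 * B)" by (intro mult_left_mono WF) simp
      finally have "ennreal ((1/?N) powr q0) * pint q0 W G \<le> ennreal ((1/?N) powr q0) * (ennreal C * ennreal (?N powr q0 * B))"
        by (rule mult_left_mono) simp
      also have "\<dots> = ennreal ((1/?N) powr q0 * (C * (?N powr q0 * B)))"
        using C B0 by (simp add: ennreal_mult)
      also have "(1/?N) powr q0 * (C * (?N powr q0 * B)) = C * B" using N by (simp add: powr_divide)
      also have "ennreal ((1/?N) powr q0) * pint q0 W G = pint q0 W (\<lambda>x. 1 / ?N * G x)"
        using N G by (intro pint_cmult[symmetric]) auto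
      finally have "pint q0 W (\<lambda>x. 1 / ?N * G x) + ennreal B \<le> ennreal (C * B) + ennreal B"
        by (rule add_right_mono)
      also have "\<dots> = ennreal ?R" using C B0 by (simp add: algebra_simps flip: ennreal_plus)
      finally show "(\<integral>\<^sup>+x. ennreal (1 / ?N * G x * \<kappa> x) \<partial>lebesgue) \<le> ennreal ?R"
        using WG[of "\<lambda>x. 1 / ?N * G x"] N G by (auto intro: order_trans)
    qed (use N G R0 in auto)
    then have "ennreal ((1 / ?N) powr q) * pint q u G \<le> ennreal (?R powr q)"
      using N G by (subst (asm) pint_cmult) auto
    then have "ennreal (?N powr q) * (ennreal ((1 / ?N) powr q) * pint q u G) \<le> ennreal (?N powr q) * ennreal (?R powr q)"
      by (rule mult_left_mono) simp
    then have "pint q u G \<le> ennreal (?N powr q * ?R powr q)"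
      using N by (simp add: ennreal_mult_mult powr_divide ennreal_mult)
    also have "?N powr q = Y + \<epsilon>" using \<epsilon> Y q by (simp add: N_def powr_powr)
    finally show ?thesis by (simp add: mult.commute)
  qed
  \<comment> \<open>The auxiliary constant added to \<open>F\<close> disappears as \<epsilon> tends
    to zero.\<close>
  have "pint q u G \<le> ennreal (?R powr q * Y)"
  proof (rule ennreal_le_epsilon)
    fix e :: real assume e: "0 < e"
    have "pint q u G \<le> ennreal (?R powr q * (Y + e / ?R powr q))"
      by (rule key) (use e R0 in \<open>intro divide_pos_pos, auto\<close>)
    also have "?R powr q * (Y + e / ?R powr q) = ?R powr q * Y + e" using R0 C B0 by (simp add: field_simps)
    also have "ennreal \<dots> = ennreal (?R powr q * Y) + ennreal e" using Y e by simp
    finally show "pint q u G \<le> ennreal (?R powr q * Y) + ennreal e" .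
  qed
  then show "pint q u G \<le> ennreal (?R powr q) * pint q u F" using Y by (simp add: ennreal_mult)
qed

subsection \<open>Prescribing the Muckenhoupt constant\<close>

lemma nn_integral_cmult_le:
  assumes [measurable]: "g \<in> borel_measurable M" and "AE x in M. f x \<le> c * g x"
  shows "(\<integral>\<^sup>+x. f x \<partial>M) \<le> c * (\<integral>\<^sup>+x. g x \<partial>M)"
proof -
  have "(\<integral>\<^sup>+x. f x \<partial>M) \<le> (\<integral>\<^sup>+x. c * g x \<partial>M)" by (rule nn_integral_mono_AE[OF assms(2)])
  then show ?thesis by (simp add: nn_integral_cmult)
qed

lemma wmass_le_cmult:
  assumes [measurable]: "w \<in> borel_measurable lebesgue" "E \<in> sets lebesgue" and c: "0 \<le> c" and w: "\<And>x. 0 \<le> w x"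
    and le: "\<And>x. x \<in> E \<Longrightarrow> v x \<le> c * w x"
  shows "wmass v E \<le> ennreal c * wmass w E"
  unfolding wmass_def
proof (intro nn_integral_cmult_le AE_I2)
  fix x
  show "ennreal (v x) * indicator E x \<le> ennreal c * (ennreal (w x) * indicator E x)"
    using le[of x] c w by (auto simp: indicator_def simp flip: ennreal_mult intro!: ennreal_leI)
qed measurable

lemma avg_le_cmult:
  assumes "wmass v E \<le> ennreal c * wmass w E" shows "avg v E \<le> ennreal c * avg w E"
  using divide_right_mono_ennreal[OF assms, of "emeasure lebesgue E"] unfolding avg_def
  by (simp only: ennreal_times_divide)

text \<open>The factor \<open>b\<close> comes from the average of \<open>v\<close> and
  \<open>1 / a\<close> from the average of the dual weight, whose exponent is negative. For
  \<open>q = 1\<close>, each constant admissible for \<open>u\<close> becomes admissible for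
  \<open>v\<close> after multiplication by \<open>b / a\<close>.\<close>

lemma Ap_const_comparable:
  fixes u v :: "real ^ 'n \<Rightarrow> real"
  assumes q: "1 \<le> q" and [measurable]: "u \<in> borel_measurable lebesgue" and u: "\<And>x. 0 \<le> u x"
    and ab: "0 < a" "0 < b" and le: "\<And>x. a * u x \<le> v x" "\<And>x. v x \<le> b * u x"
  shows "Ap_const q v \<le> ennreal (b / a) * Ap_const q u"
proof (cases "q = 1")
  case True
  have step: "Ap_const 1 v \<le> ennreal (b / a * c)" 
    if c: "0 \<le> c" "\<forall>Q\<in>cubes. AE x in lebesgue. x \<in> Q \<longrightarrow> avg u Q \<le> ennreal (c * u x)" for c
  proof (rule Ap_const_one_le)
    show "0 \<le> b / a * c" using ab c by simp
    fix Q :: "(real ^ 'n) set" assume Q: "Q \<in> cubes"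
    then have [measurable]: "Q \<in> sets lebesgue" by (auto simp: cubes_eq)
    have "wmass v Q \<le> ennreal b * wmass u Q" using ab u le by (intro wmass_le_cmult) auto
    then have 1: "avg v Q \<le> ennreal b * avg u Q" by (rule avg_le_cmult)
    from c Q have "AE x in lebesgue. x \<in> Q \<longrightarrow> avg u Q \<le> ennreal (c * u x)" by blast
    then show "AE x in lebesgue. x \<in> Q \<longrightarrow> avg v Q \<le> ennreal (b / a * c * v x)"
    proof eventually_elim
      case (elim x)
      show ?case
      proof
        assume "x \<in> Q"
        then have "ennreal b * avg u Q \<le> ennreal b * ennreal (c * u x)" using elim by (intro mult_left_mono) auto
        also have "\<dots> = ennreal (b / a * c * (a * u x))" using ab c u by (simp flip: ennreal_mult)
        also have "\<dots> \<le> ennreal (b / a * c * v x)" using ab c le by (intro ennreal_leI mult_left_mono) auto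
        finally show "avg v Q \<le> ennreal (b / a * c * v x)" using 1 by (rule order_trans[rotated])
      qed
    qed
  qed
  \<comment> \<open>Scaling the left side instead of the infimum allows \<open>Inf_greatest\<close>
    to be applied directly.\<close>
  have "ennreal (a / b) * Ap_const 1 v \<le> Ap_const 1 u"
    unfolding Ap_const_def[of 1 u] if_P[OF refl]
  proof (rule Inf_greatest)
    fix z assume "z \<in> {ennreal c | c. 0 \<le> c \<and> (\<forall>Q\<in>cubes. AE x in lebesgue. x \<in> Q \<longrightarrow> avg u Q \<le> ennreal (c * u x))}"
    then obtain c where c: "z = ennreal c" "0 \<le> c" 
      "\<forall>Q\<in>cubes. AE x in lebesgue. x \<in> Q \<longrightarrow> avg u Q \<le> ennreal (c * u x)" by blast
    have "ennreal (a / b) * Ap_const 1 v \<le> ennreal (a / b) * ennreal (b / a * c)"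
      by (intro mult_left_mono step c) simp
    also have "\<dots> = z" using c ab by (simp flip: ennreal_mult)
    finally show "ennreal (a / b) * Ap_const 1 v \<le> z" .
  qed
  then have "ennreal (b / a) * (ennreal (a / b) * Ap_const 1 v) \<le> ennreal (b / a) * Ap_const 1 u"
    by (rule mult_left_mono) simp
  then show ?thesis using ab True by (simp add: ennreal_mult_mult)
next
  case False
  then have q1: "1 < q" using q by simp
  let ?e = "1 - conj_exponent q"
  have e: "?e < 0" "?e * (q - 1) = -1" unfolding dual_exponent[OF q1] using q1 by auto
  show ?thesis unfolding Ap_const_le_iff[OF q1]
  proof (intro allI impI)
    fix c :: "real ^ 'n" and h :: real assume h: "0 < h"
    let ?Q = "cub c h"
    have "wmass v ?Q \<le> ennreal b * wmass u ?Q" using ab u le by (intro wmass_le_cmult) auto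
    then have 1: "avg v ?Q \<le> ennreal b * avg u ?Q" by (rule avg_le_cmult)
    have "v x powr ?e \<le> a powr ?e * u x powr ?e" for x
    proof (cases "u x = 0")
      case True
      then have "v x = 0" using le[of x] by simp
      then show ?thesis using True by simp
    next
      case False
      then have "0 < a * u x" using ab u[of x] by (simp add: less_le)
      then have "v x powr ?e \<le> (a * u x) powr ?e" using le(1)[of x] e by (intro powr_mono2') auto
      then show ?thesis using ab u by (simp add: powr_mult)
    qed
    then have "wmass (\<lambda>x. v x powr ?e) ?Q \<le> ennreal (a powr ?e) * wmass (\<lambda>x. u x powr ?e) ?Q"
      by (intro wmass_le_cmult) auto
    then have "avg (\<lambda>x. v x powr ?e) ?Q \<le> ennreal (a powr ?e) * avg (\<lambda>x. u x powr ?e) ?Q" by (rule avg_le_cmult)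
    then have "epowr (avg (\<lambda>x. v x powr ?e) ?Q) (q - 1) \<le> epowr (ennreal (a powr ?e) * avg (\<lambda>x. u x powr ?e) ?Q) (q - 1)"
      using q1 by (intro epowr_mono) auto
    also have "\<dots> = ennreal (1 / a) * epowr (avg (\<lambda>x. u x powr ?e) ?Q) (q - 1)"
      using q1 ab e by (simp add: epowr_mult epowr_ennreal powr_powr powr_minus divide_inverse)
    finally have "avg v ?Q * epowr (avg (\<lambda>x. v x powr ?e) ?Q) (q - 1) \<le>
       (ennreal b * avg u ?Q) * (ennreal (1 / a) * epowr (avg (\<lambda>x. u x powr ?e) ?Q) (q - 1))"
      by (intro mult_mono 1) auto
    also have "\<dots> = (ennreal b * ennreal (1/a)) * (avg u ?Q * epowr (avg (\<lambda>x. u x powr ?e) ?Q) (q - 1))"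
      by (simp only: ac_simps)
    also have "ennreal b * ennreal (1/a) = ennreal (b / a)" using ab by (simp flip: ennreal_mult)
    also have "avg u ?Q * epowr (avg (\<lambda>x. u x powr ?e) ?Q) (q - 1) \<le> Ap_const q u"
      using Ap_const_le_iff[OF q1, of u "Ap_const q u"] h by simp
    finally show "avg v ?Q * epowr (avg (\<lambda>x. v x powr ?e) ?Q) (q - 1) \<le> ennreal (b / a) * Ap_const q u"
      by (simp add: mult_left_mono)
  qed
qed

lemma Muckenhoupt_comparable:
  fixes u v :: "real ^ 'n \<Rightarrow> real"
  assumes q: "1 \<le> q" and u: "u \<in> Muckenhoupt q" and [measurable]: "v \<in> borel_measurable lebesgue"
    and ab: "0 < a" "0 < b" and le: "\<And>x. a * u x \<le> v x" "\<And>x. v x \<le> b * u x"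
  shows "v \<in> Muckenhoupt q"
proof -
  have ru: "regular_weight u" using u by (rule Muckenhoupt_regular)
  then have [measurable]: "u \<in> borel_measurable lebesgue" and u0: "\<And>x. 0 \<le> u x" and up: "AE x in lebesgue. 0 < u x"
    by (auto simp: regular_weight_def)
  have v0: "0 \<le> v x" for x using le(1)[of x] ab u0[of x] by (meson less_imp_le mult_nonneg_nonneg order_trans)
  have "AE x in lebesgue. 0 < v x" using up
  proof eventually_elim
    case (elim x)
    then have "0 < a * u x" using ab by simp
    then show ?case using le(1)[of x] by linarith
  qed
  moreover have "wmass v (cub c h) < top" if "0 < h" for c h
  proof -
    have "wmass v (cub c h) \<le> ennreal b * wmass u (cub c h)" using ab u0 le by (intro wmass_le_cmult) auto
    also have "\<dots> < top" using ru that by (simp add: regular_weight_def ennreal_mult_less_top)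
    finally show ?thesis .
  qed
  ultimately have "regular_weight v" using v0 by (simp add: regular_weight_def)
  moreover have "Ap_const q v < top"
  proof -
    have "Ap_const q v \<le> ennreal (b / a) * Ap_const q u" by (rule Ap_const_comparable) (use q ab le u0 in auto)
    also have "\<dots> < top" using u by (simp add: Muckenhoupt_def ennreal_mult_less_top)
    finally show ?thesis .
  qed
  ultimately show ?thesis by (simp add: Muckenhoupt_def regular_weight_iff)
qed

lemma thick_real:
  fixes w :: "real ^ 'n \<Rightarrow> real"
  assumes w: "thick q (k powr (1/q)) w" and q: "0 < q" and k: "0 < k" and h: "0 < h" and E: "E \<in> sets lebesgue" "E \<subseteq> cub c h"
    and m: "wmass w (cub c h) = ennreal m" "0 \<le> m" "wmass w E = ennreal e" "0 \<le> e"
    and v: "emeasure lebesgue (cub c h) = ennreal v" "0 \<le> v" "emeasure lebesgue E = ennreal d" "0 \<le> d"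
  shows "d powr q * m \<le> k * v powr q * e"
proof -
  have "ennreal d * epowr (ennreal m) (1 / q) \<le> ennreal (k powr (1/q)) * ennreal v * epowr (ennreal e) (1 / q)"
    using w h E m v unfolding thick_def by metis
  then have "d * m powr (1/q) \<le> k powr (1/q) * v * e powr (1/q)"
    using m v by (simp add: epowr_ennreal flip: ennreal_mult)
  then have "(d * m powr (1/q)) powr q \<le> (k powr (1/q) * v * e powr (1/q)) powr q"
    using q v by (intro powr_mono2) auto
  then show ?thesis using q k m v by (simp add: powr_mult powr_powr)
qed

text \<open>
  Multiplying \<open>u\<close> by \<open>s \<ge> 1\<close> on a fixed subcube of a cube changes the constant continuously in \<open>s\<close> and
  makes it grow linearly, so the intermediate value theorem gives the prescribed value.
\<close>

lemma Muckenhoupt_prescribed_constant: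
  assumes q: "1 \<le> q" and K: "0 < K"
  obtains S where "1 \<le> S" "\<And>u :: real ^ 'n \<Rightarrow> real. u \<in> Muckenhoupt q \<Longrightarrow> Ap_const q u \<le> ennreal K \<Longrightarrow>
      \<exists>v\<in>Muckenhoupt q. Ap_const q v = ennreal K \<and> (\<forall>x. u x \<le> v x \<and> v x \<le> S * u x)"
proof -
  let ?n = "CARD('n)"
  define V where "V = ((2::real) ^ ?n) powr q"
  \<comment> \<open>One factor \<open>(K + 1) * V\<close> compares the masses of \<open>u\<close> on
    \<open>Q\<close> and \<open>E\<close>, the other would compare those of \<open>v S\<close> on
    \<open>Q\<close> and \<open>Q - E\<close> if the constant of \<open>v S\<close> were at most
    \<open>K\<close>. The 2 makes the two comparisons contradictory; \<open>V\<close> is the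
    \<open>q\<close>-th power of \<open>|Q|/|E|\<close>.\<close>
  define S where "S = 2 * ((K + 1) * (K + 1) * V * V)"
  have V1: "1 \<le> V" unfolding V_def using q by (intro ge_one_powr_ge_zero) auto
  have S1: "1 \<le> S"
  proof -
    have "1 * 1 * 1 * 1 \<le> (K + 1) * (K + 1) * V * V" using K V1 by (intro mult_mono) auto
    then show ?thesis by (simp add: S_def)
  qed
  have main: "\<exists>v\<in>Muckenhoupt q. Ap_const q v = ennreal K \<and> (\<forall>x. u x \<le> v x \<and> v x \<le> S * u x)"
    if u: "u \<in> Muckenhoupt q" and Ku: "Ap_const q u \<le> ennreal K" for u :: "real ^ 'n \<Rightarrow> real"
  proof -
    have ru: "regular_weight u" using u by (rule Muckenhoupt_regular)
    have [measurable]: "u \<in> borel_measurable lebesgue" and u0: "\<And>x. 0 \<le> u x"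
      using ru by (auto simp: regular_weight_def)
    define Q where "Q = (cub 0 1 :: (real ^ 'n) set)"
    define E where "E = (cub 0 (1/2) :: (real ^ 'n) set)"
    have [measurable]: "Q \<in> sets lebesgue" "E \<in> sets lebesgue" by (auto simp: Q_def E_def)
    have EQ: "E \<subseteq> Q" unfolding E_def Q_def by (rule cub_mono) simp
    define v where "v s x = u x * (if x \<in> E then s else 1)" for s :: real and x
    have [measurable]: "v s \<in> borel_measurable lebesgue" for s unfolding v_def[abs_def] by measurable
    have vst: "v s x \<le> v t x" "v t x \<le> t / s * v s x" if "1 \<le> s" "s \<le> t" for s t x
    proof -
      show "v s x \<le> v t x" using that u0 by (auto simp: v_def intro!: mult_left_mono)
      have "1 * u x \<le> t / s * u x" using that u0 by (intro mult_right_mono) auto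
      then show "v t x \<le> t / s * v s x" using that by (auto simp: v_def)
    qed
    have v1: "v 1 = u" by (auto simp: v_def)
    have vM: "v s \<in> Muckenhoupt q" if "1 \<le> s" for s
      using vst[of 1 s] that unfolding v1 by (intro Muckenhoupt_comparable[OF q u, of _ 1 s]) auto
    define g where "g s = enn2real (Ap_const q (v s))" for s
    have g: "Ap_const q (v s) = ennreal (g s)" if "1 \<le> s" for s
      using vM[OF that] by (simp add: g_def Muckenhoupt_def ennreal_enn2real_if less_top)
    have g0: "0 \<le> g s" for s by (simp add: g_def)
    have v0: "0 \<le> v s x" if "1 \<le> s" for s x using that u0 by (simp add: v_def)
    \<comment> \<open>\<open>v s\<close> and \<open>v t\<close> differ pointwise by a factor between
      \<open>1\<close> and \<open>t / s\<close>, so their constants do as well up to this factor in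
      either direction.\<close>
    have gst: "g t \<le> t / s * g s" "g s \<le> t / s * g t" if st: "1 \<le> s" "s \<le> t" for s t
    proof -
      have "Ap_const q (v t) \<le> ennreal ((t / s) / 1) * Ap_const q (v s)"
        by (rule Ap_const_comparable) (use q v0 st vst[OF st] in auto)
      then have "ennreal (g t) \<le> ennreal (t / s) * ennreal (g s)" using g[of s] g[of t] st by simp
      then have "ennreal (g t) \<le> ennreal (t / s * g s)" using g0 st by (subst ennreal_mult) auto
      then show "g t \<le> t / s * g s" using g0 st by (subst (asm) ennreal_le_iff) auto
      have "s / t * v t x \<le> v s x" for x using vst(2)[OF st, of x] st by (simp add: field_simps)
      then have "Ap_const q (v s) \<le> ennreal (1 / (s / t)) * Ap_const q (v t)"
        by (intro Ap_const_comparable) (use q v0 st vst(1)[OF st] in auto)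
      then have "ennreal (g s) \<le> ennreal (t / s) * ennreal (g t)" using g[of s] g[of t] st by simp
      then have "ennreal (g s) \<le> ennreal (t / s * g t)" using g0 st by (subst ennreal_mult) auto
      then show "g s \<le> t / s * g t" using g0 st by (subst (asm) ennreal_le_iff) auto
    qed
    have g1: "g 1 \<le> K" using Ku g[of 1] K by (simp add: v1 ennreal_le_iff)
    have gS: "K \<le> g S"
    proof -
      have q0: "0 < q" using q by simp
      obtain m where m: "wmass u Q = ennreal m" "0 < m" using regular_weight_massE[OF ru, of 1 0] by (auto simp: Q_def)
      have rS: "regular_weight (v S)" using vM[OF S1] by (rule Muckenhoupt_regular)
      obtain mS where mS: "wmass (v S) Q = ennreal mS" "0 < mS" using regular_weight_massE[OF rS, of 1 0] by (auto simp: Q_def)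
      obtain e where e: "wmass u E = ennreal e" "0 < e" using regular_weight_massE[OF ru, of "1/2" 0] by (auto simp: E_def)
      have "wmass u (Q - E) < top" using wmass_mono[of "Q - E" Q u] m by (auto intro: le_less_trans)
      then obtain d where d: "wmass u (Q - E) = ennreal d" "0 \<le> d" by (cases "wmass u (Q - E)") auto
      have dm: "d \<le> m" using wmass_mono[of "Q - E" Q u] m d by (simp add: ennreal_le_iff)
      have vd: "wmass (v S) (Q - E) = ennreal d"
        unfolding d(1)[symmetric] wmass_def by (intro nn_integral_cong) (auto simp: v_def indicator_def)
      have EQm: "emeasure lebesgue Q = ennreal (2 ^ ?n)" "emeasure lebesgue E = ennreal 1"
        unfolding Q_def E_def by (subst emeasure_cub; simp)+
      have "emeasure lebesgue (Q - E) = emeasure lebesgue Q - emeasure lebesgue E"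
        using EQ EQm by (intro emeasure_Diff) auto
      also have "\<dots> = ennreal (2 ^ ?n - 1)" unfolding EQm by (rule ennreal_minus) simp
      finally have Dm: "emeasure lebesgue (Q - E) = ennreal (2 ^ ?n - 1)" .
      have two: "(2::real) \<le> 2 ^ ?n" using power_increasing[of 1 ?n "2::real"] by (simp add: Suc_leI)
      have "1 powr q * m \<le> (K + 1) * (2 ^ ?n) powr q * e"
        by (rule thick_real[of q "K+1" u 1 E 0])
          (use Muckenhoupt_thick[OF q u Ku K] K m e EQm EQ q0 in \<open>auto simp: Q_def[symmetric]\<close>)
      then have 1: "m \<le> (K + 1) * V * e" by (simp add: V_def)
      have "S * e \<le> mS"
      proof -
        have "ennreal S * wmass u E = (\<integral>\<^sup>+x. ennreal S * (ennreal (u x) * indicator E x) \<partial>lebesgue)"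
          unfolding wmass_def by (rule nn_integral_cmult[symmetric]) measurable
        also have "\<dots> \<le> wmass (v S) Q" unfolding wmass_def using EQ S1 u0
          by (intro nn_integral_mono) (auto simp: v_def indicator_def ennreal_mult mult.commute)
        finally have "ennreal (S * e) \<le> ennreal mS" using e mS S1 by (simp add: ennreal_mult)
        then show ?thesis using mS by (simp add: ennreal_le_iff)
      qed
      show ?thesis
      proof (rule ccontr)
        assume "\<not> K \<le> g S"
        then have "Ap_const q (v S) \<le> ennreal K" unfolding g[OF S1] by (intro ennreal_leI) simp
        \<comment> \<open>With a constant at most \<open>K\<close>, the part \<open>Q - E\<close>,
          of volume at least \<open>1\<close>, would carry a fixed share of the mass; but there
          \<open>v S\<close> equals \<open>u\<close>, while its mass on \<open>E\<close> has grown
          by the factor \<open>S\<close>.\<close>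
        then have th: "thick q ((K + 1) powr (1/q)) (v S)" using K by (intro Muckenhoupt_thick[OF q vM[OF S1]])
        have "(2 ^ ?n - 1) powr q * mS \<le> (K + 1) * (2 ^ ?n) powr q * d"
          by (rule thick_real[of q "K+1" "v S" 1 "Q - E" 0])
            (use th K mS d vd EQm Dm q0 two in \<open>auto simp: Q_def[symmetric]\<close>)
        moreover have "1 * mS \<le> (2 ^ ?n - 1) powr q * mS"
          using two q mS by (intro mult_right_mono ge_one_powr_ge_zero) auto
        ultimately have "mS \<le> (K + 1) * V * d" by (simp add: V_def)
        also have "\<dots> \<le> (K + 1) * V * ((K + 1) * V * e)"
          using dm 1 K V1 by (intro mult_left_mono) auto
        also have "\<dots> = S * e / 2" by (simp add: S_def)
        finally have "S * e \<le> S * e / 2" using \<open>S * e \<le> mS\<close> by simp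
        moreover have "0 < S * e" using S1 e by simp
        ultimately show False by simp
      qed
    qed
    have lip: "\<bar>g t - g s\<bar> \<le> (S * K) * \<bar>t - s\<bar>" if st: "1 \<le> s" "s \<le> t" "t \<le> S" for s t
    proof -
      have bd: "g r \<le> S * K" if r: "1 \<le> r" "r \<le> S" for r
      proof -
        have "g r \<le> r / 1 * g 1" using gst(1)[of 1 r] r by simp
        also have "\<dots> \<le> S * K" using g1 g0 r by (intro mult_mono) auto
        finally show ?thesis .
      qed
      have *: "(t / s - 1) * g r \<le> (S * K) * (t - s)" if r: "1 \<le> r" "r \<le> S" for r
      proof -
        have "t / s - 1 = (t - s) / s" using st by (simp add: field_simps)
        also have "\<dots> \<le> t - s" using st by (simp add: divide_le_eq mult_le_cancel_left1)
        finally have "(t / s - 1) * g r \<le> (t - s) * (S * K)"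
          using bd[OF r] st g0 by (intro mult_mono) auto
        then show ?thesis by (simp add: mult.commute)
      qed
      have "g t - g s \<le> (t / s - 1) * g s" "g s - g t \<le> (t / s - 1) * g t"
        using gst[OF st(1,2)] by (simp_all add: algebra_simps)
      then show ?thesis using *[of s] *[of t] st by (simp add: abs_le_iff)
    qed
    have "(S * K)-lipschitz_on {1..S} g"
    proof (rule lipschitz_onI)
      fix s t assume "s \<in> {1..S}" "t \<in> {1..S}"
      then show "dist (g s) (g t) \<le> S * K * dist s t"
        using lip[of s t] lip[of t s] by (cases "s \<le> t") (auto simp: dist_real_def abs_minus_commute)
    qed (use S1 K in simp)
    then have "continuous_on {1..S} g" by (rule lipschitz_on_continuous_on)
    then obtain s where s: "1 \<le> s" "s \<le> S" "g s = K" using IVT'[of g 1 K S] g1 gS S1 by auto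
    have "u x \<le> v s x" "v s x \<le> S * u x" for x
    proof -
      show "u x \<le> v s x" using vst(1)[of 1 s x] s by (simp add: v1)
      have "v s x \<le> s * u x" using vst(2)[of 1 s x] s by (simp add: v1)
      also have "\<dots> \<le> S * u x" using s u0 by (intro mult_right_mono) auto
      finally show "v s x \<le> S * u x" .
    qed
    then show ?thesis using vM[OF s(1)] g[OF s(1)] s(3) by (intro bexI[of _ "v s"]) auto
  qed
  show thesis by (rule that[OF S1 main])
qed

subsection \<open>Localizing weights\<close>

text \<open>The last hypothesis is an \<open>A_1\<close> condition relative to the measure
  \<open>w dx\<close>. On a cube \<open>v\<close> is at least \<open>u(Q)/(A w(Q))\<close> with
  \<open>u = v w\<close>; this lower bound in the dual weight compensates the change from
  \<open>w(Q)\<close> to \<open>u(Q)\<close> up to the factor \<open>A\<close>.\<close>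

lemma Muckenhoupt_times:
  fixes v w :: "real ^ 'n \<Rightarrow> real"
  assumes q: "1 \<le> q" and w: "w \<in> Muckenhoupt q" and K: "Ap_const q w \<le> ennreal K" "0 < K"
    and [measurable]: "v \<in> borel_measurable lebesgue" and v: "\<And>x. 0 < v x" and A: "0 < A"
    and le: "\<And>c h x. 0 < h \<Longrightarrow> x \<in> cub c h \<Longrightarrow> wmass (\<lambda>x. v x * w x) (cub c h) \<le> ennreal (A * v x) * wmass w (cub c h)"
  shows "(\<lambda>x. v x * w x) \<in> Muckenhoupt q" "Ap_const q (\<lambda>x. v x * w x) \<le> ennreal (A * (K + 1))"
proof -
  let ?u = "\<lambda>x. v x * w x"
  have rw: "regular_weight w" using w by (rule Muckenhoupt_regular)
  have [measurable]: "w \<in> borel_measurable lebesgue" and w0: "\<And>x. 0 \<le> w x" and wp: "AE x in lebesgue. 0 < w x"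
    using rw by (auto simp: regular_weight_def)
  have fin: "wmass ?u (cub c h) < top" if h: "0 < h" for c h
  proof -
    have "wmass ?u (cub c h) \<le> ennreal (A * v c) * wmass w (cub c h)"
      by (intro le h center_in_cub) (use h in simp)
    also have "\<dots> < top" using rw h by (simp add: regular_weight_def ennreal_mult_less_top)
    finally show ?thesis .
  qed
  have "AE x in lebesgue. 0 < ?u x" using wp by eventually_elim (simp add: v)
  then have ru: "regular_weight ?u" using fin v w0 by (simp add: regular_weight_def less_imp_le)
  show Ap: "Ap_const q ?u \<le> ennreal (A * (K + 1))"
  proof (cases "q = 1")
    case True
    have "Ap_const 1 w < ennreal (K + 1)" using K True by (simp add: ennreal_less_iff order_le_less_trans)
    then have A1: "A1_bound (K + 1) w" using w True by (intro Muckenhoupt_one_A1_bound) auto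
    have "Ap_const 1 ?u \<le> ennreal (A * (K + 1))"
    proof (rule Ap_const_one_le)
      show "0 \<le> A * (K + 1)" using A K by simp
      fix Q :: "(real ^ 'n) set" assume "Q \<in> cubes"
      then obtain c h where Q: "Q = cub c h" "0 < h" by (auto simp: cubes_eq)
      obtain V where V: "emeasure lebesgue (cub c h) = ennreal V" "0 < V" using emeasure_cub_pos[OF Q(2)] by blast
      obtain X where X: "wmass ?u (cub c h) = ennreal X" "0 < X" using regular_weight_massE[OF ru Q(2)] by blast
      obtain Y where Y: "wmass w (cub c h) = ennreal Y" "0 < Y" using regular_weight_massE[OF rw Q(2)] by blast
      have "AE x in lebesgue. x \<in> cub c h \<longrightarrow> wmass w (cub c h) \<le> ennreal ((K + 1) * w x) * emeasure lebesgue (cub c h)"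
        using A1 Q(2) by (simp add: A1_bound_def)
      then show "AE x in lebesgue. x \<in> Q \<longrightarrow> avg ?u Q \<le> ennreal (A * (K + 1) * ?u x)"
      proof eventually_elim
        case (elim x)
        show ?case
        proof
          assume x: "x \<in> Q"
          have "ennreal X \<le> ennreal (A * v x) * ennreal Y" using le[OF Q(2), of x c] x Q X Y by simp
          also have "\<dots> = ennreal (A * v x * Y)" using A v[of x] Y by (subst ennreal_mult[symmetric]) auto
          finally have 1: "X \<le> A * v x * Y" using A v[of x] Y by (subst (asm) ennreal_le_iff) auto
          have "ennreal Y \<le> ennreal ((K + 1) * w x) * ennreal V" using elim x Q V Y by simp
          also have "\<dots> = ennreal ((K + 1) * w x * V)" using K w0[of x] V by (subst ennreal_mult[symmetric]) auto
          finally have 2: "Y \<le> (K + 1) * w x * V" using K w0[of x] V by (subst (asm) ennreal_le_iff) auto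
          have "A * v x * Y \<le> A * v x * ((K + 1) * w x * V)" using 2 A v[of x] by (intro mult_left_mono) auto
          then have "X / V \<le> A * (K + 1) * ?u x" using 1 V by (simp add: divide_le_eq mult_ac)
          moreover have "avg ?u Q = ennreal (X / V)" unfolding Q(1) using X by (intro avg_cub[OF V]) auto
          ultimately show "avg ?u Q \<le> ennreal (A * (K + 1) * ?u x)" by (simp only: ennreal_leI)
        qed
      qed
    qed
    then show ?thesis using True by simp
  next
    case False
    then have q1: "1 < q" using q by simp
    let ?e = "1 - conj_exponent q"
    have e: "?e < 0" "?e * (q - 1) = -1" unfolding dual_exponent[OF q1] using q1 by auto
    show ?thesis unfolding Ap_const_le_iff[OF q1]
    proof (intro allI impI)
      fix c :: "real ^ 'n" and h :: real assume h: "0 < h"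
      obtain V where V: "emeasure lebesgue (cub c h) = ennreal V" "0 < V" using emeasure_cub_pos[OF h] by blast
      obtain X where X: "wmass ?u (cub c h) = ennreal X" "0 < X" using regular_weight_massE[OF ru h] by blast
      obtain Y where Y: "wmass w (cub c h) = ennreal Y" "0 < Y" using regular_weight_massE[OF rw h] by blast
      define b where "b = X / (A * Y)"
      have b0: "0 < b" using X Y A by (simp add: b_def)
      have low: "b \<le> v x" if x: "x \<in> cub c h" for x
      proof -
        have "ennreal X \<le> ennreal (A * v x) * ennreal Y" using le[OF h x] X Y by simp
        also have "\<dots> = ennreal (A * v x * Y)" using A v[of x] Y by (subst ennreal_mult[symmetric]) auto
        finally have "X \<le> A * v x * Y" using A v[of x] Y by (subst (asm) ennreal_le_iff) auto
        then show ?thesis using A Y by (simp add: b_def divide_le_eq mult_ac)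
      qed
      have "wmass (\<lambda>x. ?u x powr ?e) (cub c h) \<le> ennreal (b powr ?e) * wmass (\<lambda>x. w x powr ?e) (cub c h)"
      proof (rule wmass_le_cmult)
        fix x assume x: "x \<in> cub c h"
        have "v x powr ?e \<le> b powr ?e" using low[OF x] b0 e by (intro powr_mono2') auto
        then have "v x powr ?e * w x powr ?e \<le> b powr ?e * w x powr ?e" by (intro mult_right_mono) auto
        then show "?u x powr ?e \<le> b powr ?e * w x powr ?e" using v[of x] w0[of x] by (simp add: powr_mult)
      qed auto
      then have "avg (\<lambda>x. ?u x powr ?e) (cub c h) \<le> ennreal (b powr ?e) * avg (\<lambda>x. w x powr ?e) (cub c h)"
        by (rule avg_le_cmult)
      then have "epowr (avg (\<lambda>x. ?u x powr ?e) (cub c h)) (q - 1) \<le>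
          epowr (ennreal (b powr ?e) * avg (\<lambda>x. w x powr ?e) (cub c h)) (q - 1)"
        using q1 by (intro epowr_mono) auto
      also have "\<dots> = ennreal (1 / b) * epowr (avg (\<lambda>x. w x powr ?e) (cub c h)) (q - 1)"
        using q1 b0 e by (simp add: epowr_mult epowr_ennreal powr_powr powr_minus divide_inverse)
      finally have "avg ?u (cub c h) * epowr (avg (\<lambda>x. ?u x powr ?e) (cub c h)) (q - 1) \<le>
          ennreal (X / V) * (ennreal (1 / b) * epowr (avg (\<lambda>x. w x powr ?e) (cub c h)) (q - 1))"
        using avg_cub[OF V X(1)] X by (simp add: mult_left_mono)
      also have "\<dots> = ennreal (X / V * (1 / b)) * epowr (avg (\<lambda>x. w x powr ?e) (cub c h)) (q - 1)"
        using X V b0 by (intro ennreal_mult_mult) auto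
      also have "X / V * (1 / b) = A * (Y / V)" using X V A Y by (simp add: b_def)
      also have "ennreal (A * (Y / V)) = ennreal A * avg w (cub c h)"
        using avg_cub[OF V Y(1)] Y A V by (subst ennreal_mult) auto
      also have "ennreal A * avg w (cub c h) * epowr (avg (\<lambda>x. w x powr ?e) (cub c h)) (q - 1) =
         ennreal A * (avg w (cub c h) * epowr (avg (\<lambda>x. w x powr ?e) (cub c h)) (q - 1))" by (rule mult.assoc)
      also have "\<dots> \<le> ennreal A * ennreal K"
        using Ap_const_le_iff[OF q1, of w "ennreal K"] K h by (intro mult_left_mono) auto
      also have "\<dots> \<le> ennreal (A * (K + 1))"
        using A K by (subst ennreal_mult[symmetric]) (auto intro: ennreal_leI)
      finally show "avg ?u (cub c h) * epowr (avg (\<lambda>x. ?u x powr ?e) (cub c h)) (q - 1) \<le> ennreal (A * (K + 1))" .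
    qed
  qed
  show "?u \<in> Muckenhoupt q"
    using ru Ap by (auto simp: Muckenhoupt_def regular_weight_iff intro: le_less_trans)
qed

definition mass :: "(real ^ 'n \<Rightarrow> real) \<Rightarrow> real ^ 'n \<Rightarrow> real \<Rightarrow> real" where
  "mass w c h = enn2real (wmass w (cub c h))"

lemma wmass_eq_mass:
  assumes "regular_weight w" "0 < h" shows "wmass w (cub c h) = ennreal (mass w c h)" "0 < mass w c h"
proof -
  obtain m where m: "wmass w (cub c h) = ennreal m" "0 < m" using regular_weight_massE[OF assms] by blast
  then show "wmass w (cub c h) = ennreal (mass w c h)" "0 < mass w c h" by (auto simp: mass_def)
qed

lemma suminf_geometric_ennreal:
  assumes "0 \<le> \<beta>" "\<beta> < (1::real)" shows "(\<Sum>j. ennreal (\<beta> ^ j)) = ennreal (1 / (1 - \<beta>))"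
  using assms by (subst suminf_ennreal2) (auto intro: summable_geometric simp: suminf_geometric)

text \<open>To test the relative \<open>A_1\<close> condition on a cube of half side
  \<open>h'\<close>, the sum defining \<open>v\<close> is split by size. For the dilates
  \<open>Q j\<close> larger than the test cube, the coefficients are comparable to ones whose dilate
  contains the given point. For the smaller ones, the growth hypothesis makes the masses
  \<open>a j * w(Q j)\<close> sum geometrically up to the largest of them that meets the test cube.
  \<beta> enters the growth squared because the coefficients use up one power.\<close>

lemma localizing_weight:
  fixes w :: "real ^ 'n \<Rightarrow> real" and \<mu> :: "real ^ 'n \<Rightarrow> real \<Rightarrow> real"
  assumes rw: "regular_weight w" and D: "doubling D w"
    and \<mu>_all: "\<forall>c h. 0 < h \<longrightarrow> 0 < \<mu> c h \<and> \<mu> c h \<le> \<mu> c (2 * h)"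
      "\<forall>c h. 0 < h \<longrightarrow> \<mu> c (2 * h) \<le> D' * \<mu> c h"
    and \<theta>: "0 \<le> \<theta>" and \<beta>: "0 < \<beta>" "\<beta> < 1" and C: "0 \<le> C"
    and growth_all: "\<forall>c h. \<forall>i j::nat. 0 < h \<longrightarrow> i \<le> j \<longrightarrow>
       mass w c (2 ^ i * h) * \<mu> c (2 ^ i * h) powr (- \<theta>)
         \<le> C * (\<beta> ^ (j - i) * \<beta> ^ (j - i)) * (mass w c (2 ^ j * h) * \<mu> c (2 ^ j * h) powr (- \<theta>))"
  defines "L \<equiv> D' powr \<theta> / \<beta>"
  defines "A \<equiv> L ^ 2 + C * L ^ 3 * D * (1 / (1 - \<beta>))"
  assumes h: "0 < h"
  obtains v :: "real ^ 'n \<Rightarrow> real" where "v \<in> borel_measurable lebesgue" "\<And>x. 0 < v x" 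
    "\<And>x. x \<in> cub c h \<Longrightarrow> \<mu> c h powr (- \<theta>) \<le> v x"
    "\<And>c' h' x. 0 < h' \<Longrightarrow> x \<in> cub c' h' \<Longrightarrow> 
       wmass (\<lambda>x. v x * w x) (cub c' h') \<le> ennreal (A * v x) * wmass w (cub c' h')"
    "\<And>f N. f \<in> borel_measurable lebesgue \<Longrightarrow> 
       (\<And>h'. 0 < h' \<Longrightarrow> (\<integral>\<^sup>+x. f x * indicator (cub c h') x \<partial>lebesgue) \<le> N * ennreal (\<mu> c h' powr \<theta>)) \<Longrightarrow>
       (\<integral>\<^sup>+x. f x * ennreal (v x) \<partial>lebesgue) \<le> ennreal (1 / (1 - \<beta>)) * N"
proof -
  have [measurable]: "w \<in> borel_measurable lebesgue" and w0: "\<And>x. 0 \<le> w x"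
    using rw by (auto simp: regular_weight_def)
  have D0: "0 < D" using D by (simp add: doubling_def)
  have \<mu>: "\<And>c h. 0 < h \<Longrightarrow> 0 < \<mu> c h" "\<And>c h. 0 < h \<Longrightarrow> \<mu> c h \<le> \<mu> c (2 * h)"
    "\<And>c h. 0 < h \<Longrightarrow> \<mu> c (2 * h) \<le> D' * \<mu> c h"
    using \<mu>_all by simp_all
  note growth = growth_all[rule_format]
  define m where "m j = \<mu> c (2 ^ j * h)" for j :: nat
  define Q where "Q j = cub c (2 ^ j * h)" for j :: nat
  define a where "a j = m j powr (- \<theta>) * \<beta> ^ j" for j
  have [measurable]: "Q j \<in> sets lebesgue" for j by (simp add: Q_def)
  have mpos: "0 < m j" for j using \<mu>(1) h by (simp add: m_def)
  have mmono: "m j \<le> m (Suc j)" "m (Suc j) \<le> D' * m j" for j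
    using \<mu>(2,3)[of "2 ^ j * h" c] h by (auto simp: m_def mult.assoc)
  have D'0: "0 < D'" using \<mu>(1,3)[OF h, of c] \<mu>(1)[of "2 * h" c] h by (metis less_le_trans mult_pos_pos zero_less_mult_pos2 zero_less_numeral)
  have L0: "0 < L" using D'0 \<beta> by (simp add: L_def)
  have apos: "0 < a j" for j
    unfolding a_def using mpos[of j] \<beta> by (intro mult_pos_pos) auto
  \<comment> \<open>One dilation multiplies \<open>m\<close> by at most \<open>D'\<close> and the
    geometric factor by \<beta>; \<open>L\<close> is the resulting loss.\<close>
  have aSuc: "a j \<le> L * a (Suc j)" for j
  proof -
    have "(D' * m j) powr (-\<theta>) \<le> m (Suc j) powr (-\<theta>)"
      using mmono mpos \<theta> by (intro powr_mono2') auto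
    then have "D' powr (-\<theta>) * m j powr (-\<theta>) \<le> m (Suc j) powr (-\<theta>)"
      using D'0 mpos[of j] by (simp add: powr_mult)
    then have "D' powr \<theta> * (D' powr (-\<theta>) * m j powr (-\<theta>)) \<le> D' powr \<theta> * m (Suc j) powr (-\<theta>)"
      by (rule mult_left_mono) simp
    moreover have "D' powr \<theta> * D' powr (-\<theta>) = 1" using D'0 by (simp add: powr_minus)
    ultimately have "m j powr (-\<theta>) \<le> D' powr \<theta> * m (Suc j) powr (-\<theta>)"
      by (simp only: mult.assoc[symmetric] mult_1_left)
    then have "m j powr (-\<theta>) * \<beta> ^ j \<le> D' powr \<theta> * m (Suc j) powr (-\<theta>) * \<beta> ^ j"
      using \<beta> by (intro mult_right_mono) auto
    also have "\<dots> = L * a (Suc j)" using \<beta> by (simp add: L_def a_def)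
    finally show ?thesis by (simp add: a_def)
  qed
  have aadd: "a j \<le> L ^ i * a (j + i)" for i j
  proof (induction i)
    case (Suc i)
    have "L ^ i * a (j + i) \<le> L ^ i * (L * a (Suc (j + i)))" using aSuc L0 by (intro mult_left_mono) auto
    then show ?case using Suc by (simp add: mult_ac)
  qed simp
  have adec: "a j \<le> a 0 * \<beta> ^ j" for j
  proof -
    have "m 0 \<le> m j" by (rule lift_Suc_mono_le[of m]) (use mmono in auto)
    then have "m j powr (-\<theta>) \<le> m 0 powr (-\<theta>)" using mpos \<theta> by (intro powr_mono2') auto
    then show ?thesis using \<beta> by (simp add: a_def mult_right_mono)
  qed
  have summ: "summable (\<lambda>j. a j * indicator (Q j) x)" for x
  proof (rule summable_comparison_test')
    show "summable (\<lambda>j. a 0 * \<beta> ^ j)" using \<beta> by (intro summable_mult summable_geometric) auto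
    show "norm (a j * indicator (Q j) x) \<le> a 0 * \<beta> ^ j" if "0 \<le> j" for j
      using adec[of j] apos[of j] apos[of 0] \<beta> by (auto simp: indicator_def)
  qed
  define v where "v x = (\<Sum>j. a j * indicator (Q j) x)" for x
  have vm [measurable]: "v \<in> borel_measurable lebesgue" unfolding v_def[abs_def] by measurable
  have ve: "ennreal (v x) = (\<Sum>j. ennreal (a j) * indicator (Q j) x)" for x
  proof -
    have "ennreal (v x) = (\<Sum>j. ennreal (a j * indicator (Q j) x))"
      unfolding v_def by (rule suminf_ennreal2[symmetric]) (use summ apos in \<open>auto simp: less_imp_le\<close>)
    also have "\<dots> = (\<Sum>j. ennreal (a j) * indicator (Q j) x)"
      by (intro suminf_cong) (auto simp: indicator_def)
    finally show ?thesis .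
  qed
  have vge: "a j \<le> v x" if "x \<in> Q j" for x j
    using sum_le_suminf[OF summ[of x], of "{j}"] that apos by (auto simp: v_def less_imp_le)
  have vpos: "0 < v x" for x
  proof -
    obtain j where "x \<in> Q j" using ex_cub[OF h, of x c] by (auto simp: Q_def)
    then show ?thesis using vge[of x j] apos[of j] by linarith
  qed
  have v1: "\<mu> c h powr (- \<theta>) \<le> v x" if "x \<in> cub c h" for x
    using vge[of x 0] that by (simp add: Q_def a_def m_def)
  have v2: "wmass (\<lambda>x. v x * w x) (cub c' h') \<le> ennreal (A * v x) * wmass w (cub c' h')"
    if h': "0 < h'" and x: "x \<in> cub c' h'" for c' h' x
  proof -
    let ?Q = "cub c' h'" and ?M = "mass w c' h'"
    note M = wmass_eq_mass[OF rw h', of c']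
    have "wmass (\<lambda>x. v x * w x) ?Q = (\<integral>\<^sup>+y. (\<Sum>j. ennreal (a j) * (ennreal (w y) * indicator (?Q \<inter> Q j) y)) \<partial>lebesgue)"
      unfolding wmass_def
    proof (intro nn_integral_cong)
      fix y
      have "ennreal (v y * w y) * indicator ?Q y = ennreal (v y) * (ennreal (w y) * indicator ?Q y)"
        using vpos[of y] w0[of y] by (simp add: ennreal_mult mult.assoc)
      also have "\<dots> = (\<Sum>j. ennreal (a j) * indicator (Q j) y * (ennreal (w y) * indicator ?Q y))"
        unfolding ve by (rule ennreal_suminf_multc[symmetric])
      also have "\<dots> = (\<Sum>j. ennreal (a j) * (ennreal (w y) * indicator (?Q \<inter> Q j) y))"
        by (intro suminf_cong) (auto simp: indicator_def)
      finally show "ennreal (v y * w y) * indicator ?Q y = (\<Sum>j. ennreal (a j) * (ennreal (w y) * indicator (?Q \<inter> Q j) y))" .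
    qed
    also have "\<dots> = (\<Sum>j. ennreal (a j) * wmass w (?Q \<inter> Q j))"
      unfolding wmass_def by (subst nn_integral_suminf, measurable) (simp add: nn_integral_cmult)
    also have "\<dots> \<le> ennreal (A * v x) * wmass w ?Q"
    proof -
      define J where "J = {j. 2 ^ j * h \<le> h' \<and> ?Q \<inter> Q j \<noteq> {}}"
      have finJ: "finite J"
      proof -
        obtain k where k: "h' / h < 2 ^ k" using real_arch_pow[of 2 "h' / h"] by auto
        have "J \<subseteq> {..<k}"
        proof
          fix j assume "j \<in> J"
          then have "2 ^ j * h \<le> h'" by (simp add: J_def)
          also have "h' < 2 ^ k * h" using k h by (simp add: field_simps)
          finally have "2 ^ j * h < 2 ^ k * h" .
          then have "(2::real) ^ j < 2 ^ k" using h by simp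
          then show "j \<in> {..<k}" by simp
        qed
        then show ?thesis by (rule finite_subset) simp
      qed
      let ?n = "Max J"
      \<comment> \<open>Geometric decay away from the largest index in \<open>J\<close>: the factor
        \<open>L ^ 3\<close> reaches a dilate containing \<open>x\<close>, and \<open>D\<close>
        compares the mass of that largest dilate with the test cube.\<close>
      define B where "B j = (if j \<in> J then \<beta> ^ (?n - j) * (C * L ^ 3 * D * v x) else 0)" for j
      have B0: "0 \<le> B j" for j using \<beta> C L0 D0 vpos[of x] by (simp add: B_def)
      have term_le: "ennreal (a j) * wmass w (?Q \<inter> Q j) \<le>
          (ennreal (L ^ 2) * (ennreal (a (j + 2)) * indicator (Q (j + 2)) x) + ennreal (B j)) * wmass w ?Q" for j
      proof (cases "?Q \<inter> Q j = {}")
        case True then show ?thesis by (simp add: wmass_def)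
      next
        case ne: False
        then obtain y where y: "y \<in> ?Q" "y \<in> Q j" by blast
        show ?thesis
        proof (cases "j \<in> J")
          case False
          then have hj: "h' < 2 ^ j * h" using ne by (auto simp: J_def)
          \<comment> \<open>The test cube is smaller than \<open>Q j\<close> and meets it, so three
            times the half side covers it, and \<open>3 \<le> 2 ^ 2\<close>.\<close>
          have "x \<in> Q (j + 2)" 
          proof -
            have "0 < 2 ^ j * h" "2 ^ (j + 2) * h = 4 * (2 ^ j * h)" using h by (auto simp: power_add)
            then have "2 * h' + 2 ^ j * h \<le> 2 ^ (j + 2) * h" using hj by linarith
            then have "?Q \<subseteq> Q (j + 2)" unfolding Q_def
              by (rule cub_subset[OF y(1) y(2)[unfolded Q_def]])
            then show ?thesis using x by blast
          qed
          moreover have "ennreal (a j) * wmass w (?Q \<inter> Q j) \<le> ennreal (L ^ 2 * a (j + 2)) * wmass w ?Q"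
            by (intro mult_mono ennreal_leI aadd wmass_mono) auto
          moreover have "ennreal (L ^ 2 * a (j + 2)) = ennreal (L ^ 2) * ennreal (a (j + 2))"
            using apos[of "j+2"] by (intro ennreal_mult) auto
          ultimately show ?thesis by (simp add: B_def False)
        next
          case True
          have nJ: "?n \<in> J" and jn: "j \<le> ?n" using finJ True by (auto intro: Max_in)
          then have hn: "2 ^ ?n * h \<le> h'" and nne: "?Q \<inter> Q ?n \<noteq> {}" by (auto simp: J_def)
          then obtain z where z: "z \<in> ?Q" "z \<in> Q ?n" by blast
          \<comment> \<open>The next dilate still meets the test cube, so it can leave
            \<open>J\<close> only by being larger; hence \<open>h'\<close> is below twice the half
            side of the dilate of maximal index.\<close>
          have "Suc ?n \<notin> J"
          proof
            assume "Suc ?n \<in> J"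
            from Max_ge[OF finJ this] show False by linarith
          qed
          moreover have "Q ?n \<subseteq> Q (Suc ?n)" unfolding Q_def using h by (intro cub_mono) auto
          ultimately have hn': "h' < 2 * (2 ^ ?n * h)" using nne by (auto simp: J_def)
          have xQ: "x \<in> Q (?n + 3)"
          proof -
            \<comment> \<open>The enlargement must exceed \<open>2 * 2 + 1 = 5\<close> times the
              half side, so two doublings are too few and three suffice.\<close>
            have "0 < 2 ^ ?n * h" "2 ^ (?n + 3) * h = 8 * (2 ^ ?n * h)" using h by (auto simp: power_add)
            then have "2 * h' + 2 ^ ?n * h \<le> 2 ^ (?n + 3) * h" using hn' by linarith
            then have "?Q \<subseteq> Q (?n + 3)" unfolding Q_def
              by (rule cub_subset[OF z(1) z(2)[unfolded Q_def]])
            then show ?thesis using x by blast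
          qed
          have "Q ?n \<subseteq> cub c' (3 * h')" unfolding Q_def
            by (rule cub_subset[OF z(2)[unfolded Q_def] z(1)]) (use hn in simp)
          then have "wmass w (Q ?n) \<le> wmass w (cub c' (3 * h'))" by (rule wmass_mono)
          also have "\<dots> \<le> ennreal D * wmass w ?Q" using D h' by (simp add: doubling_def)
          finally have Wn: "mass w c (2 ^ ?n * h) \<le> D * ?M"
            using M D0 wmass_eq_mass[OF rw, of "2 ^ ?n * h" c] h
            by (simp add: Q_def ennreal_mult[symmetric] less_imp_le ennreal_le_iff)
          have an: "a ?n \<le> L ^ 3 * v x"
            using aadd[of ?n 3] vge[OF xQ] L0 by (meson less_imp_le mult_left_mono order_trans zero_le_power)
          \<comment> \<open>The coefficient supplies \<open>\<beta> ^ j\<close>, and one of the two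
            growth factors completes it to \<open>\<beta> ^ ?n\<close>, that is, to the coefficient
            \<open>a ?n\<close>; the other one remains as geometric decay.\<close>
          have "a j * mass w c (2 ^ j * h) = \<beta> ^ j * (mass w c (2 ^ j * h) * m j powr (-\<theta>))" by (simp add: a_def)
          also have "\<dots> \<le> \<beta> ^ j * (C * (\<beta> ^ (?n - j) * \<beta> ^ (?n - j)) * (mass w c (2 ^ ?n * h) * m ?n powr (-\<theta>)))"
            unfolding m_def using \<beta> h jn by (intro mult_left_mono growth) auto
          also have "\<dots> = C * \<beta> ^ (?n - j) * ((\<beta> ^ j * \<beta> ^ (?n - j)) * m ?n powr (-\<theta>)) * mass w c (2 ^ ?n * h)"
            by (simp only: mult_ac)
          also have "\<beta> ^ j * \<beta> ^ (?n - j) = \<beta> ^ ?n" using jn by (simp flip: power_add)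
          also have "\<beta> ^ ?n * m ?n powr (-\<theta>) = a ?n" by (simp add: a_def)
          also have "C * \<beta> ^ (?n - j) * a ?n * mass w c (2 ^ ?n * h) \<le> C * \<beta> ^ (?n - j) * (L ^ 3 * v x) * (D * ?M)"
            using C \<beta> an Wn apos[of ?n] L0 vpos[of x] by (intro mult_mono mult_left_mono) (auto simp: mass_def less_imp_le)
          also have "\<dots> = B j * ?M" using True by (simp add: B_def mult_ac)
          finally have "ennreal (a j * mass w c (2 ^ j * h)) \<le> ennreal (B j * ?M)" by (rule ennreal_leI)
          moreover have "ennreal (a j) * wmass w (?Q \<inter> Q j) \<le> ennreal (a j) * wmass w (Q j)"
            by (intro mult_left_mono wmass_mono) auto
          moreover have "ennreal (a j) * wmass w (Q j) = ennreal (a j * mass w c (2 ^ j * h))"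
            unfolding Q_def using wmass_eq_mass[OF rw, of "2 ^ j * h" c] h apos[of j] by (simp add: ennreal_mult)
          moreover have "ennreal (B j * ?M) = ennreal (B j) * wmass w ?Q" using M B0[of j] by (simp add: ennreal_mult)
          ultimately have "ennreal (a j) * wmass w (?Q \<inter> Q j) \<le> ennreal (B j) * wmass w ?Q" by simp
          also have "\<dots> \<le> (ennreal (L ^ 2) * (ennreal (a (j + 2)) * indicator (Q (j + 2)) x) + ennreal (B j)) * wmass w ?Q"
            by (intro mult_right_mono) auto
          finally show ?thesis .
        qed
      qed
      have sB: "(\<Sum>j. ennreal (B j)) \<le> ennreal (C * L ^ 3 * D * (1 / (1 - \<beta>)) * v x)"
      proof -
        let ?X = "C * L ^ 3 * D * v x"
        have X0: "0 \<le> ?X" using C L0 D0 vpos[of x] by simp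
        have "(\<Sum>j. ennreal (B j)) = (\<Sum>j\<in>J. ennreal (B j))"
          by (rule suminf_finite[OF finJ]) (simp add: B_def)
        also have "\<dots> = ennreal (\<Sum>j\<in>J. B j)" using B0 by simp
        also have "(\<Sum>j\<in>J. B j) = (\<Sum>j\<in>J. \<beta> ^ (?n - j)) * ?X" by (simp add: B_def sum_distrib_right)
        also have "(\<Sum>j\<in>J. \<beta> ^ (?n - j)) = (\<Sum>i\<in>(\<lambda>j. ?n - j) ` J. \<beta> ^ i)"
        proof (subst sum.reindex)
          show "inj_on (\<lambda>j. ?n - j) J" using finJ by (intro inj_onI) (metis Max_ge diff_diff_cancel)
        qed simp
        also have "\<dots> \<le> (\<Sum>i. \<beta> ^ i)" using finJ \<beta> by (intro sum_le_suminf summable_geometric) auto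
        also have "\<dots> = 1 / (1 - \<beta>)" using \<beta> by (simp add: suminf_geometric)
        finally show ?thesis using X0 by (simp add: ennreal_leI mult_right_mono mult_ac)
      qed
      have "(\<Sum>j. ennreal (a j) * wmass w (?Q \<inter> Q j)) \<le>
        (\<Sum>j. (ennreal (L ^ 2) * (ennreal (a (j + 2)) * indicator (Q (j + 2)) x) + ennreal (B j)) * wmass w ?Q)"
        by (intro suminf_le term_le) auto
      also have "\<dots> = (ennreal (L ^ 2) * (\<Sum>j. ennreal (a (j + 2)) * indicator (Q (j + 2)) x) + (\<Sum>j. ennreal (B j))) * wmass w ?Q"
        by (simp add: suminf_add[symmetric])
      also have "\<dots> \<le> (ennreal (L ^ 2) * ennreal (v x) + ennreal (C * L ^ 3 * D * (1 / (1 - \<beta>)) * v x)) * wmass w ?Q"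
        unfolding ve using suminf_shift_le[of "\<lambda>j. ennreal (a j) * indicator (Q j) x" 2]
        by (intro mult_right_mono add_mono mult_left_mono sB) auto
      also have "ennreal (L ^ 2) * ennreal (v x) + ennreal (C * L ^ 3 * D * (1 / (1 - \<beta>)) * v x) = ennreal (A * v x)"
        using C L0 D0 vpos[of x] \<beta> by (simp add: A_def algebra_simps flip: ennreal_mult ennreal_plus)
      finally show ?thesis .
    qed
    finally show ?thesis .
  qed
  have v3: "(\<integral>\<^sup>+x. f x * ennreal (v x) \<partial>lebesgue) \<le> ennreal (1 / (1 - \<beta>)) * N"
    if [measurable]: "f \<in> borel_measurable lebesgue" and
       f: "\<And>h'. 0 < h' \<Longrightarrow> (\<integral>\<^sup>+x. f x * indicator (cub c h') x \<partial>lebesgue) \<le> N * ennreal (\<mu> c h' powr \<theta>)" for f N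
  proof -
    have "(\<integral>\<^sup>+x. f x * ennreal (v x) \<partial>lebesgue) = (\<integral>\<^sup>+x. (\<Sum>j. ennreal (a j) * (f x * indicator (Q j) x)) \<partial>lebesgue)"
      unfolding ve by (intro nn_integral_cong, subst ennreal_suminf_cmult[symmetric]) (simp add: mult_ac)
    also have "\<dots> = (\<Sum>j. ennreal (a j) * (\<integral>\<^sup>+x. f x * indicator (Q j) x \<partial>lebesgue))"
      by (subst nn_integral_suminf, measurable) (simp add: nn_integral_cmult)
    also have "\<dots> \<le> (\<Sum>j. ennreal (\<beta> ^ j) * N)"
    proof (intro suminf_le)
      fix j
      have "ennreal (a j) * (\<integral>\<^sup>+x. f x * indicator (Q j) x \<partial>lebesgue) \<le> ennreal (a j) * (N * ennreal (m j powr \<theta>))"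
        unfolding Q_def m_def using h by (intro mult_left_mono f) auto
      also have "\<dots> = ennreal (a j * m j powr \<theta>) * N"
        using apos[of j] by (simp add: ennreal_mult mult_ac)
      \<comment> \<open>The growth allowed by the Morrey bound cancels against the coefficient,
        leaving a geometric series.\<close>
      also have "a j * m j powr \<theta> = \<beta> ^ j" using mpos[of j] by (simp add: a_def powr_minus)
      finally show "ennreal (a j) * (\<integral>\<^sup>+x. f x * indicator (Q j) x \<partial>lebesgue) \<le> ennreal (\<beta> ^ j) * N" .
    qed auto
    also have "\<dots> = (\<Sum>j. ennreal (\<beta> ^ j)) * N" by simp
    also have "(\<Sum>j. ennreal (\<beta> ^ j)) = ennreal (1 / (1 - \<beta>))" using \<beta> by (intro suminf_geometric_ennreal) auto
    finally show ?thesis .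
  qed
  show thesis by (rule that[OF vm vpos v1 v2 v3])
qed

subsection \<open>From Lebesgue to Morrey estimates\<close>

text \<open>What \<open>localizing_weight\<close> requires of the set function \<mu> and the
  exponent \<theta>. Both Morrey scales satisfy it, so the transfer argument is carried out only
  once.\<close>

definition morrey_scale :: "(real ^ 'n \<Rightarrow> real) \<Rightarrow> (real ^ 'n \<Rightarrow> real \<Rightarrow> real) \<Rightarrow> real \<Rightarrow> bool" where
  "morrey_scale w \<mu> \<theta> \<longleftrightarrow> 0 \<le> \<theta> \<and> (\<forall>c h. 0 < h \<longrightarrow> 0 < \<mu> c h \<and> \<mu> c h \<le> \<mu> c (2 * h)) \<and>
     (\<exists>D. \<forall>c h. 0 < h \<longrightarrow> \<mu> c (2 * h) \<le> D * \<mu> c h) \<and>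
     (\<exists>\<beta> C. 0 < \<beta> \<and> \<beta> < 1 \<and> 0 \<le> C \<and> (\<forall>c h. \<forall>i j::nat. 0 < h \<longrightarrow> i \<le> j \<longrightarrow>
       mass w c (2 ^ i * h) * \<mu> c (2 ^ i * h) powr (- \<theta>)
         \<le> C * (\<beta> ^ (j - i) * \<beta> ^ (j - i)) * (mass w c (2 ^ j * h) * \<mu> c (2 ^ j * h) powr (- \<theta>))))"

lemma pint_weight_mono:
  assumes "\<And>x. w x \<le> v x" shows "pint q w F \<le> pint q v F"
  unfolding pint_def using assms by (intro nn_integral_mono ennreal_leI mult_left_mono) auto

lemma pint_weight_cmult:
  assumes [measurable]: "w \<in> borel_measurable lebesgue" "F \<in> borel_measurable lebesgue" 
    and "\<And>x. v x \<le> S * w x" "0 \<le> S" 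
  shows "pint q v F \<le> ennreal S * pint q w F"
  unfolding pint_def
proof (intro nn_integral_cmult_le AE_I2)
  fix x
  have "F x powr q * v x \<le> F x powr q * (S * w x)" using assms by (intro mult_left_mono) auto
  then have "F x powr q * v x \<le> S * (F x powr q * w x)" by (simp add: mult_ac)
  then show "ennreal (F x powr q * v x) \<le> ennreal S * ennreal (F x powr q * w x)"
    using assms(4) by (subst ennreal_mult'[symmetric]) (auto intro: ennreal_leI)
qed measurable

text \<open>The hypothesis of the extrapolation theorem controls the operator norm only through an arbitrary
  function of the Muckenhoupt constant, possibly unbounded on bounded sets; replacing the weight by a
  comparable one with prescribed constant makes it uniform.\<close>

lemma uniform_bound:
  fixes \<phi> :: "ennreal \<Rightarrow> real"
  assumes q: "1 \<le> q" and K: "0 < K"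
  obtains C where "0 \<le> C" 
    "\<And>(F :: real ^ 'n \<Rightarrow> real) G W. F \<in> borel_measurable lebesgue \<Longrightarrow> G \<in> borel_measurable lebesgue \<Longrightarrow>
      (\<And>W. W \<in> Muckenhoupt q \<Longrightarrow> pint q W F < top \<Longrightarrow> pint q W G \<le> ennreal (\<phi> (Ap_const q W)) * pint q W F) \<Longrightarrow>
      W \<in> Muckenhoupt q \<Longrightarrow> Ap_const q W \<le> ennreal K \<Longrightarrow> pint q W F < top \<Longrightarrow> pint q W G \<le> ennreal C * pint q W F"
proof -
  obtain S where S: "1 \<le> S" "\<And>u :: real ^ 'n \<Rightarrow> real. u \<in> Muckenhoupt q \<Longrightarrow> Ap_const q u \<le> ennreal K \<Longrightarrow>
      \<exists>v\<in>Muckenhoupt q. Ap_const q v = ennreal K \<and> (\<forall>x. u x \<le> v x \<and> v x \<le> S * u x)"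
    using Muckenhoupt_prescribed_constant[OF q K] by blast
  \<comment> \<open>The factor \<open>S\<close> pays for replacing \<open>W\<close> by the
    comparable weight \<open>v\<close>; the maximum with zero covers negative values of
    \<phi>.\<close>
  define C where "C = max 0 (\<phi> (ennreal K)) * S"
  show thesis
  proof (rule that[of C])
    show "0 \<le> C" using S by (simp add: C_def)
    fix F G W :: "real ^ 'n \<Rightarrow> real"
    assume FG [measurable]: "F \<in> borel_measurable lebesgue" "G \<in> borel_measurable lebesgue"
      and hyp: "\<And>W. W \<in> Muckenhoupt q \<Longrightarrow> pint q W F < top \<Longrightarrow> pint q W G \<le> ennreal (\<phi> (Ap_const q W)) * pint q W F"
      and W: "W \<in> Muckenhoupt q" "Ap_const q W \<le> ennreal K" "pint q W F < top"
    have [measurable]: "W \<in> borel_measurable lebesgue" using Muckenhoupt_regular[OF W(1)] by (simp add: regular_weight_def)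
    obtain v where v: "v \<in> Muckenhoupt q" "Ap_const q v = ennreal K" "\<And>x. W x \<le> v x" "\<And>x. v x \<le> S * W x"
      using S(2)[OF W(1,2)] by blast
    have vF: "pint q v F \<le> ennreal S * pint q W F" using v S by (intro pint_weight_cmult) auto
    have vft: "pint q v F < top" using W(3) by (intro le_less_trans[OF vF]) (simp add: ennreal_mult_less_top)
    have "pint q W G \<le> pint q v G" by (rule pint_weight_mono) (rule v)
    also have "\<dots> \<le> ennreal (\<phi> (ennreal K)) * pint q v F"
      using hyp[OF v(1) vft] v(2) by simp
    also have "\<dots> \<le> ennreal (max 0 (\<phi> (ennreal K))) * (ennreal S * pint q W F)"
      by (intro mult_mono vF ennreal_leI) auto
    also have "\<dots> = ennreal C * pint q W F" using S(1) by (simp only: ennreal_mult_mult C_def)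
    finally show "pint q W G \<le> ennreal C * pint q W F" .
  qed
qed

text \<open>A Morrey bound for \<open>F\<close> gives a bound for \<open>F\<close> with the weight
  localized at the cube in question, extrapolation carries it over to \<open>G\<close>, and on that
  cube the localized weight is at least \<mu> to the power -\<theta> times \<open>w\<close>.
  \<open>B\<close> is independent of the cube because one number \<open>U\<close> bounds the
  constants of all localized weights.\<close>

theorem morrey_transfer:
  fixes w :: "real ^ 'n \<Rightarrow> real" and \<phi> :: "ennreal \<Rightarrow> real"
  assumes q0: "1 \<le> q0" and q: "1 < q \<or> q = 1 \<and> q0 = 1" and w: "w \<in> Muckenhoupt q"
    and scale: "morrey_scale w \<mu> \<theta>"
  shows "\<exists>B\<ge>0. \<forall>F N. F \<in> borel_measurable lebesgue \<longrightarrow> (\<forall>x. 0 \<le> F x) \<longrightarrow> N < top \<longrightarrow>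
      (\<forall>c h. 0 < h \<longrightarrow> wmass (\<lambda>x. F x powr q * w x) (cub c h) \<le> N * ennreal (\<mu> c h powr \<theta>)) \<longrightarrow>
      (\<exists>W\<in>Muckenhoupt q0. pint q0 W F < top) \<and>
      (\<forall>G. G \<in> borel_measurable lebesgue \<longrightarrow> (\<forall>x. 0 \<le> G x) \<longrightarrow>
        (\<forall>W. W \<in> Muckenhoupt q0 \<longrightarrow> pint q0 W F < top \<longrightarrow>
           pint q0 W G \<le> ennreal (\<phi> (Ap_const q0 W)) * pint q0 W F) \<longrightarrow>
        (\<forall>c h. 0 < h \<longrightarrow> wmass (\<lambda>x. G x powr q * w x) (cub c h) \<le> ennreal B * N * ennreal (\<mu> c h powr \<theta>)))"
proof -
  have q1: "1 \<le> q" using q by auto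
  have rw: "regular_weight w" using w by (rule Muckenhoupt_regular)
  have [measurable]: "w \<in> borel_measurable lebesgue" and w0: "\<And>x. 0 \<le> w x" using rw by (auto simp: regular_weight_def)
  define K where "K = enn2real (Ap_const q w) + 1"
  have K: "Ap_const q w \<le> ennreal K" "0 < K"
  proof -
    have "Ap_const q w = ennreal (enn2real (Ap_const q w))" using w by (simp add: Muckenhoupt_def ennreal_enn2real_if less_top)
    also have "\<dots> \<le> ennreal K" by (rule ennreal_leI) (simp add: K_def)
    finally show "Ap_const q w \<le> ennreal K" .
  qed (simp add: K_def add_nonneg_pos)
  define D where "D = ((K + 1) powr (1/q) * 3 ^ CARD('n)) powr q"
  have D: "doubling D w" unfolding D_def
    by (rule thick_doubling[OF rw Muckenhoupt_thick[OF q1 w K]]) (use q1 K in auto)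
  note sc = scale[unfolded morrey_scale_def]
  obtain D' where D': "\<forall>c h. 0 < h \<longrightarrow> \<mu> c (2 * h) \<le> D' * \<mu> c h"
    using conjunct1[OF conjunct2[OF conjunct2[OF sc]]] by (rule exE)
  obtain \<beta> C where bc: "0 < \<beta> \<and> \<beta> < 1 \<and> 0 \<le> C \<and> (\<forall>c h. \<forall>i j::nat. 0 < h \<longrightarrow> i \<le> j \<longrightarrow>
       mass w c (2 ^ i * h) * \<mu> c (2 ^ i * h) powr (- \<theta>)
         \<le> C * (\<beta> ^ (j - i) * \<beta> ^ (j - i)) * (mass w c (2 ^ j * h) * \<mu> c (2 ^ j * h) powr (- \<theta>)))"
    using conjunct2[OF conjunct2[OF conjunct2[OF sc]]] by (elim exE)
  have \<theta>: "0 \<le> \<theta>" by (rule conjunct1[OF sc])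
  note \<mu>_all = conjunct1[OF conjunct2[OF sc]]
  have \<mu>: "\<And>c h. 0 < h \<Longrightarrow> 0 < \<mu> c h" using \<mu>_all by simp
  have \<beta>: "0 < \<beta>" "\<beta> < 1" and C: "0 \<le> C"
    using bc by simp_all
  note growth = conjunct2[OF conjunct2[OF conjunct2[OF bc]]]
  define L where "L = D' powr \<theta> / \<beta>"
  define A where "A = L ^ 2 + C * L ^ 3 * D * (1 / (1 - \<beta>))"
  note lw = localizing_weight[OF rw D \<mu>_all D' \<theta> \<beta> C growth, folded L_def, folded A_def]
  \<comment> \<open>\<open>A + 1\<close> ensures a positive factor in
    \<open>Muckenhoupt_times\<close>.\<close>
  define U where "U = (A + 1) * (K + 1)"
  have A0: "0 \<le> A"
  proof -
    have "0 \<le> L" using \<beta> by (simp add: L_def)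
    moreover have "0 < D" using D by (simp add: doubling_def)
    ultimately show ?thesis using C \<beta> by (simp add: A_def)
  qed
  have U0: "0 < U" using A0 K by (simp add: U_def)
  have loc: "\<exists>v u. v \<in> borel_measurable lebesgue \<and> (\<forall>x. 0 < v x) \<and> u = (\<lambda>x. v x * w x) \<and> (\<forall>x\<in>cub c h. \<mu> c h powr (- \<theta>) \<le> v x) \<and>
      u \<in> Muckenhoupt q \<and> Ap_const q u \<le> ennreal U \<and>
      (\<forall>F N. F \<in> borel_measurable lebesgue \<longrightarrow> 
        (\<forall>c h. 0 < h \<longrightarrow> wmass (\<lambda>x. F x powr q * w x) (cub c h) \<le> N * ennreal (\<mu> c h powr \<theta>)) \<longrightarrow>
        pint q u F \<le> ennreal (1 / (1 - \<beta>)) * N)" if h: "0 < h" for c h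
  proof (rule lw[OF h, where c = c])
    fix v :: "real ^ 'n \<Rightarrow> real"
    assume v [measurable]: "v \<in> borel_measurable lebesgue" and vp: "\<And>x. 0 < v x" 
    and vl: "\<And>x. x \<in> cub c h \<Longrightarrow> \<mu> c h powr (- \<theta>) \<le> v x"
    and vA: "\<And>c' h' x. 0 < h' \<Longrightarrow> x \<in> cub c' h' \<Longrightarrow> 
       wmass (\<lambda>x. v x * w x) (cub c' h') \<le> ennreal (A * v x) * wmass w (cub c' h')"
    and vN: "\<And>f N. f \<in> borel_measurable lebesgue \<Longrightarrow> 
       (\<And>h'. 0 < h' \<Longrightarrow> (\<integral>\<^sup>+x. f x * indicator (cub c h') x \<partial>lebesgue) \<le> N * ennreal (\<mu> c h' powr \<theta>)) \<Longrightarrow>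
       (\<integral>\<^sup>+x. f x * ennreal (v x) \<partial>lebesgue) \<le> ennreal (1 / (1 - \<beta>)) * N"
    let ?u = "\<lambda>x. v x * w x"
    have vA': "wmass ?u (cub c' h') \<le> ennreal ((A + 1) * v x) * wmass w (cub c' h')"
      if "0 < h'" "x \<in> cub c' h'" for c' h' x
    proof -
      have "ennreal (A * v x) * wmass w (cub c' h') \<le> ennreal ((A + 1) * v x) * wmass w (cub c' h')"
        using vp[of x] by (intro mult_right_mono ennreal_leI) auto
      then show ?thesis using vA[OF that] by (rule order_trans[rotated])
    qed
    have A1: "0 < A + 1" using A0 by simp
    note u = Muckenhoupt_times[OF q1 w K v vp A1 vA', folded U_def]
    have "pint q ?u F \<le> ennreal (1 / (1 - \<beta>)) * N" if [measurable]: "F \<in> borel_measurable lebesgue" and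
       F: "\<forall>c h. 0 < h \<longrightarrow> wmass (\<lambda>x. F x powr q * w x) (cub c h) \<le> N * ennreal (\<mu> c h powr \<theta>)" for F N
    proof -
      have "pint q ?u F = (\<integral>\<^sup>+x. ennreal (F x powr q * w x) * ennreal (v x) \<partial>lebesgue)"
        unfolding pint_def
      proof (intro nn_integral_cong)
        fix x
        show "ennreal (F x powr q * ?u x) = ennreal (F x powr q * w x) * ennreal (v x)"
          using w0[of x] vp[of x] by (subst ennreal_mult[symmetric]) (auto simp: mult_ac)
      qed
      also have "\<dots> \<le> ennreal (1 / (1 - \<beta>)) * N"
        using F by (intro vN) (auto simp: wmass_def)
      finally show ?thesis .
    qed
    then show ?thesis using v vp vl u by (intro exI[of _ v] exI[of _ ?u]) auto
  qed
  \<comment> \<open>For \<open>q = 1\<close> also \<open>q0 = 1\<close>, and the hypothesis applies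
    to the localized weight itself, made uniform by \<open>uniform_bound\<close>; for larger
    \<open>q\<close> it is reached by extrapolation.\<close>
  have weighted: "\<exists>B\<ge>0. \<forall>(u :: real ^ 'n \<Rightarrow> real) F. u \<in> Muckenhoupt q \<longrightarrow> Ap_const q u \<le> ennreal U \<longrightarrow> F \<in> borel_measurable lebesgue \<longrightarrow> 
      (\<forall>x. 0 \<le> F x) \<longrightarrow> pint q u F < top \<longrightarrow>
      (\<exists>W\<in>Muckenhoupt q0. pint q0 W F < top) \<and>
      (\<forall>G. G \<in> borel_measurable lebesgue \<longrightarrow> (\<forall>x. 0 \<le> G x) \<longrightarrow>
        (\<forall>W. W \<in> Muckenhoupt q0 \<longrightarrow> pint q0 W F < top \<longrightarrow> pint q0 W G \<le> ennreal (\<phi> (Ap_const q0 W)) * pint q0 W F) \<longrightarrow>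
        pint q u G \<le> ennreal B * pint q u F)"
    (is "\<exists>B\<ge>0. ?P B")
  proof (cases "q = 1")
    case True
    then have q01: "q0 = 1" using q by auto
    obtain B where B: "0 \<le> B" 
    "\<And>(F :: real ^ 'n \<Rightarrow> real) G W. F \<in> borel_measurable lebesgue \<Longrightarrow> G \<in> borel_measurable lebesgue \<Longrightarrow>
      (\<And>W. W \<in> Muckenhoupt q0 \<Longrightarrow> pint q0 W F < top \<Longrightarrow> pint q0 W G \<le> ennreal (\<phi> (Ap_const q0 W)) * pint q0 W F) \<Longrightarrow>
      W \<in> Muckenhoupt q0 \<Longrightarrow> Ap_const q0 W \<le> ennreal U \<Longrightarrow> pint q0 W F < top \<Longrightarrow> pint q0 W G \<le> ennreal B * pint q0 W F"
      using uniform_bound[OF q0 U0, of \<phi>] by blast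
    have "?P B"
    proof (intro allI impI conjI)
      fix u F :: "real ^ 'n \<Rightarrow> real" assume u: "u \<in> Muckenhoupt q" "Ap_const q u \<le> ennreal U" and F: "F \<in> borel_measurable lebesgue" 
        "\<forall>x. 0 \<le> F x" "pint q u F < top"
      show "\<exists>W\<in>Muckenhoupt q0. pint q0 W F < top" using u F True q01 by auto
      fix G :: "real ^ 'n \<Rightarrow> real" assume G: "G \<in> borel_measurable lebesgue" "\<forall>x. 0 \<le> G x" 
         "\<forall>W. W \<in> Muckenhoupt q0 \<longrightarrow> pint q0 W F < top \<longrightarrow> pint q0 W G \<le> ennreal (\<phi> (Ap_const q0 W)) * pint q0 W F"
      have "pint q0 u G \<le> ennreal B * pint q0 u F"
        by (rule B(2)[OF F(1) G(1)]) (use G u F True q01 in auto)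
      then show "pint q u G \<le> ennreal B * pint q u F" using True q01 by simp
    qed
    then show ?thesis using B(1) by blast
  next
    case False
    then have q2: "1 < q" using q by auto
    let ?k = "U powr (1/q)" let ?q = "q / (q - 1)"
    define K0 where "K0 = max (rdf_const CARD('n) q ?k) (rdf_const CARD('n) ?q ?k) powr q0"
    define B0 where "B0 = 2 powr q * 2 + 2 powr ?q * (2::real)"
    have K00: "0 < K0" using rdf_const_pos[of "CARD('n)" q ?k] by (simp add: K0_def less_max_iff_disj)
    obtain C where C: "0 \<le> C" 
    "\<And>(F :: real ^ 'n \<Rightarrow> real) G W. F \<in> borel_measurable lebesgue \<Longrightarrow> G \<in> borel_measurable lebesgue \<Longrightarrow>
      (\<And>W. W \<in> Muckenhoupt q0 \<Longrightarrow> pint q0 W F < top \<Longrightarrow> pint q0 W G \<le> ennreal (\<phi> (Ap_const q0 W)) * pint q0 W F) \<Longrightarrow>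
      W \<in> Muckenhoupt q0 \<Longrightarrow> Ap_const q0 W \<le> ennreal K0 \<Longrightarrow> pint q0 W F < top \<Longrightarrow> pint q0 W G \<le> ennreal C * pint q0 W F"
      using uniform_bound[OF q0 K00, of \<phi>] by blast
    let ?B = "((C + 1) * B0) powr q"
    have "?P ?B"
    proof (intro allI impI conjI)
      fix u F :: "real ^ 'n \<Rightarrow> real" assume u: "u \<in> Muckenhoupt q" "Ap_const q u \<le> ennreal U" and F: "F \<in> borel_measurable lebesgue" 
        "\<forall>x. 0 \<le> F x" "pint q u F < top"
      note dp = Muckenhoupt_dual_pair[OF q2 u(1) u(2) U0]
      note ex = extrapolation[OF q0 dp F(1) spec[OF F(2)] F(3), folded K0_def B0_def]
      show "\<exists>W\<in>Muckenhoupt q0. pint q0 W F < top" by (rule ex(1))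
      fix G :: "real ^ 'n \<Rightarrow> real" assume G: "G \<in> borel_measurable lebesgue" "\<forall>x. 0 \<le> G x" 
         "\<forall>W. W \<in> Muckenhoupt q0 \<longrightarrow> pint q0 W F < top \<longrightarrow> pint q0 W G \<le> ennreal (\<phi> (Ap_const q0 W)) * pint q0 W F"
      show "pint q u G \<le> ennreal ?B * pint q u F"
      proof (rule ex(2)[OF G(1) spec[OF G(2)] C(1)])
        fix W assume "W \<in> Muckenhoupt q0" "Ap_const q0 W \<le> ennreal K0" "pint q0 W F < top"
        then show "pint q0 W G \<le> ennreal C * pint q0 W F"
          by (intro C(2)[OF F(1) G(1)]) (use G in auto)
      qed
    qed
    then show ?thesis by (intro exI[of _ ?B]) auto
  qed
  then obtain B where B0: "0 \<le> B" and B: "?P B" by blast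
  let ?B = "B * (1 / (1 - \<beta>))"
  show ?thesis
  proof (intro exI[of _ ?B] conjI allI impI)
    show "0 \<le> ?B" using B0 \<beta> by simp
    fix F :: "real ^ 'n \<Rightarrow> real" and N assume F [measurable]: "F \<in> borel_measurable lebesgue" and F_nn: "\<forall>x. 0 \<le> F x" and N: "N < top"
      and F_bd: "\<forall>c h. 0 < h \<longrightarrow> wmass (\<lambda>x. F x powr q * w x) (cub c h) \<le> N * ennreal (\<mu> c h powr \<theta>)"
    note F0 = F_nn[rule_format] and FN = F_bd[rule_format]
    have uF: "pint q u F < top" if "pint q u F \<le> ennreal (1 / (1 - \<beta>)) * N" for u
      using that N by (auto simp: ennreal_mult_less_top intro: le_less_trans)
    show "\<exists>W\<in>Muckenhoupt q0. pint q0 W F < top"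
    proof -
      \<comment> \<open>Membership in the domain needs only one localized weight; the one at the
        unit cube is taken.\<close>
      obtain u where "u \<in> Muckenhoupt q" "Ap_const q u \<le> ennreal U" "pint q u F \<le> ennreal (1 / (1 - \<beta>)) * N"
        using loc[of 1 0] F FN by auto
      then show ?thesis using B F F0 uF by blast
    qed
    fix G :: "real ^ 'n \<Rightarrow> real" and c :: "real ^ 'n" and h :: real assume G [measurable]: "G \<in> borel_measurable lebesgue" and G0: "\<forall>x. 0 \<le> G x"
      and hyp: "\<forall>W. W \<in> Muckenhoupt q0 \<longrightarrow> pint q0 W F < top \<longrightarrow> pint q0 W G \<le> ennreal (\<phi> (Ap_const q0 W)) * pint q0 W F"
      and h: "0 < h"
    from loc[OF h, of c] obtain v u where v [measurable]: "v \<in> borel_measurable lebesgue" and vp: "\<And>x. 0 < v x" 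
      and u: "u = (\<lambda>x. v x * w x)" and vl: "\<And>x. x \<in> cub c h \<Longrightarrow> \<mu> c h powr (- \<theta>) \<le> v x"
      and uM: "u \<in> Muckenhoupt q" "Ap_const q u \<le> ennreal U"
      and uN: "\<And>F N. F \<in> borel_measurable lebesgue \<Longrightarrow> 
        (\<And>c h. 0 < h \<Longrightarrow> wmass (\<lambda>x. F x powr q * w x) (cub c h) \<le> N * ennreal (\<mu> c h powr \<theta>)) \<Longrightarrow>
        pint q u F \<le> ennreal (1 / (1 - \<beta>)) * N" by blast
    have FB: "pint q u F \<le> ennreal (1 / (1 - \<beta>)) * N" by (rule uN[OF F FN])
    have "pint q u G \<le> ennreal B * pint q u F"
      using B uM F F0 uF[OF FB] G G0 hyp by blast
    also have "\<dots> \<le> ennreal B * (ennreal (1 / (1 - \<beta>)) * N)" by (intro mult_left_mono FB) simp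
    also have "\<dots> = ennreal ?B * N" using B0 \<beta> by (intro ennreal_mult_mult) auto
    finally have GB: "pint q u G \<le> ennreal ?B * N" .
    have "wmass (\<lambda>x. G x powr q * w x) (cub c h) \<le> ennreal (\<mu> c h powr \<theta>) * pint q u G"
      unfolding wmass_def pint_def
    proof (intro nn_integral_cmult_le AE_I2)
      fix x
      show "ennreal (G x powr q * w x) * indicator (cub c h) x \<le> ennreal (\<mu> c h powr \<theta>) * ennreal (G x powr q * u x)"
      proof (cases "x \<in> cub c h")
        case True
        have "1 = \<mu> c h powr \<theta> * \<mu> c h powr (- \<theta>)" using \<mu>[OF h, of c] by (simp add: powr_minus)
        also have "\<dots> \<le> \<mu> c h powr \<theta> * v x" using vl[OF True] by (intro mult_left_mono) auto
        finally have "1 * (G x powr q * w x) \<le> \<mu> c h powr \<theta> * v x * (G x powr q * w x)"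
          using w0[of x] by (intro mult_right_mono) auto
        then have "G x powr q * w x \<le> \<mu> c h powr \<theta> * (G x powr q * u x)" by (simp add: u mult_ac)
        then show ?thesis using True by (subst ennreal_mult'[symmetric]) (auto intro: ennreal_leI)
      qed simp
    qed (unfold u, measurable)
    also have "\<dots> \<le> ennreal (\<mu> c h powr \<theta>) * (ennreal ?B * N)" by (intro mult_left_mono GB) simp
    finally show "wmass (\<lambda>x. G x powr q * w x) (cub c h) \<le> ennreal ?B * N * ennreal (\<mu> c h powr \<theta>)"
      by (simp only: mult.commute)
  qed
qed

subsection \<open>Growth of masses of concentric cubes\<close>

lemma wmass_split:
  assumes [measurable]: "w \<in> borel_measurable lebesgue" "E \<in> sets lebesgue" "Q \<in> sets lebesgue" and "E \<subseteq> Q"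
  shows "wmass w Q = wmass w E + wmass w (Q - E)"
proof -
  have "wmass w Q = (\<integral>\<^sup>+x. ennreal (w x) * indicator E x + ennreal (w x) * indicator (Q - E) x \<partial>lebesgue)"
    unfolding wmass_def using assms(4) by (intro nn_integral_cong) (auto simp: indicator_def)
  then show ?thesis unfolding wmass_def by (simp add: nn_integral_add)
qed

lemma annulus_mass:
  fixes w :: "real ^ 'n \<Rightarrow> real"
  assumes rw: "regular_weight w" and h: "0 < h"
  obtains e where "wmass w (cub c (2 * h) - cub c h) = ennreal e" "0 \<le> e" "mass w c (2 * h) = mass w c h + e"
proof -
  have [measurable]: "w \<in> borel_measurable lebesgue" using rw by (simp add: regular_weight_def)
  have h2: "0 < 2 * h" using h by simp
  have split: "wmass w (cub c (2 * h)) = wmass w (cub c h) + wmass w (cub c (2 * h) - cub c h)"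
    using h by (intro wmass_split cub_mono) auto
  have "wmass w (cub c (2 * h) - cub c h) \<le> wmass w (cub c (2 * h))" by (intro wmass_mono) auto
  then have "wmass w (cub c (2 * h) - cub c h) < top" using wmass_eq_mass[OF rw h2, of c] by (auto intro: le_less_trans)
  then obtain e where e: "wmass w (cub c (2 * h) - cub c h) = ennreal e" "0 \<le> e"
    by (cases "wmass w (cub c (2 * h) - cub c h)") auto
  have "ennreal (mass w c (2 * h)) = ennreal (mass w c h + e)"
    using split e wmass_eq_mass[OF rw h, of c] wmass_eq_mass[OF rw h2, of c] by simp
  then have "mass w c (2 * h) = mass w c h + e" using e by (subst (asm) ennreal_inj) (auto simp: mass_def)
  then show thesis using that e by blast
qed

text \<open>The annulus fills at least half of the larger cube, since \<open>2 ^ n \<ge> 2\<close>.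
  Thickness then gives it a fixed share of the mass.\<close>

lemma thick_annulus:
  fixes w :: "real ^ 'n \<Rightarrow> real"
  assumes rw: "regular_weight w" and th: "thick q (k powr (1/q)) w" and q: "1 \<le> q" and k: "0 < k" and h: "0 < h"
    and e: "wmass w (cub c (2 * h) - cub c h) = ennreal e" "0 \<le> e"
  shows "mass w c (2 * h) \<le> k * 2 powr q * e"
proof -
  let ?n = "CARD('n)"
  have h2: "0 < 2 * h" using h by simp
  define V where "V = (2 * (2 * h)) ^ ?n"
  have V: "emeasure lebesgue (cub c (2 * h)) = ennreal V" "0 < V"
    using h emeasure_cub[of "2 * h" c] by (auto simp: V_def)
  have "emeasure lebesgue (cub c (2 * h) - cub c h) = emeasure lebesgue (cub c (2 * h)) - emeasure lebesgue (cub c h)"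
    using h emeasure_cub[of h c] by (intro emeasure_Diff cub_mono) auto
  also have "\<dots> = ennreal V - ennreal ((2 * h) ^ ?n)" using V(1) h emeasure_cub[of h c] by simp
  also have "\<dots> = ennreal (V - (2 * h) ^ ?n)" using h by (intro ennreal_minus) simp
  finally have d: "emeasure lebesgue (cub c (2 * h) - cub c h) = ennreal (V - (2 * h) ^ ?n)" .
  have "2 * (2 * h) ^ ?n \<le> 2 ^ ?n * (2 * h) ^ ?n"
    using power_increasing[of 1 ?n "2::real"] h by (intro mult_right_mono) (auto simp: Suc_leI)
  then have "2 * (2 * h) ^ ?n \<le> V" unfolding V_def power_mult_distrib[of 2 "2 * h"] .
  then have Vd: "V / 2 \<le> V - (2 * h) ^ ?n" by simp
  have "(V - (2 * h) ^ ?n) powr q * mass w c (2 * h) \<le> k * V powr q * e"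
    by (rule thick_real[OF th _ k h2 _ _ wmass_eq_mass(1)[OF rw h2] _ e V(1) _ d])
      (use q V Vd wmass_eq_mass(2)[OF rw h2, of c] in auto)
  moreover have "(V / 2) powr q * mass w c (2 * h) \<le> (V - (2 * h) ^ ?n) powr q * mass w c (2 * h)"
    using Vd V q by (intro mult_right_mono powr_mono2) (auto simp: mass_def)
  ultimately have "(V / 2) powr q * mass w c (2 * h) \<le> k * V powr q * e" by simp
  then have "V powr q * mass w c (2 * h) \<le> V powr q * (k * 2 powr q * e)"
    using V by (simp add: powr_divide field_simps)
  then show ?thesis using V by simp
qed

text \<open>The enlarged constant \<open>a + 1\<close> keeps the ratio strictly between
  \<open>0\<close> and \<open>1\<close>.\<close>

lemma reverse_doubling:
  assumes "mass w c (2 * h) = mass w c h + e" "mass w c (2 * h) \<le> a * e" "0 < a" "0 \<le> e"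
  shows "mass w c h \<le> (1 - 1 / (a + 1)) * mass w c (2 * h)"
proof -
  have "mass w c (2 * h) \<le> (a + 1) * e" using assms by (simp add: algebra_simps)
  then have "mass w c (2 * h) / (a + 1) \<le> e" using assms(3) by (simp add: divide_le_eq mult.commute)
  then show ?thesis using assms(1) by (simp add: algebra_simps add_divide_distrib)
qed

lemma geometric_iterate:
  fixes f :: "nat \<Rightarrow> real"
  assumes "\<And>i. f i \<le> \<rho> * f (Suc i)" "0 \<le> \<rho>" "i \<le> j"
  shows "f i \<le> \<rho> ^ (j - i) * f j"
  using assms(3)
proof (induction j rule: dec_induct)
  case (step j)
  have "f i \<le> \<rho> ^ (j - i) * f j" by (rule step)
  also have "\<dots> \<le> \<rho> ^ (j - i) * (\<rho> * f (Suc j))" using assms by (intro mult_left_mono) auto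
  also have "\<dots> = \<rho> ^ (Suc j - i) * f (Suc j)" using step by (simp add: Suc_diff_le)
  finally show ?case .
qed simp

text \<open>A square root of the geometric rate, to match the squared factor in
  \<open>morrey_scale\<close>.\<close>

lemma half_power_ratio:
  assumes "0 < \<rho>" "\<rho> < (1::real)" "0 < e"
  obtains \<beta> where "0 < \<beta>" "\<beta> < 1" "\<And>k::nat. \<beta> ^ k * \<beta> ^ k = (\<rho> ^ k) powr e"
proof (rule that[of "\<rho> powr (e / 2)"])
  show "\<rho> powr (e / 2) < 1" using assms powr_less_mono2[of "e/2" \<rho> 1] by simp
  show "(\<rho> powr (e / 2)) ^ k * (\<rho> powr (e / 2)) ^ k = (\<rho> ^ k) powr e" for k :: nat
  proof -
    have "(\<rho> powr (e / 2)) ^ k * (\<rho> powr (e / 2)) ^ k = (\<rho> powr e) ^ k"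
      by (simp add: power_mult_distrib[symmetric] powr_add[symmetric])
    also have "\<dots> = (\<rho> ^ k) powr e"
      using assms by (simp add: powr_powr mult.commute flip: powr_realpow)
    finally show ?thesis .
  qed
qed (use assms in auto)

section \<open>The growth condition for both Morrey scales\<close>

lemma Muckenhoupt_thickE:
  fixes w :: "real ^ 'n \<Rightarrow> real"
  assumes "1 \<le> q" "w \<in> Muckenhoupt q"
  obtains k where "0 < k" "thick q (k powr (1/q)) w"
proof -
  let ?K = "enn2real (Ap_const q w) + 1"
  have "Ap_const q w = ennreal (enn2real (Ap_const q w))"
    using assms by (simp add: Muckenhoupt_def ennreal_enn2real_if less_top)
  also have "\<dots> \<le> ennreal ?K" by (rule ennreal_leI) simp
  finally have "thick q ((?K + 1) powr (1/q)) w"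
    by (intro Muckenhoupt_thick[OF assms]) (auto intro: add_nonneg_pos)
  moreover have "0 < ?K + 1" using enn2real_nonneg[of "Ap_const q w"] by linarith
  ultimately show thesis by (intro that[of "?K + 1"])
qed

text \<open>With \<mu> equal to the mass of \<open>w\<close>, the quantity that must grow is its
  power \<open>1 - \<theta>\<close>; reverse doubling gives a geometric rate because this exponent
  is positive.\<close>

lemma morrey_scale_mass:
  fixes w :: "real ^ 'n \<Rightarrow> real"
  assumes q: "1 \<le> q" and w: "w \<in> Muckenhoupt q" and \<theta>: "0 \<le> \<theta>" "\<theta> < 1"
  shows "morrey_scale w (mass w) \<theta>"
proof -
  have rw: "regular_weight w" using w by (rule Muckenhoupt_regular)
  obtain k where k: "0 < k" and th: "thick q (k powr (1/q)) w" using Muckenhoupt_thickE[OF q w] by blast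
  define a where "a = k * 2 powr q"
  have a0: "0 < a" using k by (simp add: a_def)
  define \<rho> where "\<rho> = 1 - 1 / (a + 1)"
  have \<rho>: "0 < \<rho>" "\<rho> < 1" using a0 by (auto simp: \<rho>_def)
  have pos: "0 < mass w c h" if "0 < h" for c h using wmass_eq_mass(2)[OF rw that] .
  have rev: "mass w c h \<le> \<rho> * mass w c (2 * h)" if h: "0 < h" for c h
  proof -
    obtain e where e: "wmass w (cub c (2 * h) - cub c h) = ennreal e" "0 \<le> e" "mass w c (2 * h) = mass w c h + e"
      using annulus_mass[OF rw h] by blast
    show ?thesis unfolding \<rho>_def
      by (rule reverse_doubling[OF e(3) _ a0 e(2)]) (unfold a_def, rule thick_annulus[OF rw th q k h e(1,2)])
  qed
  have mono: "mass w c h \<le> mass w c (2 * h)" if h: "0 < h" for c h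
  proof -
    have "\<rho> * mass w c (2 * h) \<le> 1 * mass w c (2 * h)" using \<rho> by (intro mult_right_mono) (auto simp: mass_def)
    then show ?thesis using rev[OF h, of c] by simp
  qed
  have dbl: "\<exists>D. \<forall>c h. 0 < h \<longrightarrow> mass w c (2 * h) \<le> D * mass w c h"
  proof (intro exI allI impI)
    fix c :: "real ^ 'n" and h :: real assume h: "0 < h"
    let ?D = "(k powr (1/q) * 2 ^ CARD('n)) powr q"
    have "wmass w (cub c (2 * h)) \<le> ennreal ?D * wmass w (cub c h)"
      using thick_scale[OF rw th, of h "2 * h" c c] h k q cub_mono[of h "2 * h" c] by simp
    then have "ennreal (mass w c (2 * h)) \<le> ennreal (?D * mass w c h)"
      using wmass_eq_mass[OF rw h, of c] wmass_eq_mass[OF rw, of "2 * h" c] h by (simp add: ennreal_mult less_imp_le)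
    then show "mass w c (2 * h) \<le> ?D * mass w c h"
      using pos[OF h, of c] by (subst (asm) ennreal_le_iff) auto
  qed
  obtain \<beta> where \<beta>: "0 < \<beta>" "\<beta> < 1" "\<And>k::nat. \<beta> ^ k * \<beta> ^ k = (\<rho> ^ k) powr (1 - \<theta>)"
    using half_power_ratio[OF \<rho>, of "1 - \<theta>"] \<theta> by auto
  have growth: "mass w c (2 ^ i * h) * mass w c (2 ^ i * h) powr (- \<theta>)
         \<le> 1 * (\<beta> ^ (j - i) * \<beta> ^ (j - i)) * (mass w c (2 ^ j * h) * mass w c (2 ^ j * h) powr (- \<theta>))"
    if h: "0 < h" and ij: "i \<le> j" for c h and i j :: nat
  proof -
    have eq: "m * m powr (- \<theta>) = m powr (1 - \<theta>)" if "0 < m" for m :: real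
      using powr_add[of m 1 "- \<theta>"] that by simp
    have p: "0 < mass w c (2 ^ i * h)" "0 < mass w c (2 ^ j * h)" using h by (auto intro: pos)
    have "mass w c (2 ^ i * h) \<le> \<rho> ^ (j - i) * mass w c (2 ^ j * h)"
      by (rule geometric_iterate[OF _ _ ij, of "\<lambda>i. mass w c (2 ^ i * h)"])
        (use rev[of "2 ^ i * h" c for i] h \<rho> in \<open>auto simp: mult.assoc\<close>)
    then have "mass w c (2 ^ i * h) powr (1 - \<theta>) \<le> (\<rho> ^ (j - i) * mass w c (2 ^ j * h)) powr (1 - \<theta>)"
      using \<theta> p by (intro powr_mono2) auto
    also have "\<dots> = (\<rho> ^ (j - i)) powr (1 - \<theta>) * mass w c (2 ^ j * h) powr (1 - \<theta>)"
      using \<rho> p by (simp add: powr_mult)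
    finally show ?thesis unfolding eq[OF p(1)] eq[OF p(2)] by (simp only: \<beta>(3) mult_1_left)
  qed
  show ?thesis unfolding morrey_scale_def
  proof (intro conjI)
    show "\<forall>c h. 0 < h \<longrightarrow> 0 < mass w c h \<and> mass w c h \<le> mass w c (2 * h)" using pos mono by blast
    show "\<exists>\<beta> C. 0 < \<beta> \<and> \<beta> < 1 \<and> 0 \<le> C \<and> (\<forall>c h. \<forall>i j::nat. 0 < h \<longrightarrow> i \<le> j \<longrightarrow>
       mass w c (2 ^ i * h) * mass w c (2 ^ i * h) powr (- \<theta>)
         \<le> C * (\<beta> ^ (j - i) * \<beta> ^ (j - i)) * (mass w c (2 ^ j * h) * mass w c (2 ^ j * h) powr (- \<theta>)))"
      by (rule exI[of _ \<beta>], rule exI[of _ 1], intro conjI allI impI growth) (use \<beta> in auto)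
  qed (use \<theta> dbl in auto)
qed

text \<open>\<open>w(Q)\<close> is comparable to the power \<open>1/\<sigma>\<close> of the mass of
  \<open>w powr \<sigma>\<close> times \<open>|Q|^(1 - 1/\<sigma>)\<close>, by Hoelder in one
  direction and reverse Hoelder in the other. After multiplication by
  \<open>|Q|^(-\<theta>)\<close>, the volume keeps a nonnegative exponent, so the geometric growth
  comes from \<open>w powr \<sigma>\<close> alone. This is why the endpoint \<theta> = 1 -
  1/\<sigma> is included.\<close>

lemma morrey_scale_volume:
  fixes w :: "real ^ 'n \<Rightarrow> real"
  assumes q: "1 \<le> q" and w: "w \<in> Muckenhoupt q" and RH: "w \<in> RevHolder \<sigma>" and \<sigma>: "1 < \<sigma>" 
    and \<theta>: "0 \<le> \<theta>" "\<theta> \<le> 1 - 1 / \<sigma>"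
  shows "morrey_scale w (\<lambda>c h. (2 * h) ^ CARD('n)) \<theta>"
proof -
  let ?n = "CARD('n)"
  have rw: "regular_weight w" using w by (rule Muckenhoupt_regular)
  have [measurable]: "w \<in> borel_measurable lebesgue" and w0: "\<And>x. 0 \<le> w x" and wp: "AE x in lebesgue. 0 < w x"
    using rw by (auto simp: regular_weight_def)
  obtain k where k: "0 < k" and th: "thick q (k powr (1/q)) w" using Muckenhoupt_thickE[OF q w] by blast
  let ?P = "\<lambda>x. w x powr \<sigma>"
  let ?V = "\<lambda>h::real. (2 * h) ^ ?n"
  obtain c0 where c0: "\<forall>Q\<in>cubes. epowr (avg ?P Q) (1 / \<sigma>) \<le> ennreal c0 * avg w Q"
    using RH by (auto simp: RevHolder_def)
  define R where "R = max 1 c0"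
  have V: "emeasure lebesgue (cub c h) = ennreal (?V h)" "0 < ?V h" if "0 < h" for c :: "real^'n" and h
    using emeasure_cub[of h c] that by auto
  have RH': "epowr (avg ?P (cub c h)) (1 / \<sigma>) \<le> ennreal (R * (mass w c h / ?V h))" if h: "0 < h" for c h
  proof -
    have "epowr (avg ?P (cub c h)) (1 / \<sigma>) \<le> ennreal c0 * avg w (cub c h)" using c0 cub_in_cubes[OF h] by blast
    also have "\<dots> \<le> ennreal R * avg w (cub c h)" by (intro mult_right_mono ennreal_leI) (auto simp: R_def)
    also have "avg w (cub c h) = ennreal (mass w c h / ?V h)"
      using wmass_eq_mass[OF rw h, of c] by (intro avg_cub V h) auto
    also have "ennreal R * \<dots> = ennreal (R * (mass w c h / ?V h))"
      by (rule ennreal_mult'[symmetric]) (simp add: R_def)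
    finally show ?thesis .
  qed
  have Pfin: "wmass ?P (cub c h) < top" if h: "0 < h" for c h
  proof (rule ccontr)
    assume "\<not> ?thesis"
    then have "wmass ?P (cub c h) = top" by (simp add: not_less top_unique)
    then have "avg ?P (cub c h) = top" unfolding avg_def V(1)[OF h] by (simp add: ennreal_top_divide)
    then have "top \<le> ennreal (R * (mass w c h / ?V h))" using RH'[OF h, of c] by simp
    then show False by (simp add: top_unique)
  qed
  have "AE x in lebesgue. 0 < ?P x" using wp by eventually_elim simp
  then have rP: "regular_weight ?P" using Pfin by (simp add: regular_weight_def)
  have pos: "0 < mass w c h" "0 < mass ?P c h" if "0 < h" for c h 
    using wmass_eq_mass(2)[OF rw that] wmass_eq_mass(2)[OF rP that] by auto
  have up: "mass ?P c h powr (1 / \<sigma>) * ?V h powr (1 - 1 / \<sigma>) \<le> R * mass w c h" if h: "0 < h" for c h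
  proof -
    have "avg ?P (cub c h) = ennreal (mass ?P c h / ?V h)"
      using wmass_eq_mass[OF rP h, of c] by (intro avg_cub V h) auto
    then have "ennreal ((mass ?P c h / ?V h) powr (1 / \<sigma>)) \<le> ennreal (R * (mass w c h / ?V h))"
      using RH'[OF h, of c] pos[OF h, of c] V(2)[OF h] by (simp add: epowr_ennreal)
    then have "(mass ?P c h / ?V h) powr (1 / \<sigma>) \<le> R * (mass w c h / ?V h)"
      using pos[OF h, of c] V(2)[OF h] by (subst (asm) ennreal_le_iff) (auto simp: R_def)
    then have "(mass ?P c h / ?V h) powr (1 / \<sigma>) * ?V h \<le> R * (mass w c h / ?V h) * ?V h"
      using V(2)[OF h] by (intro mult_right_mono) auto
    moreover have "(mass ?P c h / ?V h) powr (1 / \<sigma>) * ?V h = mass ?P c h powr (1 / \<sigma>) * ?V h powr (1 - 1 / \<sigma>)"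
      using V(2)[OF h] pos[OF h, of c] by (simp add: powr_divide powr_diff)
    ultimately show ?thesis using h by simp
  qed
  have holder: "wmass w E \<le> epowr (wmass ?P E) (1 / \<sigma>) * epowr (emeasure lebesgue E) (1 - 1 / \<sigma>)" 
    if [measurable]: "E \<in> sets lebesgue" for E
  proof -
    have "wmass w E = (\<integral>\<^sup>+x. epowr (ennreal (?P x) * indicator E x) (1 / \<sigma>) * epowr (indicator E x) (1 - 1 / \<sigma>) \<partial>lebesgue)"
      unfolding wmass_def using w0 \<sigma>
      by (intro nn_integral_cong) (auto simp: indicator_def epowr_ennreal powr_powr)
    also have "\<dots> \<le> epowr (wmass ?P E) (1 / \<sigma>) * epowr (\<integral>\<^sup>+x. indicator E x \<partial>lebesgue) (1 - 1 / \<sigma>)"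
      unfolding wmass_def by (rule holder_epowr) (use \<sigma> in auto)
    finally show ?thesis by simp
  qed
  have low: "mass w c h \<le> mass ?P c h powr (1 / \<sigma>) * ?V h powr (1 - 1 / \<sigma>)" if h: "0 < h" for c h
  proof -
    have "ennreal (mass w c h) \<le> ennreal (mass ?P c h powr (1 / \<sigma>) * ?V h powr (1 - 1 / \<sigma>))"
      using holder[OF cub_lebesgue, of c h] wmass_eq_mass[OF rw h, of c] wmass_eq_mass[OF rP h, of c] V(1)[OF h, of c] V(2)[OF h]
      by (simp only: epowr_ennreal less_imp_le ennreal_mult powr_ge_zero)
    then show ?thesis by (subst (asm) ennreal_le_iff) auto
  qed
  \<comment> \<open>The constants of the reverse Hoelder condition and of
    \<open>thick_annulus\<close>, raised to \<sigma> when the power \<open>1/\<sigma>\<close> is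
    undone.\<close>
  define a where "a = (R * (k * 2 powr q)) powr \<sigma>"
  have R1: "1 \<le> R" by (simp add: R_def)
  have a0: "0 < a" using k R1 by (simp add: a_def)
  define \<rho> where "\<rho> = 1 - 1 / (a + 1)"
  have \<rho>: "0 < \<rho>" "\<rho> < 1" using a0 by (auto simp: \<rho>_def)
  \<comment> \<open>The annulus has a fixed share of \<open>w\<close>. Hoelder on the annulus and
    reverse Hoelder on the large cube turn this into a fixed share of
    \<open>w powr \<sigma>\<close>.\<close>
  have rev: "mass ?P c h \<le> \<rho> * mass ?P c (2 * h)" if h: "0 < h" for c h
  proof -
    have h2: "0 < 2 * h" using h by simp
    let ?E = "cub c (2 * h) - cub c h"
    obtain e where e: "wmass w ?E = ennreal e" "0 \<le> e" using annulus_mass[OF rw h] by blast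
    obtain d where d: "wmass ?P ?E = ennreal d" "0 \<le> d" "mass ?P c (2 * h) = mass ?P c h + d"
      using annulus_mass[OF rP h] by blast
    let ?V2 = "?V (2 * h)"
    have "emeasure lebesgue ?E \<le> emeasure lebesgue (cub c (2 * h))" by (intro emeasure_mono) auto
    then have "epowr (emeasure lebesgue ?E) (1 - 1 / \<sigma>) \<le> epowr (ennreal ?V2) (1 - 1 / \<sigma>)"
      unfolding V(1)[OF h2] using \<sigma> by (intro epowr_mono) auto
    then have "wmass w ?E \<le> epowr (wmass ?P ?E) (1 / \<sigma>) * epowr (ennreal ?V2) (1 - 1 / \<sigma>)"
      using holder[of ?E] by (meson mult_left_mono order_trans zero_le cub_lebesgue sets.Diff)
    then have "ennreal e \<le> ennreal (d powr (1 / \<sigma>) * ?V2 powr (1 - 1 / \<sigma>))"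
      unfolding e(1) d(1) using d V(2)[OF h2] by (simp only: epowr_ennreal less_imp_le ennreal_mult powr_ge_zero)
    then have ed: "e \<le> d powr (1 / \<sigma>) * ?V2 powr (1 - 1 / \<sigma>)" by (subst (asm) ennreal_le_iff) auto
    have "mass ?P c (2 * h) powr (1 / \<sigma>) * ?V2 powr (1 - 1 / \<sigma>) \<le> R * mass w c (2 * h)" by (rule up[OF h2])
    also have "\<dots> \<le> R * (k * 2 powr q * e)"
      using thick_annulus[OF rw th q k h e] R1 by (intro mult_left_mono) auto
    also have "\<dots> \<le> R * (k * 2 powr q * (d powr (1 / \<sigma>) * ?V2 powr (1 - 1 / \<sigma>)))"
      using ed R1 k by (intro mult_left_mono) auto
    finally have "mass ?P c (2 * h) powr (1 / \<sigma>) * ?V2 powr (1 - 1 / \<sigma>) \<le> (R * (k * 2 powr q) * d powr (1 / \<sigma>)) * ?V2 powr (1 - 1 / \<sigma>)"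
      by (simp only: mult.assoc)
    moreover have "0 < ?V2 powr (1 - 1 / \<sigma>)" using h by simp
    ultimately have "mass ?P c (2 * h) powr (1 / \<sigma>) \<le> R * (k * 2 powr q) * d powr (1 / \<sigma>)"
      by (rule mult_right_le_imp_le)
    then have "(mass ?P c (2 * h) powr (1 / \<sigma>)) powr \<sigma> \<le> (R * (k * 2 powr q) * d powr (1 / \<sigma>)) powr \<sigma>"
      using \<sigma> by (intro powr_mono2) auto
    moreover have "(mass ?P c (2 * h) powr (1 / \<sigma>)) powr \<sigma> = mass ?P c (2 * h)"
      using \<sigma> pos(2)[OF h2, of c] by (simp add: powr_powr)
    moreover have "(R * (k * 2 powr q) * d powr (1 / \<sigma>)) powr \<sigma> = a * d"
      using \<sigma> d R1 k by (simp add: a_def powr_mult powr_powr)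
    ultimately have "mass ?P c (2 * h) \<le> a * d" by simp
    then show ?thesis unfolding \<rho>_def by (rule reverse_doubling[OF d(3) _ a0 d(2)])
  qed
  obtain \<beta> where \<beta>: "0 < \<beta>" "\<beta> < 1" "\<And>k::nat. \<beta> ^ k * \<beta> ^ k = (\<rho> ^ k) powr (1 / \<sigma>)"
    using half_power_ratio[OF \<rho>, of "1 / \<sigma>"] \<sigma> by auto
  have growth: "mass w c (2 ^ i * h) * ?V (2 ^ i * h) powr (- \<theta>)
         \<le> R * (\<beta> ^ (j - i) * \<beta> ^ (j - i)) * (mass w c (2 ^ j * h) * ?V (2 ^ j * h) powr (- \<theta>))"
    if h: "0 < h" and ij: "i \<le> j" for c h and i j :: nat
  proof -
    define hi where "hi = 2 ^ i * h"
    define hj where "hj = 2 ^ j * h"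
    have hij: "0 < hi" "0 < hj" "hi \<le> hj" using h ij by (auto simp: hi_def hj_def)
    let ?\<kappa> = "1 - 1 / \<sigma> - \<theta>"
    have "mass ?P c hi \<le> \<rho> ^ (j - i) * mass ?P c hj" unfolding hi_def hj_def
      by (rule geometric_iterate[OF _ _ ij, of "\<lambda>i. mass ?P c (2 ^ i * h)"])
        (use rev[of "2 ^ i * h" c for i] h \<rho> in \<open>auto simp: mult.assoc\<close>)
    then have "mass ?P c hi powr (1 / \<sigma>) \<le> (\<rho> ^ (j - i) * mass ?P c hj) powr (1 / \<sigma>)"
      using \<sigma> pos[OF hij(1), of c] by (intro powr_mono2) auto
    also have "\<dots> = (\<beta> ^ (j - i) * \<beta> ^ (j - i)) * mass ?P c hj powr (1 / \<sigma>)"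
      using \<rho> pos[OF hij(2), of c] by (simp only: \<beta>(3) powr_mult less_imp_le zero_le_power)
    finally have P: "mass ?P c hi powr (1 / \<sigma>) \<le> (\<beta> ^ (j - i) * \<beta> ^ (j - i)) * mass ?P c hj powr (1 / \<sigma>)" .
    have Vij: "?V hi powr ?\<kappa> \<le> ?V hj powr ?\<kappa>"
      using hij \<theta> by (intro powr_mono2 power_mono) auto
    have Veq: "?V x powr (1 - 1 / \<sigma>) * ?V x powr (- \<theta>) = ?V x powr ?\<kappa>" for x
      by (simp add: powr_add[symmetric])
    have "mass w c hi * ?V hi powr (- \<theta>) \<le> mass ?P c hi powr (1 / \<sigma>) * ?V hi powr (1 - 1 / \<sigma>) * ?V hi powr (- \<theta>)"
      by (intro mult_right_mono low hij) auto
    also have "\<dots> = mass ?P c hi powr (1 / \<sigma>) * ?V hi powr ?\<kappa>" by (simp only: mult.assoc Veq)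
    also have "\<dots> \<le> ((\<beta> ^ (j - i) * \<beta> ^ (j - i)) * mass ?P c hj powr (1 / \<sigma>)) * ?V hj powr ?\<kappa>"
      using \<beta> by (intro mult_mono P Vij) auto
    also have "\<dots> = (\<beta> ^ (j - i) * \<beta> ^ (j - i)) * (mass ?P c hj powr (1 / \<sigma>) * ?V hj powr (1 - 1 / \<sigma>)) * ?V hj powr (- \<theta>)"
      by (simp only: mult.assoc Veq)
    also have "\<dots> \<le> (\<beta> ^ (j - i) * \<beta> ^ (j - i)) * (R * mass w c hj) * ?V hj powr (- \<theta>)"
      using \<beta> by (intro mult_right_mono mult_left_mono up hij) auto
    finally show ?thesis unfolding hi_def hj_def by (simp only: mult_ac)
  qed
  show ?thesis unfolding morrey_scale_def
  proof (intro conjI)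
    show "\<forall>(c::real^'n) h. 0 < h \<longrightarrow> 0 < ?V h \<and> ?V h \<le> ?V (2 * h)" by (auto intro: power_mono)
    show "\<exists>D. \<forall>(c::real^'n) h. 0 < h \<longrightarrow> ?V (2 * h) \<le> D * ?V h"
      by (rule exI[of _ "2 ^ ?n"]) (simp only: power_mult_distrib[of 2 "2 * h" for h] order_refl simp_thms)
    show "\<exists>\<beta> C. 0 < \<beta> \<and> \<beta> < 1 \<and> 0 \<le> C \<and> (\<forall>c h. \<forall>i j::nat. 0 < h \<longrightarrow> i \<le> j \<longrightarrow>
       mass w c (2 ^ i * h) * ?V (2 ^ i * h) powr (- \<theta>)
         \<le> C * (\<beta> ^ (j - i) * \<beta> ^ (j - i)) * (mass w c (2 ^ j * h) * ?V (2 ^ j * h) powr (- \<theta>)))"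
      by (rule exI[of _ \<beta>], rule exI[of _ R], intro conjI allI impI growth) (use \<beta> R1 in auto)
  qed (use \<theta> in auto)
qed

subsection \<open>Operators on Morrey spaces\<close>

text \<open>Raising to the power \<open>p\<close> turns the exponent of the Morrey factor into minus
  \<theta>, where \<theta> = 1 + r p/n; the norm bound becomes the integral bound used by
  \<open>morrey_transfer\<close>.\<close>

lemma morrey_factor_le_iff:
  fixes Q :: "(real ^ 'n) set"
  assumes p: "0 < p" and m: "\<mu> Q = ennreal m" "0 < m"
  shows "morrey_factor p r \<mu> Q * epowr X (1 / p) \<le> M \<longleftrightarrow> X \<le> epowr M p * ennreal (m powr (1 + r * p / real CARD('n)))"
proof -
  let ?\<theta> = "1 + r * p / real CARD('n)"
  have "- ?\<theta> * (1 / p) = - (1 / p + r / real CARD('n))" using p by (simp add: field_simps)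
  then have "morrey_factor p r \<mu> Q = epowr (ennreal (m powr (- ?\<theta>))) (1 / p)"
    using m by (simp add: morrey_factor_def epowr_ennreal powr_powr)
  then have "morrey_factor p r \<mu> Q * epowr X (1 / p) = epowr (ennreal (m powr (- ?\<theta>)) * X) (1 / p)"
    using p by (simp add: epowr_mult)
  then have "morrey_factor p r \<mu> Q * epowr X (1 / p) \<le> M \<longleftrightarrow> ennreal (m powr (- ?\<theta>)) * X \<le> epowr M p"
    using p by (simp add: epowr_le_swap)
  also have "\<dots> \<longleftrightarrow> X \<le> epowr M p * ennreal (m powr ?\<theta>)"
  proof
    assume "ennreal (m powr (- ?\<theta>)) * X \<le> epowr M p"
    then have "ennreal (m powr ?\<theta>) * (ennreal (m powr (- ?\<theta>)) * X) \<le> ennreal (m powr ?\<theta>) * epowr M p"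
      by (rule mult_left_mono) simp
    moreover have "ennreal (m powr ?\<theta>) * (ennreal (m powr (- ?\<theta>)) * X) = X"
      using m by (subst ennreal_mult_mult) (simp_all only: powr_ge_zero powr_add[symmetric], simp)
    ultimately show "X \<le> epowr M p * ennreal (m powr ?\<theta>)" by (simp only: mult.commute)
  next
    assume "X \<le> epowr M p * ennreal (m powr ?\<theta>)"
    then have "ennreal (m powr (- ?\<theta>)) * X \<le> ennreal (m powr (- ?\<theta>)) * (ennreal (m powr ?\<theta>) * epowr M p)"
      by (intro mult_left_mono) (simp_all only: mult.commute zero_le)
    also have "\<dots> = epowr M p"
      using m by (subst ennreal_mult_mult) (simp_all only: powr_ge_zero powr_add[symmetric], simp)
    finally show "ennreal (m powr (- ?\<theta>)) * X \<le> epowr M p" .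
  qed
  finally show ?thesis .
qed

lemma ball_cubes_iff: "(\<forall>Q\<in>cubes. P Q) \<longleftrightarrow> (\<forall>c h. 0 < h \<longrightarrow> P (cub c h))"
  unfolding cubes_eq by blast

lemma morrey_sup_le_iff:
  fixes \<mu> :: "(real ^ 'n) set \<Rightarrow> ennreal"
  assumes p: "0 < p" and m: "\<And>c h. 0 < h \<Longrightarrow> \<mu> (cub c h) = ennreal (m c h)" "\<And>c h. 0 < h \<Longrightarrow> 0 < m c h"
  shows "(SUP Q\<in>cubes. morrey_factor p r \<mu> Q * Lp_norm p w Q f) \<le> M \<longleftrightarrow>
    (\<forall>c h. 0 < h \<longrightarrow> wmass (\<lambda>x. norm (f x) powr p * w x) (cub c h)
       \<le> epowr M p * ennreal (m c h powr (1 + r * p / real CARD('n))))"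
proof -
  note iff = morrey_factor_le_iff[where \<mu> = \<mu> and Q = "cub c h" and m = "m c h" for c h, OF p m]
  show ?thesis unfolding SUP_le_iff Lp_norm_def ball_cubes_iff by (simp only: iff cong: imp_cong)
qed

lemma weak_morrey_sup_le_iff:
  fixes \<mu> :: "(real ^ 'n) set \<Rightarrow> ennreal"
  assumes p: "0 < p" and m: "\<And>c h. 0 < h \<Longrightarrow> \<mu> (cub c h) = ennreal (m c h)" "\<And>c h. 0 < h \<Longrightarrow> 0 < m c h"
  shows "(SUP Q\<in>cubes. morrey_factor p r \<mu> Q * weak_Lp_norm p w Q f) \<le> M \<longleftrightarrow>
    (\<forall>c h t. 0 < h \<longrightarrow> 0 < t \<longrightarrow> ennreal (t powr p) * wmass w {x\<in>cub c h. t < norm (f x)}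
       \<le> epowr M p * ennreal (m c h powr (1 + r * p / real CARD('n))))"
proof -
  have weak: "weak_Lp_norm p w Q f = (SUP t\<in>{0<..}. epowr (ennreal (t powr p) * wmass w {x\<in>Q. t < norm (f x)}) (1 / p))" for Q
    unfolding weak_Lp_norm_def
  proof (intro SUP_cong refl)
    fix t :: real assume "t \<in> {0<..}"
    then show "ennreal t * epowr (wmass w {x\<in>Q. t < norm (f x)}) (1 / p) = epowr (ennreal (t powr p) * wmass w {x\<in>Q. t < norm (f x)}) (1 / p)"
      using p by (simp add: epowr_mult epowr_ennreal powr_powr)
  qed
  note iff = morrey_factor_le_iff[where \<mu> = \<mu> and Q = "cub c h" and m = "m c h" for c h, OF p m]
  show ?thesis
    unfolding SUP_le_iff weak SUP_mult_left_ennreal ball_cubes_iff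
    by (simp add: iff cong: imp_cong) blast
qed

section \<open>Reduction of the operator statements to pairs of functions\<close>

lemma Lp_norm_pint:
  assumes "0 < \<gamma>"
  shows "Lp_norm p w UNIV f = epowr (pint (p / \<gamma>) w (\<lambda>x. norm (f x) powr \<gamma>)) (1 / p)"
  using assms by (simp add: Lp_norm_def wmass_def pint_def powr_powr)

lemma epowr_ennreal_max: "epowr (ennreal c) p = ennreal (max 0 c powr p)"
  by (cases "0 \<le> c") (auto simp: epowr_ennreal max_def ennreal_neg)

text \<open>The set function \<mu> is kept general, so that the mass of \<open>w\<close> and the
  volume are two instances. The membership \<open>X \<subseteq> Lp_union\<close> is established
  before the bounds because measurability of \<open>T f\<close> is known only on the domain.\<close>

lemma morrey_bounds:
  fixes T :: "(real ^ 'n \<Rightarrow> complex) \<Rightarrow> (real ^ 'n \<Rightarrow> complex)" and c\<^sub>1 :: "ennreal \<Rightarrow> real"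
    and \<mu> :: "(real ^ 'n) set \<Rightarrow> ennreal"
  assumes \<gamma>: "1 \<le> \<gamma>" "\<gamma> \<le> p\<^sub>0" and T: "operator_on (Lp_union (p\<^sub>0 / \<gamma>) p\<^sub>0) T"
    and p: "\<gamma> < p \<or> p = \<gamma> \<and> p\<^sub>0 = \<gamma>" and w: "w \<in> Muckenhoupt (p / \<gamma>)"
    and m: "\<And>c h. 0 < h \<Longrightarrow> \<mu> (cub c h) = ennreal (m c h)" "\<And>c h. 0 < h \<Longrightarrow> 0 < m c h"
    and scale: "morrey_scale w m (1 + r * p / real CARD('n))"
  defines "nrm \<equiv> \<lambda>f. SUP Q\<in>cubes. morrey_factor p r \<mu> Q * Lp_norm p w Q f"
    and "wnrm \<equiv> \<lambda>f. SUP Q\<in>cubes. morrey_factor p r \<mu> Q * weak_Lp_norm p w Q f"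
  defines "X \<equiv> {f \<in> borel_measurable lebesgue. nrm f < top}"
  shows "X \<subseteq> Lp_union (p\<^sub>0 / \<gamma>) p\<^sub>0"
    and "\<forall>w\<in>Muckenhoupt (p\<^sub>0 / \<gamma>). \<forall>f\<in>Lp_space p\<^sub>0 w.
        Lp_norm p\<^sub>0 w UNIV (T f) \<le> ennreal (c\<^sub>1 (Ap_const (p\<^sub>0 / \<gamma>) w)) * Lp_norm p\<^sub>0 w UNIV f \<Longrightarrow>
      \<exists>c\<^sub>2::real. \<forall>f\<in>X. nrm (T f) \<le> ennreal c\<^sub>2 * nrm f"
    and "\<forall>w\<in>Muckenhoupt (p\<^sub>0 / \<gamma>). \<forall>f\<in>Lp_space p\<^sub>0 w.
        weak_Lp_norm p\<^sub>0 w UNIV (T f) \<le> ennreal (c\<^sub>1 (Ap_const (p\<^sub>0 / \<gamma>) w)) * Lp_norm p\<^sub>0 w UNIV f \<Longrightarrow>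
      \<exists>c\<^sub>2::real. \<forall>f\<in>X. wnrm (T f) \<le> ennreal c\<^sub>2 * nrm f"
proof -
  let ?q = "p / \<gamma>" and ?s = "p\<^sub>0 / \<gamma>" and ?\<theta> = "1 + r * p / real CARD('n)"
  have pos: "0 < \<gamma>" "0 < p" "0 < p\<^sub>0" using \<gamma> p by auto
  have q0: "1 \<le> ?s" using \<gamma> by simp
  have q: "1 < ?q \<or> ?q = 1 \<and> ?s = 1" using p
  proof
    assume "\<gamma> < p" then show ?thesis using pos by simp
  qed (use pos in simp)
  \<comment> \<open>The operator bound raised to the power \<open>p\<^sub>0\<close>, as
    \<open>pint\<close> carries no root; a negative value of \<open>c\<^sub>1\<close> acts as
    zero.\<close>
  define \<phi> where "\<phi> K = max 0 (c\<^sub>1 K) powr p\<^sub>0" for K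
  obtain B where B: "0 \<le> B" and transfer: "\<forall>F N. F \<in> borel_measurable lebesgue \<longrightarrow> (\<forall>x. 0 \<le> F x) \<longrightarrow> N < top \<longrightarrow>
      (\<forall>c h. 0 < h \<longrightarrow> wmass (\<lambda>x. F x powr ?q * w x) (cub c h) \<le> N * ennreal (m c h powr ?\<theta>)) \<longrightarrow>
      (\<exists>W\<in>Muckenhoupt ?s. pint ?s W F < top) \<and>
      (\<forall>G. G \<in> borel_measurable lebesgue \<longrightarrow> (\<forall>x. 0 \<le> G x) \<longrightarrow>
        (\<forall>W. W \<in> Muckenhoupt ?s \<longrightarrow> pint ?s W F < top \<longrightarrow>
           pint ?s W G \<le> ennreal (\<phi> (Ap_const ?s W)) * pint ?s W F) \<longrightarrow>
        (\<forall>c h. 0 < h \<longrightarrow> wmass (\<lambda>x. G x powr ?q * w x) (cub c h) \<le> ennreal B * N * ennreal (m c h powr ?\<theta>)))"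
    using morrey_transfer[OF q0 q w scale, where \<phi> = \<phi>] by (elim exE conjE)
  note dom = transfer[rule_format, THEN conjunct1]
    and bound = transfer[rule_format, THEN conjunct2, rule_format]
  let ?F = "\<lambda>f x. norm (f x :: complex) powr \<gamma>"
  have Fm: "?F f \<in> borel_measurable lebesgue" if [measurable]: "f \<in> borel_measurable lebesgue" for f :: "real ^ 'n \<Rightarrow> complex"
    by measurable
  have Fq: "?F f x powr ?q = norm (f x) powr p" for f and x :: "real ^ 'n" using pos by (simp add: powr_powr)
  have nrm_le_iff: "nrm f \<le> M \<longleftrightarrow> (\<forall>c h. 0 < h \<longrightarrow> wmass (\<lambda>x. norm (f x) powr p * w x) (cub c h)
       \<le> epowr M p * ennreal (m c h powr ?\<theta>))" for f M
    unfolding nrm_def by (rule morrey_sup_le_iff[OF pos(2)]) (fact m)+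
  have wnrm_le_iff: "wnrm f \<le> M \<longleftrightarrow> (\<forall>c h t. 0 < h \<longrightarrow> 0 < t \<longrightarrow>
       ennreal (t powr p) * wmass w {x\<in>cub c h. t < norm (f x)} \<le> epowr M p * ennreal (m c h powr ?\<theta>))" for f M
    unfolding wnrm_def by (rule weak_morrey_sup_le_iff[OF pos(2)]) (fact m)+
  have FN: "wmass (\<lambda>x. ?F f x powr ?q * w x) (cub c h) \<le> epowr (nrm f) p * ennreal (m c h powr ?\<theta>)" if "0 < h" for f c h
    unfolding Fq using nrm_le_iff[of f "nrm f"] that by blast
  have Nfin: "epowr (nrm f) p < top" if "f \<in> X" for f using that by (simp add: X_def)
  have Xm: "f \<in> borel_measurable lebesgue" if "f \<in> X" for f using that by (simp add: X_def)
  have Lp: "f \<in> Lp_space p\<^sub>0 W" if "f \<in> X" "pint ?s W (?F f) < top" for f W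
    using that by (simp add: Lp_space_def Xm Lp_norm_pint[OF pos(1)])
  show sub: "X \<subseteq> Lp_union ?s p\<^sub>0"
  proof
    fix f assume f: "f \<in> X"
    obtain W where "W \<in> Muckenhoupt ?s" "pint ?s W (?F f) < top"
      using dom[OF Fm[OF Xm[OF f]] powr_ge_zero Nfin[OF f] FN] by blast
    then show "f \<in> Lp_union ?s p\<^sub>0" using Lp[OF f] unfolding Lp_union_def by blast
  qed
  have Tm: "T f \<in> borel_measurable lebesgue" if "f \<in> X" for f
    using T sub that by (auto simp: operator_on_def)
  let ?c = "B powr (1 / p)"
  have cN: "epowr (ennreal ?c * M) p = ennreal B * epowr M p" for M
    using pos B by (simp add: epowr_mult epowr_ennreal powr_powr)
  have raise: "pint ?s W G \<le> ennreal (\<phi> (Ap_const ?s W)) * pint ?s W (?F f)"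
    if "epowr (pint ?s W G) (1 / p\<^sub>0) \<le> ennreal (c\<^sub>1 (Ap_const ?s W)) * Lp_norm p\<^sub>0 W UNIV f" for W G f
  proof -
    have "epowr (epowr (pint ?s W G) (1 / p\<^sub>0)) p\<^sub>0 \<le> epowr (ennreal (c\<^sub>1 (Ap_const ?s W)) * Lp_norm p\<^sub>0 W UNIV f) p\<^sub>0"
      using that pos by (intro epowr_mono) auto
    then show ?thesis
      using pos by (simp add: epowr_epowr epowr_mult Lp_norm_pint[OF pos(1)] epowr_ennreal_max \<phi>_def)
  qed
  show "\<exists>c\<^sub>2::real. \<forall>f\<in>X. nrm (T f) \<le> ennreal c\<^sub>2 * nrm f"
    if H: "\<forall>w\<in>Muckenhoupt (p\<^sub>0 / \<gamma>). \<forall>f\<in>Lp_space p\<^sub>0 w.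
        Lp_norm p\<^sub>0 w UNIV (T f) \<le> ennreal (c\<^sub>1 (Ap_const (p\<^sub>0 / \<gamma>) w)) * Lp_norm p\<^sub>0 w UNIV f"
  proof (intro exI ballI)
    fix f assume f: "f \<in> X"
    have "wmass (\<lambda>x. ?F (T f) x powr ?q * w x) (cub c h) \<le> ennreal B * epowr (nrm f) p * ennreal (m c h powr ?\<theta>)"
      if h: "0 < h" for c h
    proof (rule bound[OF Fm[OF Xm[OF f]] powr_ge_zero Nfin[OF f] FN Fm[OF Tm[OF f]] powr_ge_zero _ h])
      fix W :: "real ^ 'n \<Rightarrow> real" assume W: "W \<in> Muckenhoupt ?s" "pint ?s W (?F f) < top"
      show "pint ?s W (?F (T f)) \<le> ennreal (\<phi> (Ap_const ?s W)) * pint ?s W (?F f)"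
        using H[rule_format, OF W(1) Lp[OF f W(2)]] by (intro raise) (simp only: Lp_norm_pint[OF pos(1), of p\<^sub>0 W "T f"])
    qed
    then show "nrm (T f) \<le> ennreal ?c * nrm f"
      unfolding nrm_le_iff cN Fq by blast
  qed
  show "\<exists>c\<^sub>2::real. \<forall>f\<in>X. wnrm (T f) \<le> ennreal c\<^sub>2 * nrm f"
    if H: "\<forall>w\<in>Muckenhoupt (p\<^sub>0 / \<gamma>). \<forall>f\<in>Lp_space p\<^sub>0 w.
        weak_Lp_norm p\<^sub>0 w UNIV (T f) \<le> ennreal (c\<^sub>1 (Ap_const (p\<^sub>0 / \<gamma>) w)) * Lp_norm p\<^sub>0 w UNIV f"
  proof (intro exI ballI)
    fix f assume f: "f \<in> X"
    have [measurable]: "T f \<in> borel_measurable lebesgue" by (rule Tm[OF f])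
    have "ennreal (t powr p) * wmass w {x\<in>cub c h. t < norm (T f x)} \<le> ennreal B * epowr (nrm f) p * ennreal (m c h powr ?\<theta>)"
      if h: "0 < h" and t: "0 < t" for c h t
    proof -
      \<comment> \<open>At a fixed level \<open>t\<close>, the hypothesis for \<open>?G\<close> is
        one term of the supremum in the weak norm, and the conclusion is one term of the weak Morrey
        norm.\<close>
      let ?G = "\<lambda>x. (t * indicator {x. t < norm (T f x)} x) powr \<gamma>"
      have Gm: "?G \<in> borel_measurable lebesgue" by measurable
      have Gs: "?G x powr (s / \<gamma>) * v x = t powr s * (v x * indicator {x. t < norm (T f x)} x)" if "0 < s" for s v x
        using pos t that by (auto simp: indicator_def powr_powr)
      have GI: "(\<integral>\<^sup>+x. ennreal (?G x powr (s / \<gamma>) * v x) * indicator E x \<partial>lebesgue)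
          = ennreal (t powr s) * wmass v {x\<in>E. t < norm (T f x)}"
        if s: "0 < s" and [measurable]: "v \<in> borel_measurable lebesgue" "E \<in> sets lebesgue" for s v E
      proof -
        have "(\<integral>\<^sup>+x. ennreal (?G x powr (s / \<gamma>) * v x) * indicator E x \<partial>lebesgue) =
          (\<integral>\<^sup>+x. ennreal (t powr s) * (ennreal (v x) * indicator {x\<in>E. t < norm (T f x)} x) \<partial>lebesgue)"
          unfolding Gs[OF s] by (intro nn_integral_cong) (auto simp: indicator_def ennreal_mult')
        also have "\<dots> = ennreal (t powr s) * wmass v {x\<in>E. t < norm (T f x)}"
          unfolding wmass_def by (rule nn_integral_cmult) measurable
        finally show ?thesis .
      qed
      have "wmass (\<lambda>x. ?G x powr ?q * w x) (cub c h) \<le> ennreal B * epowr (nrm f) p * ennreal (m c h powr ?\<theta>)"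
      proof (rule bound[OF Fm[OF Xm[OF f]] powr_ge_zero Nfin[OF f] FN Gm powr_ge_zero _ h])
        fix W :: "real ^ 'n \<Rightarrow> real" assume W: "W \<in> Muckenhoupt ?s" "pint ?s W (?F f) < top"
        have [measurable]: "W \<in> borel_measurable lebesgue"
          using Muckenhoupt_regular[OF W(1)] by (simp add: regular_weight_def)
        have "pint ?s W ?G = ennreal (t powr p\<^sub>0) * wmass W {x\<in>UNIV. t < norm (T f x)}"
          using GI[OF pos(3), of W UNIV] by (simp add: pint_def)
        then have "epowr (pint ?s W ?G) (1 / p\<^sub>0) = ennreal t * epowr (wmass W {x\<in>UNIV. t < norm (T f x)}) (1 / p\<^sub>0)"
          using pos t by (simp add: epowr_mult epowr_ennreal powr_powr)
        also have "\<dots> \<le> weak_Lp_norm p\<^sub>0 W UNIV (T f)"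
          unfolding weak_Lp_norm_def using t by (intro SUP_upper) simp
        also have "\<dots> \<le> ennreal (c\<^sub>1 (Ap_const ?s W)) * Lp_norm p\<^sub>0 W UNIV f" by (rule H[rule_format, OF W(1) Lp[OF f W(2)]])
        finally show "pint ?s W ?G \<le> ennreal (\<phi> (Ap_const ?s W)) * pint ?s W (?F f)" by (rule raise)
      qed
      moreover have "wmass (\<lambda>x. ?G x powr ?q * w x) (cub c h) = ennreal (t powr p) * wmass w {x\<in>cub c h. t < norm (T f x)}"
        using GI[OF pos(2), of w "cub c h"] Muckenhoupt_regular[OF w] by (simp add: wmass_def regular_weight_def)
      ultimately show ?thesis by simp
    qed
    then show "wnrm (T f) \<le> ennreal ?c * nrm f"
      unfolding wnrm_le_iff cN by blast
  qed
qed

theorem corollary4p4: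
  fixes T :: "(real ^ 'n \<Rightarrow> complex) \<Rightarrow> (real ^ 'n \<Rightarrow> complex)"
    and \<gamma> p\<^sub>0 :: real
  assumes "1 \<le> \<gamma>" and "\<gamma> \<le> p\<^sub>0"
    and "operator_on (Lp_union (p\<^sub>0 / \<gamma>) p\<^sub>0) T"
  shows
    "((\<exists>c\<^sub>1 :: ennreal \<Rightarrow> real. \<forall>w\<in>Muckenhoupt (p\<^sub>0 / \<gamma>). \<forall>f\<in>Lp_space p\<^sub>0 w.
          Lp_norm p\<^sub>0 w UNIV (T f) \<le> ennreal (c\<^sub>1 (Ap_const (p\<^sub>0 / \<gamma>) w)) * Lp_norm p\<^sub>0 w UNIV f)
      \<longrightarrow> (\<forall>p::real. \<gamma> < p \<or> (p = \<gamma> \<and> p\<^sub>0 = \<gamma>) \<longrightarrow>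
        (\<forall>r::real. \<forall>w\<in>Muckenhoupt (p / \<gamma>).
           - real CARD('n) / p \<le> r \<and> r < 0 \<longrightarrow>
             morrey_space p r w \<subseteq> Lp_union (p\<^sub>0 / \<gamma>) p\<^sub>0 \<and>
             (\<exists>c\<^sub>2::real. \<forall>f\<in>morrey_space p r w.
                morrey_norm p r w (T f) \<le> ennreal c\<^sub>2 * morrey_norm p r w f)) \<and>
        (\<forall>(\<sigma>::real) (r::real). \<forall>w\<in>Muckenhoupt (p / \<gamma>) \<inter> RevHolder \<sigma>.
           1 < \<sigma> \<and> - real CARD('n) / p \<le> r \<and> r \<le> - real CARD('n) / (p * \<sigma>) \<longrightarrow>
             lam_morrey_space p r w \<subseteq> Lp_union (p\<^sub>0 / \<gamma>) p\<^sub>0 \<and>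
             (\<exists>c\<^sub>3::real. \<forall>f\<in>lam_morrey_space p r w.
                lam_morrey_norm p r w (T f) \<le> ennreal c\<^sub>3 * lam_morrey_norm p r w f))))
     \<and>
     ((\<exists>c\<^sub>1 :: ennreal \<Rightarrow> real. \<forall>w\<in>Muckenhoupt (p\<^sub>0 / \<gamma>). \<forall>f\<in>Lp_space p\<^sub>0 w.
          weak_Lp_norm p\<^sub>0 w UNIV (T f) \<le> ennreal (c\<^sub>1 (Ap_const (p\<^sub>0 / \<gamma>) w)) * Lp_norm p\<^sub>0 w UNIV f)
      \<longrightarrow> (\<forall>p::real. \<gamma> < p \<or> (p = \<gamma> \<and> p\<^sub>0 = \<gamma>) \<longrightarrow>
        (\<forall>r::real. \<forall>w\<in>Muckenhoupt (p / \<gamma>).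
           - real CARD('n) / p \<le> r \<and> r < 0 \<longrightarrow>
             morrey_space p r w \<subseteq> Lp_union (p\<^sub>0 / \<gamma>) p\<^sub>0 \<and>
             (\<exists>c\<^sub>2::real. \<forall>f\<in>morrey_space p r w.
                weak_morrey_norm p r w (T f) \<le> ennreal c\<^sub>2 * morrey_norm p r w f)) \<and>
        (\<forall>(\<sigma>::real) (r::real). \<forall>w\<in>Muckenhoupt (p / \<gamma>) \<inter> RevHolder \<sigma>.
           1 < \<sigma> \<and> - real CARD('n) / p \<le> r \<and> r \<le> - real CARD('n) / (p * \<sigma>) \<longrightarrow>
             lam_morrey_space p r w \<subseteq> Lp_union (p\<^sub>0 / \<gamma>) p\<^sub>0 \<and>
             (\<exists>c\<^sub>3::real. \<forall>f\<in>lam_morrey_space p r w.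
                weak_lam_morrey_norm p r w (T f) \<le> ennreal c\<^sub>3 * lam_morrey_norm p r w f))))"
proof -
  have pos: "0 < p" if "\<gamma> < p \<or> (p = \<gamma> \<and> p\<^sub>0 = \<gamma>)" for p using that assms(1) by auto
  have q1: "1 \<le> p / \<gamma>" if "\<gamma> < p \<or> (p = \<gamma> \<and> p\<^sub>0 = \<gamma>)" for p using that assms(1) by auto
  have lower: "0 \<le> 1 + r * p / real CARD('n)" if "0 < p" "- real CARD('n) / p \<le> r" for p r
    using that by (simp add: field_simps)
  have mass_scale: "morrey_scale w (mass w) (1 + r * p / real CARD('n))"
    if p: "\<gamma> < p \<or> (p = \<gamma> \<and> p\<^sub>0 = \<gamma>)" and w: "w \<in> Muckenhoupt (p / \<gamma>)" 
      and r: "- real CARD('n) / p \<le> r \<and> r < 0" for p r and w :: "real ^ 'n \<Rightarrow> real"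
    using r pos[OF p] by (intro morrey_scale_mass[OF q1[OF p] w] lower) (auto simp: mult_neg_pos divide_neg_pos)
  have volume_scale: "morrey_scale w (\<lambda>c h. (2 * h) ^ CARD('n)) (1 + r * p / real CARD('n))"
    if p: "\<gamma> < p \<or> (p = \<gamma> \<and> p\<^sub>0 = \<gamma>)" and w: "w \<in> Muckenhoupt (p / \<gamma>) \<inter> RevHolder \<sigma>" 
      and r: "1 < \<sigma> \<and> - real CARD('n) / p \<le> r \<and> r \<le> - real CARD('n) / (p * \<sigma>)" 
    for p r \<sigma> and w :: "real ^ 'n \<Rightarrow> real"
  proof (rule morrey_scale_volume[OF q1[OF p]])
    have "r * (p * \<sigma>) \<le> - real CARD('n) / (p * \<sigma>) * (p * \<sigma>)"
      using r pos[OF p] by (intro mult_right_mono) auto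
    \<comment> \<open>The upper bound on \<open>r\<close> is exactly \<theta> \<le> 1 -
      1/\<sigma>.\<close>
    then have "r * (p * \<sigma>) \<le> - real CARD('n)" using r pos[OF p] by simp
    then have "r * p / real CARD('n) \<le> - 1 / \<sigma>" using r by (simp add: field_simps)
    then show "1 + r * p / real CARD('n) \<le> 1 - 1 / \<sigma>" by simp
  qed (use w r lower[OF pos[OF p]] in auto)
  have mass: "wmass w (cub c h) = ennreal (mass w c h)" "0 < mass w c h" 
    if "w \<in> Muckenhoupt q" "0 < h" for q c h and w :: "real ^ 'n \<Rightarrow> real"
    using wmass_eq_mass[OF Muckenhoupt_regular[OF that(1)] that(2)] by auto
  have volume: "emeasure lebesgue (cub c h) = ennreal ((2 * h) ^ CARD('n))" "0 < (2 * h) ^ CARD('n)"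
    if "0 < h" for c :: "real ^ 'n" and h
    using that by (simp_all only: emeasure_cub less_imp_le) simp
  note mass_case = morrey_bounds[where \<mu> = "wmass w" and m = "mass w" for w, OF assms _ _ mass mass_scale]
    and volume_case = morrey_bounds[where \<mu> = "emeasure lebesgue" and m = "\<lambda>c h. (2 * h) ^ CARD('n)",
      OF assms _ IntD1 volume volume_scale]
  show ?thesis
    unfolding morrey_space_def lam_morrey_space_def morrey_norm_def lam_morrey_norm_def
      weak_morrey_norm_def weak_lam_morrey_norm_def
    by (rule conjI; intro impI; elim exE; intro allI impI ballI conjI;
      ((rule mass_case(1) mass_case(2) mass_case(3), assumption+)
        | (rule volume_case(1) volume_case(2) volume_case(3), assumption+)))
qed

end
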